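(* Let $(E,\|\cdot\|)$ be a complete random normed module over $\mathbb{R}$ with base $(\Omega,\mathcal{F},P)$ having full support. An operator $T:\mathscr{C}(E)\to\mathscr{C}(E)$ is stable and fully order preserving if and only if there exist $c\in E$, $w\in E^*$, $\beta\in L^0(\mathcal{F})$, $\tau\in L^0_{++}(\mathcal{F})$ and a continuous module automorphism $H$ of $E$ such that $$T(f)(x)=\tau f(H(x)+c)+w(x)+\beta\qquad\text{for all } x\in E \text{ and } f\in\mathscr{C}(E).$$
   Context: $(\Omega,\mathcal{F},P)$ is a probability space. $L^0(\mathcal{F})$ is the algebra of equivalence classes (under a.s. equality) of real-valued random variables, and $\bar L^0(\mathcal{F})$ is the set of equivalence classes of extended real-valued random variables, ordered by $\xi\le\eta$ iff $\xi\le\eta$ a.s.; it is a complete lattice, and $\vee H,\wedge H$ denote supremum and infimum. "$\xi>\eta$ on $A$" means $\xi(\omega)>\eta(\omega)$ for almost all $\omega\in A$. $L^0_+(\mathcal{F})=\{\xi\in L^0(\mathcal{F}):\xi\ge 0\}$, $L^0_{++}(\mathcal{F})=\{\xi\in L^0(\mathcal{F}):\xi>0\text{ on }\Omega\}$. $\tilde I_A$ is the class of the characteristic function of $A\in\mathcal{F}$, $A^c=\Omega\setminus A$. Convention: $0\cdot(+\infty)=0$. A random normed (RN) module over $\mathbb{R}$ with base $(\Omega,\mathcal{F},P)$ is an $L^0(\mathcal{F})$-module $E$ with a map $\|\cdot\|:E\to L^0_+(\mathcal{F})$ such that $\|\xi x\|=|\xi|\|x\|$, $\|x+y\|\le\|x\|+\|y\|$,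 and $\|x\|=0$ implies $x=\theta$ (the null element), for all $\xi\in L^0(\mathcal{F})$, $x,y\in E$. It carries the $(\varepsilon,\lambda)$-topology, a metrizable linear topology with local base at $\theta$ the sets $\{x:P(\|x\|<\varepsilon)>1-\lambda\}$, $\varepsilon>0$, $0<\lambda<1$ (so $x_n\to x$ iff $\|x_n-x\|\to0$ in probability); completeness, closedness and continuity refer to this topology. $L^0(\mathcal{F})$ is an RN module with $|\cdot|$. $E$ has full support if $\vee\{\|x\|:x\in E\}>0$ on $\Omega$. $E^*$ is the $L^0(\mathcal{F})$-module of continuous module homomorphisms $E\to L^0(\mathcal{F})$. $\mathscr{C}(E)$ is the set of proper lower semicontinuous $L^0$-convex functions, i.e. maps $f:E\to\bar L^0(\mathcal{F})$ such that: (1) $f(x)>-\infty$ on $\Omega$ for all $x\in E$; (2) $dom(f)=\{x\in E:f(x)<+\infty\text{ on }\Omega\}\neq\emptyset$; (3) $f(\xi x+(1-\xi)y)\le\xi f(x)+(1-\xi)f(y)$ for all $x,y\in E$ and $\xi\in L^0_+(\mathcal{F})$ with $0\le\xi\le1$; (4) $epi(f)=\{(x,r)\in E\times L^0(\mathcal{F}):f(x)\le r\}$ is closed in the RN module $E\times L^0(\mathcal{F})$ with $L^0$-norm $\|x\|+|r|$. For $f,g\in\mathscr{C}(E)$, $f\le g$ means $f(x)\le g(x)$ for all $x\in E$; $\tilde I_Af+\tilde I_{A^c}g$ is defined pointwise and belongs to $\mathscr{C}(E)$. An operator $T:\mathscr{C}(E)\to\mathscr{C}(E)$ is fully order preserving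 if it is onto and, for all $f,g$, $f\le g$ iff $T(f)\le T(g)$; it is stable if $T(\tilde I_Af+\tilde I_{A^c}g)=\tilde I_AT(f)+\tilde I_{A^c}T(g)$ for all $A\in\mathcal{F}$ and $f,g\in\mathscr{C}(E)$. *)

theory Defs
  imports "HOL-Probability.Probability_Measure" "HOL-Algebra.Module"
begin

section \<open>Equivalence classes of random variables\<close>

text \<open>A class is represented by the set of all its members; the notions below are polymorphic
  in the value type, which is \<^typ>\<open>real\<close> for \<open>L\<^sup>0\<close> and \<^typ>\<open>ereal\<close> for the extended
  version of \<open>L\<^sup>0\<close>.\<close>

definition ae_class :: "'w measure \<Rightarrow> ('w \<Rightarrow> 'b::topological_space) \<Rightarrow> ('w \<Rightarrow> 'b) set" where
  "ae_class M f = {g \<in> borel_measurable M. AE \<omega> in M. g \<omega> = f \<omega>}"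

definition ae_classes :: "'w measure \<Rightarrow> ('w \<Rightarrow> 'b::topological_space) set set" where
  "ae_classes M = ae_class M ` borel_measurable M"

definition rep :: "('w \<Rightarrow> 'b) set \<Rightarrow> 'w \<Rightarrow> 'b" where
  "rep X = (SOME f. f \<in> X)"

definition lift1 :: "'w measure \<Rightarrow> ('b \<Rightarrow> 'c::topological_space) \<Rightarrow> ('w \<Rightarrow> 'b) set \<Rightarrow> ('w \<Rightarrow> 'c) set" where
  "lift1 M h X = ae_class M (\<lambda>\<omega>. h (rep X \<omega>))"

definition lift2 :: "'w measure \<Rightarrow> ('b \<Rightarrow> 'c \<Rightarrow> 'd::topological_space) \<Rightarrow>
    ('w \<Rightarrow> 'b) set \<Rightarrow> ('w \<Rightarrow> 'c) set \<Rightarrow> ('w \<Rightarrow> 'd) set" where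
  "lift2 M h X Y = ae_class M (\<lambda>\<omega>. h (rep X \<omega>) (rep Y \<omega>))"

abbreviation cls_add ::
    "'w measure \<Rightarrow> ('w \<Rightarrow> 'b::{topological_space,plus}) set \<Rightarrow> ('w \<Rightarrow> 'b) set \<Rightarrow> ('w \<Rightarrow> 'b) set" where
  "cls_add M \<equiv> lift2 M (+)"

abbreviation cls_mult ::
    "'w measure \<Rightarrow> ('w \<Rightarrow> 'b::{topological_space,times}) set \<Rightarrow> ('w \<Rightarrow> 'b) set \<Rightarrow> ('w \<Rightarrow> 'b) set" where
  "cls_mult M \<equiv> lift2 M (*)"

definition cls_le :: "'w measure \<Rightarrow> ('w \<Rightarrow> 'b::ord) set \<Rightarrow> ('w \<Rightarrow> 'b) set \<Rightarrow> bool" where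
  "cls_le M X Y \<longleftrightarrow> (AE \<omega> in M. rep X \<omega> \<le> rep Y \<omega>)"

definition cls_less :: "'w measure \<Rightarrow> ('w \<Rightarrow> 'b::ord) set \<Rightarrow> ('w \<Rightarrow> 'b) set \<Rightarrow> bool" where
  "cls_less M X Y \<longleftrightarrow> (AE \<omega> in M. rep X \<omega> < rep Y \<omega>)"

lemma ae_classes_rep:
  assumes "X \<in> ae_classes M"
  shows "rep X \<in> borel_measurable M" and "X = ae_class M (rep X)"
proof -
  obtain f where f: "f \<in> borel_measurable M" "X = ae_class M f"
    using assms by (auto simp: ae_classes_def)
  then have "f \<in> X" by (simp add: ae_class_def)
  then have r: "rep X \<in> X" unfolding rep_def by (rule someI[where P = "\<lambda>g. g \<in> _"])
  then show "rep X \<in> borel_measurable M" using f by (simp add: ae_class_def)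
  have "AE \<omega> in M. rep X \<omega> = f \<omega>" using r f by (simp add: ae_class_def)
  then show "X = ae_class M (rep X)"
    unfolding f(2) by (auto simp: ae_class_def elim: eventually_elim2)
qed

lemma rep_ae_class:
  assumes "f \<in> borel_measurable M"
  shows "AE \<omega> in M. rep (ae_class M f) \<omega> = f \<omega>"
proof -
  have "f \<in> ae_class M f" using assms by (simp add: ae_class_def)
  then have "rep (ae_class M f) \<in> ae_class M f" unfolding rep_def by (rule someI[where P = "\<lambda>g. g \<in> _"])
  then show ?thesis by (simp add: ae_class_def)
qed


section \<open>The algebra \<open>L\<^sup>0\<close> and the lattice of extended random variables\<close>

record ('r, 'e) normed_module = "('r, 'e) module" +
  rnorm :: "'e \<Rightarrow> 'r"

text \<open>\<open>L\<^sup>0\<close> serves both as scalar ring and as normed module over itself.\<close>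

definition L0 :: "'w measure \<Rightarrow> (('w \<Rightarrow> real) set, ('w \<Rightarrow> real) set) normed_module" where
  "L0 M = \<lparr>carrier = ae_classes M,
           mult = cls_mult M, one = ae_class M (\<lambda>_. 1),
           zero = ae_class M (\<lambda>_. 0), add = cls_add M,
           smult = cls_mult M, rnorm = lift1 M abs\<rparr>"

definition L0_plus :: "'w measure \<Rightarrow> ('w \<Rightarrow> real) set set" where
  "L0_plus M = {\<xi> \<in> carrier (L0 M). cls_le M \<zero>\<^bsub>L0 M\<^esub> \<xi>}"

definition L0_plus_plus :: "'w measure \<Rightarrow> ('w \<Rightarrow> real) set set" where
  "L0_plus_plus M = {\<xi> \<in> carrier (L0 M). cls_less M \<zero>\<^bsub>L0 M\<^esub> \<xi>}"

definition L0_bar :: "'w measure \<Rightarrow> ('w \<Rightarrow> ereal) set gorder" where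
  "L0_bar M = \<lparr>carrier = ae_classes M, eq = (=), le = cls_le M\<rparr>"

text \<open>Products in \<open>L0_bar\<close> use the \<^typ>\<open>ereal\<close> convention \<open>0 * \<infinity> = 0\<close>.\<close>

abbreviation to_ext :: "'w measure \<Rightarrow> ('w \<Rightarrow> real) set \<Rightarrow> ('w \<Rightarrow> ereal) set" where
  "to_ext M \<equiv> lift1 M ereal"

abbreviation scale_ext ::
    "'w measure \<Rightarrow> ('w \<Rightarrow> real) set \<Rightarrow> ('w \<Rightarrow> ereal) set \<Rightarrow> ('w \<Rightarrow> ereal) set" where
  "scale_ext M \<xi> \<equiv> cls_mult M (to_ext M \<xi>)"

definition cls_indicator :: "'w measure \<Rightarrow> 'w set \<Rightarrow> ('w \<Rightarrow> real) set" where
  "cls_indicator M A = ae_class M (indicator A)"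


section \<open>Random normed modules\<close>

locale rn_module = prob_space M + module "L0 M" E
  for M :: "'w measure" and E :: "(('w \<Rightarrow> real) set, 'e) normed_module" +
  assumes rnorm_closed: "x \<in> carrier E \<Longrightarrow> rnorm E x \<in> L0_plus M"
    and rnorm_smult: "\<xi> \<in> carrier (L0 M) \<Longrightarrow> x \<in> carrier E \<Longrightarrow>
          rnorm E (\<xi> \<odot>\<^bsub>E\<^esub> x) = lift1 M abs \<xi> \<otimes>\<^bsub>L0 M\<^esub> rnorm E x"
    and rnorm_triangle: "x \<in> carrier E \<Longrightarrow> y \<in> carrier E \<Longrightarrow>
          cls_le M (rnorm E (x \<oplus>\<^bsub>E\<^esub> y)) (rnorm E x \<oplus>\<^bsub>L0 M\<^esub> rnorm E y)"
    and rnorm_zeroD: "x \<in> carrier E \<Longrightarrow> rnorm E x = \<zero>\<^bsub>L0 M\<^esub> \<Longrightarrow> x = \<zero>\<^bsub>E\<^esub>"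

text \<open>The prefix \<open>el\<close> stands for the \<open>(\<epsilon>, \<lambda>)\<close>-topology; \<open>\<delta>\<close> plays the role of \<open>\<lambda>\<close>.\<close>

definition el_nbhd ::
    "'w measure \<Rightarrow> (('w \<Rightarrow> real) set, 'e) normed_module \<Rightarrow> real \<Rightarrow> real \<Rightarrow> 'e set" where
  "el_nbhd M E \<epsilon> \<delta> =
     {x \<in> carrier E. measure M {\<omega> \<in> space M. rep (rnorm E x) \<omega> < \<epsilon>} > 1 - \<delta>}"

definition el_open :: "'w measure \<Rightarrow> (('w \<Rightarrow> real) set, 'e) normed_module \<Rightarrow> 'e set \<Rightarrow> bool" where
  "el_open M E U \<longleftrightarrow> U \<subseteq> carrier E \<and>
     (\<forall>x\<in>U. \<exists>\<epsilon> \<delta>. 0 < \<epsilon> \<and> 0 < \<delta> \<and> \<delta> < 1 \<and> {y \<in> carrier E. y \<ominus>\<^bsub>E\<^esub> x \<in> el_nbhd M E \<epsilon> \<delta>} \<subseteq> U)"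

definition el_topology :: "'w measure \<Rightarrow> (('w \<Rightarrow> real) set, 'e) normed_module \<Rightarrow> 'e topology" where
  "el_topology M E = topology (el_open M E)"

definition rn_Cauchy ::
    "'w measure \<Rightarrow> (('w \<Rightarrow> real) set, 'e) normed_module \<Rightarrow> (nat \<Rightarrow> 'e) \<Rightarrow> bool" where
  "rn_Cauchy M E s \<longleftrightarrow> range s \<subseteq> carrier E \<and>
     (\<forall>\<epsilon> \<delta>. 0 < \<epsilon> \<and> 0 < \<delta> \<and> \<delta> < 1 \<longrightarrow>
        (\<exists>N. \<forall>m\<ge>N. \<forall>n\<ge>N. s m \<ominus>\<^bsub>E\<^esub> s n \<in> el_nbhd M E \<epsilon> \<delta>))"

text \<open>The topology is metrizable by a translation-invariant metric, so completeness can be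
  expressed with sequences.\<close>

definition rn_complete :: "'w measure \<Rightarrow> (('w \<Rightarrow> real) set, 'e) normed_module \<Rightarrow> bool" where
  "rn_complete M E \<longleftrightarrow>
     (\<forall>s. rn_Cauchy M E s \<longrightarrow> (\<exists>l. limitin (el_topology M E) s l sequentially))"

definition full_support :: "'w measure \<Rightarrow> (('w \<Rightarrow> real) set, 'e) normed_module \<Rightarrow> bool" where
  "full_support M E \<longleftrightarrow>
     cls_less M (ae_class M (\<lambda>_. 0)) (\<Squnion>\<^bsub>L0_bar M\<^esub> (to_ext M ` rnorm E ` carrier E))"

text \<open>The ring multiplication and unit of a module record are irrelevant to its module structure.\<close>

definition times_L0 :: "'w measure \<Rightarrow> (('w \<Rightarrow> real) set, 'e) normed_module \<Rightarrow>
    (('w \<Rightarrow> real) set, 'e \<times> ('w \<Rightarrow> real) set) normed_module" where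
  "times_L0 M E = \<lparr>carrier = carrier E \<times> carrier (L0 M), mult = undefined, one = undefined,
     zero = (\<zero>\<^bsub>E\<^esub>, \<zero>\<^bsub>L0 M\<^esub>), add = (\<lambda>(x, r) (y, s). (x \<oplus>\<^bsub>E\<^esub> y, r \<oplus>\<^bsub>L0 M\<^esub> s)),
     smult = (\<lambda>\<xi> (x, r). (\<xi> \<odot>\<^bsub>E\<^esub> x, \<xi> \<odot>\<^bsub>L0 M\<^esub> r)),
     rnorm = (\<lambda>(x, r). rnorm E x \<oplus>\<^bsub>L0 M\<^esub> rnorm (L0 M) r)\<rparr>"

definition cont_homs :: "'w measure \<Rightarrow> (('w \<Rightarrow> real) set, 'e) normed_module \<Rightarrow>
    (('w \<Rightarrow> real) set, 'd) normed_module \<Rightarrow> ('e \<Rightarrow> 'd) set" where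
  "cont_homs M E F = {h \<in> carrier E \<rightarrow> carrier F.
     (\<forall>x\<in>carrier E. \<forall>y\<in>carrier E. h (x \<oplus>\<^bsub>E\<^esub> y) = h x \<oplus>\<^bsub>F\<^esub> h y) \<and>
     (\<forall>\<xi>\<in>carrier (L0 M). \<forall>x\<in>carrier E. h (\<xi> \<odot>\<^bsub>E\<^esub> x) = \<xi> \<odot>\<^bsub>F\<^esub> h x) \<and>
     continuous_map (el_topology M E) (el_topology M F) h}"

definition rn_dual ::
    "'w measure \<Rightarrow> (('w \<Rightarrow> real) set, 'e) normed_module \<Rightarrow> ('e \<Rightarrow> ('w \<Rightarrow> real) set) set" where
  "rn_dual M E = cont_homs M E (L0 M)"

definition cont_automorphisms ::
    "'w measure \<Rightarrow> (('w \<Rightarrow> real) set, 'e) normed_module \<Rightarrow> ('e \<Rightarrow> 'e) set" where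
  "cont_automorphisms M E = {H \<in> cont_homs M E E. bij_betw H (carrier E) (carrier E)}"


section \<open>Proper lower semicontinuous convex functions\<close>

definition epi :: "'w measure \<Rightarrow> (('w \<Rightarrow> real) set, 'e) normed_module \<Rightarrow>
    ('e \<Rightarrow> ('w \<Rightarrow> ereal) set) \<Rightarrow> ('e \<times> ('w \<Rightarrow> real) set) set" where
  "epi M E f = {(x, r). x \<in> carrier E \<and> r \<in> carrier (L0 M) \<and> cls_le M (f x) (to_ext M r)}"

definition effective_dom :: "'w measure \<Rightarrow> (('w \<Rightarrow> real) set, 'e) normed_module \<Rightarrow>
    ('e \<Rightarrow> ('w \<Rightarrow> ereal) set) \<Rightarrow> 'e set" where
  "effective_dom M E f = {x \<in> carrier E. cls_less M (f x) (ae_class M (\<lambda>_. \<infinity>))}"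

text \<open>Functions are extensional, so that equality of elements of \<open>convex_funs M E\<close> is
  equality on \<open>carrier E\<close>.\<close>

definition convex_funs :: "'w measure \<Rightarrow> (('w \<Rightarrow> real) set, 'e) normed_module \<Rightarrow>
    ('e \<Rightarrow> ('w \<Rightarrow> ereal) set) set" where
  "convex_funs M E = {f \<in> carrier E \<rightarrow>\<^sub>E carrier (L0_bar M).
     (\<forall>x\<in>carrier E. cls_less M (ae_class M (\<lambda>_. -\<infinity>)) (f x)) \<and>
     effective_dom M E f \<noteq> {} \<and>
     (\<forall>x\<in>carrier E. \<forall>y\<in>carrier E. \<forall>\<xi>\<in>L0_plus M. cls_le M \<xi> \<one>\<^bsub>L0 M\<^esub> \<longrightarrow>
        cls_le M (f (\<xi> \<odot>\<^bsub>E\<^esub> x \<oplus>\<^bsub>E\<^esub> (\<one>\<^bsub>L0 M\<^esub> \<ominus>\<^bsub>L0 M\<^esub> \<xi>) \<odot>\<^bsub>E\<^esub> y))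
          (cls_add M (scale_ext M \<xi> (f x)) (scale_ext M (\<one>\<^bsub>L0 M\<^esub> \<ominus>\<^bsub>L0 M\<^esub> \<xi>) (f y)))) \<and>
     closedin (el_topology M (times_L0 M E)) (epi M E f)}"

definition fun_le :: "'w measure \<Rightarrow> (('w \<Rightarrow> real) set, 'e) normed_module \<Rightarrow>
    ('e \<Rightarrow> ('w \<Rightarrow> ereal) set) \<Rightarrow> ('e \<Rightarrow> ('w \<Rightarrow> ereal) set) \<Rightarrow> bool" where
  "fun_le M E f g \<longleftrightarrow> (\<forall>x\<in>carrier E. cls_le M (f x) (g x))"

definition glue :: "'w measure \<Rightarrow> (('w \<Rightarrow> real) set, 'e) normed_module \<Rightarrow> 'w set \<Rightarrow>
    ('e \<Rightarrow> ('w \<Rightarrow> ereal) set) \<Rightarrow> ('e \<Rightarrow> ('w \<Rightarrow> ereal) set) \<Rightarrow> 'e \<Rightarrow> ('w \<Rightarrow> ereal) set" where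
  "glue M E A f g = (\<lambda>x\<in>carrier E.
     cls_add M (scale_ext M (cls_indicator M A) (f x))
               (scale_ext M (cls_indicator M (space M - A)) (g x)))"

definition stable_op :: "'w measure \<Rightarrow> (('w \<Rightarrow> real) set, 'e) normed_module \<Rightarrow>
    (('e \<Rightarrow> ('w \<Rightarrow> ereal) set) \<Rightarrow> 'e \<Rightarrow> ('w \<Rightarrow> ereal) set) \<Rightarrow> bool" where
  "stable_op M E T \<longleftrightarrow>
     (\<forall>A\<in>sets M. \<forall>f\<in>convex_funs M E. \<forall>g\<in>convex_funs M E.
        T (glue M E A f g) = glue M E A (T f) (T g))"

definition fully_order_preserving :: "'w measure \<Rightarrow> (('w \<Rightarrow> real) set, 'e) normed_module \<Rightarrow>
    (('e \<Rightarrow> ('w \<Rightarrow> ereal) set) \<Rightarrow> 'e \<Rightarrow> ('w \<Rightarrow> ereal) set) \<Rightarrow> bool" where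
  "fully_order_preserving M E T \<longleftrightarrow>
     T ` convex_funs M E = convex_funs M E \<and>
     (\<forall>f\<in>convex_funs M E. \<forall>g\<in>convex_funs M E.
        fun_le M E f g \<longleftrightarrow> fun_le M E (T f) (T g))"

end

theory Submission
  imports Defs "HOL-Analysis.Urysohn"
begin

text \<open>A stable order automorphism \<open>T\<close> permutes the point functions (finite at a single element),
  because these are the functions whose upper bounds are pairwise comparable up to gluing. Hence
  \<open>T\<^sup>-\<^sup>1\<close> induces a map \<open>(x, r) \<mapsto> (\<phi> x, \<psi> x r)\<close> on epigraphs. The points lying above every convex
  function below two given points form the epigraph of a segment, so this map sends segments to
  segments; the position on the image segment does not depend on the heights, and varying the heights
  shows that \<open>\<psi> x\<close> is affine with a positive slope \<open>\<tau> x\<close>. Since segments extend indefinitely, the slope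
  is constant, whence \<open>\<phi>\<close> and \<open>x \<mapsto> \<psi> x 0\<close> are affine. Continuity of their linear parts comes from
  lower semicontinuity of the images of the norm and of \<open>0\<close>, through a random version of Zabreiko's
  lemma, which also gives the continuous inverse needed for surjectivity in the converse.\<close>

section \<open>Classes of random variables\<close>

text \<open>The obstacle is that weights, heights and slopes are random variables, while distinct
  elements may coincide on part of the base space. A convex combination determines its weight only
  where its endpoints differ, so segments are first studied between endpoints that differ almost
  everywhere (\<open>sep\<close>), and gluing reduces the general case to this one. Completeness
  turns full support into one element \<open>e\<close> whose norm is positive almost everywhere. It
  exhibits any \<open>z\<close> as the midpoint of \<open>z + e\<close> and \<open>z - e\<close>,
  and a random multiple of it leads away from two given points at once. Every pointwise argument
  leaves a null set behind, so families of conditions are tested on rationals or along sequences. In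
  the height, \<open>psi\<close> is at first only known to be monotone and local; hence the slope
  comes from a monotone additive function, and continuity must be recovered from the lower
  semicontinuity of the values of \<open>T\<close>. The image of \<open>0\<close> is the functional
  \<open>w\<close> up to a constant. It is settled first, because the image of the norm is a
  multiple of the norm of \<open>H x\<close> plus the same functional.\<close>

lemma ae_class_cong:
  assumes "AE \<omega> in M. f \<omega> = g \<omega>"
  shows "ae_class M f = ae_class M g"
proof -
  have "AE \<omega> in M. h \<omega> = f \<omega> \<longleftrightarrow> h \<omega> = g \<omega>" for h
    using assms by eventually_elim auto
  then have "(AE \<omega> in M. h \<omega> = f \<omega>) \<longleftrightarrow> (AE \<omega> in M. h \<omega> = g \<omega>)" for h
    by (intro eventually_subst)
  then show ?thesis unfolding ae_class_def by blast
qed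

lemma ae_class_in [simp, intro]: "f \<in> borel_measurable M \<Longrightarrow> ae_class M f \<in> ae_classes M"
  by (simp add: ae_classes_def)

lemma ae_class_eq_iff:
  assumes "f \<in> borel_measurable M" "g \<in> borel_measurable M"
  shows "ae_class M f = ae_class M g \<longleftrightarrow> (AE \<omega> in M. f \<omega> = g \<omega>)"
proof
  assume "ae_class M f = ae_class M g"
  moreover have "f \<in> ae_class M f" using assms by (simp add: ae_class_def)
  ultimately show "AE \<omega> in M. f \<omega> = g \<omega>" by (simp add: ae_class_def)
qed (rule ae_class_cong)

lemma ae_class_rep [simp]: "X \<in> ae_classes M \<Longrightarrow> ae_class M (rep X) = X"
  using ae_classes_rep(2) by metis

lemma measurable_rep [measurable]: "X \<in> ae_classes M \<Longrightarrow> rep X \<in> borel_measurable M"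
  by (rule ae_classes_rep(1))

lemma ae_classes_eqI:
  assumes "X \<in> ae_classes M" "Y \<in> ae_classes M" "AE \<omega> in M. rep X \<omega> = rep Y \<omega>"
  shows "X = Y"
  using assms ae_class_cong ae_class_rep by metis

lemma lift1_ae_class:
  assumes "f \<in> borel_measurable M"
  shows "lift1 M h (ae_class M f) = ae_class M (\<lambda>\<omega>. h (f \<omega>))"
  unfolding lift1_def
  by (rule ae_class_cong) (use rep_ae_class[OF assms] in eventually_elim, simp)

lemma lift2_ae_class:
  assumes "f \<in> borel_measurable M" "g \<in> borel_measurable M"
  shows "lift2 M h (ae_class M f) (ae_class M g) = ae_class M (\<lambda>\<omega>. h (f \<omega>) (g \<omega>))"
  unfolding lift2_def
  by (rule ae_class_cong)
    (use rep_ae_class[OF assms(1)] rep_ae_class[OF assms(2)] in eventually_elim, simp)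

lemma cls_le_ae_class:
  assumes "f \<in> borel_measurable M" "g \<in> borel_measurable M"
  shows "cls_le M (ae_class M f) (ae_class M g) \<longleftrightarrow> (AE \<omega> in M. f \<omega> \<le> g \<omega>)"
proof -
  have "AE \<omega> in M. rep (ae_class M f) \<omega> \<le> rep (ae_class M g) \<omega> \<longleftrightarrow> f \<omega> \<le> g \<omega>"
    using rep_ae_class[OF assms(1)] rep_ae_class[OF assms(2)] by eventually_elim simp
  then show ?thesis unfolding cls_le_def by (rule eventually_subst)
qed

lemma cls_less_ae_class:
  assumes "f \<in> borel_measurable M" "g \<in> borel_measurable M"
  shows "cls_less M (ae_class M f) (ae_class M g) \<longleftrightarrow> (AE \<omega> in M. f \<omega> < g \<omega>)"
proof -
  have "AE \<omega> in M. rep (ae_class M f) \<omega> < rep (ae_class M g) \<omega> \<longleftrightarrow> f \<omega> < g \<omega>"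
    using rep_ae_class[OF assms(1)] rep_ae_class[OF assms(2)] by eventually_elim simp
  then show ?thesis unfolding cls_less_def by (rule eventually_subst)
qed

lemma ae_classesE:
  assumes "X \<in> ae_classes M"
  obtains f where "f \<in> borel_measurable M" "X = ae_class M f"
  using assms by (auto simp: ae_classes_def)

lemma L0_simps [simp]:
  "carrier (L0 M) = ae_classes M"
  "one (L0 M) = ae_class M (\<lambda>_. 1)"
  "zero (L0 M) = ae_class M (\<lambda>_. 0)"
  "add (L0 M) = cls_add M"
  "mult (L0 M) = cls_mult M"
  "smult (L0 M) = cls_mult M"
  "rnorm (L0 M) = lift1 M abs"
  by (simp_all add: L0_def)

lemma L0_bar_simps [simp]:
  "carrier (L0_bar M) = ae_classes M" "le (L0_bar M) = cls_le M" "eq (L0_bar M) = (=)"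
  by (simp_all add: L0_bar_def)

lemma cls_add_ae_class [simp]:
  fixes f g :: "'w \<Rightarrow> real"
  shows "f \<in> borel_measurable M \<Longrightarrow> g \<in> borel_measurable M \<Longrightarrow>
    cls_add M (ae_class M f) (ae_class M g) = ae_class M (\<lambda>\<omega>. f \<omega> + g \<omega>)"
  by (rule lift2_ae_class)

lemma cls_mult_ae_class [simp]:
  fixes f g :: "'w \<Rightarrow> real"
  shows "f \<in> borel_measurable M \<Longrightarrow> g \<in> borel_measurable M \<Longrightarrow>
    cls_mult M (ae_class M f) (ae_class M g) = ae_class M (\<lambda>\<omega>. f \<omega> * g \<omega>)"
  by (rule lift2_ae_class)

lemma cls_add_ae_class_ereal [simp]:
  fixes f g :: "'w \<Rightarrow> ereal"
  shows "f \<in> borel_measurable M \<Longrightarrow> g \<in> borel_measurable M \<Longrightarrow>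
    cls_add M (ae_class M f) (ae_class M g) = ae_class M (\<lambda>\<omega>. f \<omega> + g \<omega>)"
  by (rule lift2_ae_class)

lemma cls_mult_ae_class_ereal [simp]:
  fixes f g :: "'w \<Rightarrow> ereal"
  shows "f \<in> borel_measurable M \<Longrightarrow> g \<in> borel_measurable M \<Longrightarrow>
    cls_mult M (ae_class M f) (ae_class M g) = ae_class M (\<lambda>\<omega>. f \<omega> * g \<omega>)"
  by (rule lift2_ae_class)

lemma to_ext_ae_class [simp]:
  "f \<in> borel_measurable M \<Longrightarrow> to_ext M (ae_class M f) = ae_class M (\<lambda>\<omega>. ereal (f \<omega>))"
  by (rule lift1_ae_class)

text \<open>The ring axioms are a hypothesis because they are not derived for \<open>L0 M\<close>
  here; inside \<open>rn_module\<close> they come with the \<open>module\<close> locale.\<close>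

lemma L0_minus:
  fixes f g :: "'w \<Rightarrow> real"
  assumes "cring (L0 M)" and [measurable]: "f \<in> borel_measurable M" "g \<in> borel_measurable M"
  shows "ae_class M f \<ominus>\<^bsub>L0 M\<^esub> ae_class M g = ae_class M (\<lambda>\<omega>. f \<omega> - g \<omega>)"
proof -
  interpret cring "L0 M" by fact
  have "\<ominus>\<^bsub>L0 M\<^esub> ae_class M g = ae_class M (\<lambda>\<omega>. - g \<omega>)"
    by (rule minus_equality) simp_all
  then show ?thesis by (simp add: minus_eq)
qed

section \<open>Random normed modules\<close>

context rn_module
begin

text \<open>Everything is computed with representatives: \<open>N x\<close> is a version of the norm of \<open>x\<close> that is
  nonnegative everywhere, and \<open>D x y \<omega> = 0\<close> plays the role of \<open>x = y\<close> at \<open>\<omega>\<close>.\<close>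

definition N :: "'e \<Rightarrow> 'w \<Rightarrow> real" where "N x \<omega> = \<bar>rep (rnorm E x) \<omega>\<bar>"

definition sc :: "('w \<Rightarrow> real) \<Rightarrow> 'e \<Rightarrow> 'e" where "sc a x = ae_class M a \<odot>\<^bsub>E\<^esub> x"

text \<open>The normal form for module computations: differences, gluings and convex combinations
  all have this shape, and the weights stay functions so that identities between them are checked
  pointwise.\<close>

definition lc :: "('w \<Rightarrow> real) \<Rightarrow> 'e \<Rightarrow> ('w \<Rightarrow> real) \<Rightarrow> 'e \<Rightarrow> 'e" where
  "lc a x b y = sc a x \<oplus>\<^bsub>E\<^esub> sc b y"

definition D :: "'e \<Rightarrow> 'e \<Rightarrow> 'w \<Rightarrow> real" where "D x y = N (lc (\<lambda>_. 1) x (\<lambda>_. - 1) y)"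

lemma sc_closed [simp, intro]: "a \<in> borel_measurable M \<Longrightarrow> x \<in> carrier E \<Longrightarrow> sc a x \<in> carrier E"
  by (simp add: sc_def)

lemma lc_closed [simp, intro]:
  "a \<in> borel_measurable M \<Longrightarrow> x \<in> carrier E \<Longrightarrow> b \<in> borel_measurable M \<Longrightarrow> y \<in> carrier E \<Longrightarrow>
   lc a x b y \<in> carrier E"
  by (simp add: lc_def)

lemma smult_eq_sc: "\<xi> \<in> ae_classes M \<Longrightarrow> \<xi> \<odot>\<^bsub>E\<^esub> x = sc (rep \<xi>) x"
  by (simp add: sc_def)

lemma sc_cong: "AE \<omega> in M. a \<omega> = b \<omega> \<Longrightarrow> sc a x = sc b x"
  unfolding sc_def by (simp add: ae_class_cong)

lemma lc_cong:
  "AE \<omega> in M. a \<omega> = a' \<omega> \<Longrightarrow> AE \<omega> in M. b \<omega> = b' \<omega> \<Longrightarrow> lc a x b y = lc a' x b' y"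
  unfolding lc_def using sc_cong by metis

lemma sc_add:
  assumes "a \<in> borel_measurable M" "b \<in> borel_measurable M" "x \<in> carrier E"
  shows "sc a x \<oplus>\<^bsub>E\<^esub> sc b x = sc (\<lambda>\<omega>. a \<omega> + b \<omega>) x"
  using smult_l_distr[of "ae_class M a" "ae_class M b" x] assms by (simp add: sc_def)

lemma sc_sc:
  assumes "a \<in> borel_measurable M" "b \<in> borel_measurable M" "x \<in> carrier E"
  shows "sc a (sc b x) = sc (\<lambda>\<omega>. a \<omega> * b \<omega>) x"
  using smult_assoc1[of "ae_class M a" "ae_class M b" x] assms by (simp add: sc_def)

lemma sc_r_distr:
  assumes "a \<in> borel_measurable M" "x \<in> carrier E" "y \<in> carrier E"
  shows "sc a (x \<oplus>\<^bsub>E\<^esub> y) = sc a x \<oplus>\<^bsub>E\<^esub> sc a y"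
  using smult_r_distr[of "ae_class M a" x y] assms by (simp add: sc_def)

lemma sc_one [simp]: "x \<in> carrier E \<Longrightarrow> sc (\<lambda>_. 1) x = x"
  using smult_one by (simp add: sc_def)

lemma sc_zero [simp]:
  assumes "x \<in> carrier E" shows "sc (\<lambda>_. 0) x = \<zero>\<^bsub>E\<^esub>"
proof -
  have "sc (\<lambda>_. 0) x \<oplus>\<^bsub>E\<^esub> sc (\<lambda>_. 0) x = sc (\<lambda>_. 0) x" using assms by (simp add: sc_add)
  then show ?thesis using assms by (simp add: M.add.r_cancel_one)
qed

lemma sc_minus [simp]:
  assumes "x \<in> carrier E" shows "sc (\<lambda>_. - 1) x = \<ominus>\<^bsub>E\<^esub> x"
proof -
  have "sc (\<lambda>_. - 1) x \<oplus>\<^bsub>E\<^esub> sc (\<lambda>_. 1) x = \<zero>\<^bsub>E\<^esub>" using assms sc_add[of "\<lambda>_. -1" "\<lambda>_. 1" x] by (simp del: sc_one)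
  then have "sc (\<lambda>_. - 1) x \<oplus>\<^bsub>E\<^esub> x = \<zero>\<^bsub>E\<^esub>" using assms by simp
  then show ?thesis using assms by (metis M.minus_equality sc_closed borel_measurable_const)
qed

lemma minus_eq_lc: "x \<in> carrier E \<Longrightarrow> y \<in> carrier E \<Longrightarrow> x \<ominus>\<^bsub>E\<^esub> y = lc (\<lambda>_. 1) x (\<lambda>_. - 1) y"
  by (simp add: lc_def M.minus_eq)

lemma left_eq_lc: "x \<in> carrier E \<Longrightarrow> y \<in> carrier E \<Longrightarrow> x = lc (\<lambda>_. 1) x (\<lambda>_. 0) y"
  by (simp add: lc_def)

lemma right_eq_lc: "x \<in> carrier E \<Longrightarrow> y \<in> carrier E \<Longrightarrow> y = lc (\<lambda>_. 0) x (\<lambda>_. 1) y"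
  by (simp add: lc_def)

lemma lc_lc:
  assumes "a \<in> borel_measurable M" "b \<in> borel_measurable M" "c \<in> borel_measurable M"
    "d \<in> borel_measurable M" "e \<in> borel_measurable M" "g \<in> borel_measurable M"
    and x: "x \<in> carrier E" and y: "y \<in> carrier E"
  shows "lc a (lc b x c y) d (lc e x g y)
    = lc (\<lambda>\<omega>. a \<omega> * b \<omega> + d \<omega> * e \<omega>) x (\<lambda>\<omega>. a \<omega> * c \<omega> + d \<omega> * g \<omega>) y"
proof -
  have "lc a (lc b x c y) d (lc e x g y)
    = (sc (\<lambda>\<omega>. a \<omega> * b \<omega>) x \<oplus>\<^bsub>E\<^esub> sc (\<lambda>\<omega>. a \<omega> * c \<omega>) y) \<oplus>\<^bsub>E\<^esub>
      (sc (\<lambda>\<omega>. d \<omega> * e \<omega>) x \<oplus>\<^bsub>E\<^esub> sc (\<lambda>\<omega>. d \<omega> * g \<omega>) y)"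
    using assms by (simp add: lc_def sc_r_distr sc_sc)
  also have "\<dots> = (sc (\<lambda>\<omega>. a \<omega> * b \<omega>) x \<oplus>\<^bsub>E\<^esub> sc (\<lambda>\<omega>. d \<omega> * e \<omega>) x) \<oplus>\<^bsub>E\<^esub>
      (sc (\<lambda>\<omega>. a \<omega> * c \<omega>) y \<oplus>\<^bsub>E\<^esub> sc (\<lambda>\<omega>. d \<omega> * g \<omega>) y)"
    using assms by (simp add: M.a_ac)
  finally show ?thesis using assms by (simp add: sc_add lc_def)
qed

text \<open>With four different vectors nothing can be merged as in \<open>lc_lc\<close>. The
  summands are only regrouped so that \<open>x\<close> meets \<open>z\<close> and \<open>y\<close>
  meets \<open>u\<close>, as the difference of two combinations requires.\<close>

lemma lc_lc_swap:
  assumes "a \<in> borel_measurable M" "b \<in> borel_measurable M" "c \<in> borel_measurable M"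
    "d \<in> borel_measurable M" "e \<in> borel_measurable M" "g \<in> borel_measurable M"
    and "x \<in> carrier E" "y \<in> carrier E" "z \<in> carrier E" "u \<in> carrier E"
  shows "lc a (lc b x c y) d (lc e z g u)
    = lc (\<lambda>_. 1) (lc (\<lambda>\<omega>. a \<omega> * b \<omega>) x (\<lambda>\<omega>. d \<omega> * e \<omega>) z)
        (\<lambda>_. 1) (lc (\<lambda>\<omega>. a \<omega> * c \<omega>) y (\<lambda>\<omega>. d \<omega> * g \<omega>) u)"
proof -
  have "lc a (lc b x c y) d (lc e z g u)
    = (sc (\<lambda>\<omega>. a \<omega> * b \<omega>) x \<oplus>\<^bsub>E\<^esub> sc (\<lambda>\<omega>. a \<omega> * c \<omega>) y) \<oplus>\<^bsub>E\<^esub>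
      (sc (\<lambda>\<omega>. d \<omega> * e \<omega>) z \<oplus>\<^bsub>E\<^esub> sc (\<lambda>\<omega>. d \<omega> * g \<omega>) u)"
    using assms by (simp add: lc_def sc_r_distr sc_sc)
  then show ?thesis using assms by (simp add: M.a_ac lc_def)
qed

subsection \<open>The pointwise norm\<close>

lemma rnorm_in [simp]: "x \<in> carrier E \<Longrightarrow> rnorm E x \<in> ae_classes M"
  using rnorm_closed by (auto simp: L0_plus_def)

lemma N_measurable [measurable]: "x \<in> carrier E \<Longrightarrow> N x \<in> borel_measurable M"
  unfolding N_def by measurable

lemma N_nonneg [simp]: "0 \<le> N x \<omega>"
  by (simp add: N_def)

lemma rep_rnorm: "x \<in> carrier E \<Longrightarrow> AE \<omega> in M. rep (rnorm E x) \<omega> = N x \<omega>"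
proof -
  assume x: "x \<in> carrier E"
  have "cls_le M \<zero>\<^bsub>L0 M\<^esub> (rnorm E x)" using rnorm_closed[OF x] by (simp add: L0_plus_def)
  moreover have "AE \<omega> in M. rep (\<zero>\<^bsub>L0 M\<^esub>) \<omega> = 0" using rep_ae_class[of "\<lambda>_. 0::real" M] by simp
  ultimately have "AE \<omega> in M. 0 \<le> rep (rnorm E x) \<omega>"
    unfolding cls_le_def by eventually_elim simp
  then show ?thesis by eventually_elim (simp add: N_def)
qed

lemma rnorm_eq: "x \<in> carrier E \<Longrightarrow> rnorm E x = ae_class M (N x)"
  using rep_rnorm ae_class_cong[of "rep (rnorm E x)"] by (metis ae_class_rep rnorm_in)

lemma N_sc:
  assumes [measurable]: "a \<in> borel_measurable M" and [simp]: "x \<in> carrier E"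
  shows "AE \<omega> in M. N (sc a x) \<omega> = \<bar>a \<omega>\<bar> * N x \<omega>"
proof -
  have "ae_class M (N (sc a x)) = ae_class M (\<lambda>\<omega>. \<bar>a \<omega>\<bar> * N x \<omega>)"
    using rnorm_smult[of "ae_class M a" x] unfolding sc_def[symmetric]
    by (simp add: rnorm_eq lift1_ae_class)
  then show ?thesis by (subst (asm) ae_class_eq_iff) auto
qed

lemma N_add:
  assumes "x \<in> carrier E" "y \<in> carrier E"
  shows "AE \<omega> in M. N (x \<oplus>\<^bsub>E\<^esub> y) \<omega> \<le> N x \<omega> + N y \<omega>"
  using rnorm_triangle[OF assms] assms by (simp add: rnorm_eq cls_le_ae_class)

lemma N_zeroD:
  assumes "x \<in> carrier E" "AE \<omega> in M. N x \<omega> = 0"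
  shows "x = \<zero>\<^bsub>E\<^esub>"
proof (rule rnorm_zeroD)
  show "rnorm E x = \<zero>\<^bsub>L0 M\<^esub>" using ae_class_cong[OF assms(2)] assms(1) by (simp add: rnorm_eq)
qed fact

lemma N_lc:
  assumes "a \<in> borel_measurable M" "b \<in> borel_measurable M" "x \<in> carrier E" "y \<in> carrier E"
  shows "AE \<omega> in M. N (lc a x b y) \<omega> \<le> \<bar>a \<omega>\<bar> * N x \<omega> + \<bar>b \<omega>\<bar> * N y \<omega>"
  using N_add[OF sc_closed[OF assms(1,3)] sc_closed[OF assms(2,4)]]
    N_sc[OF assms(1,3)] N_sc[OF assms(2,4)]
  by eventually_elim (simp add: lc_def)

lemma N_zero: "AE \<omega> in M. N \<zero>\<^bsub>E\<^esub> \<omega> = 0"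
  using N_sc[of "\<lambda>_. 0" "\<zero>\<^bsub>E\<^esub>"] by simp

section \<open>The pointwise distance\<close>

lemma D_measurable [measurable]: "x \<in> carrier E \<Longrightarrow> y \<in> carrier E \<Longrightarrow> D x y \<in> borel_measurable M"
  unfolding D_def by simp

lemma D_nonneg [simp]: "0 \<le> D x y \<omega>"
  by (simp add: D_def)

lemma D_eq_N: "x \<in> carrier E \<Longrightarrow> y \<in> carrier E \<Longrightarrow> D x y = N (x \<ominus>\<^bsub>E\<^esub> y)"
  by (simp add: D_def minus_eq_lc)

lemma N_eq_D:
  assumes "x \<in> carrier E" shows "N x = D x \<zero>\<^bsub>E\<^esub>"
proof -
  have *: "\<ominus>\<^bsub>E\<^esub> \<zero>\<^bsub>E\<^esub> = \<zero>\<^bsub>E\<^esub>" by (rule M.minus_equality) simp_all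
  show ?thesis unfolding D_def lc_def using assms by (simp only: sc_one sc_minus M.zero_closed *) simp
qed

lemma D_lc_same:
  assumes [measurable]: "a \<in> borel_measurable M" "b \<in> borel_measurable M" 
    "a' \<in> borel_measurable M" "b' \<in> borel_measurable M" and xy [simp]: "x \<in> carrier E" "y \<in> carrier E"
  shows "AE \<omega> in M. D (lc a x b y) (lc a' x b' y) \<omega> \<le> \<bar>a \<omega> - a' \<omega>\<bar> * N x \<omega> + \<bar>b \<omega> - b' \<omega>\<bar> * N y \<omega>"
  using N_lc[of "\<lambda>\<omega>. a \<omega> - a' \<omega>" "\<lambda>\<omega>. b \<omega> - b' \<omega>" x y] by (simp add: D_def lc_lc)

lemma lc_diff:
  assumes [measurable]: "a \<in> borel_measurable M" "b \<in> borel_measurable M"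
    and [simp]: "x \<in> carrier E" "y \<in> carrier E" "x' \<in> carrier E" "y' \<in> carrier E"
  shows "lc (\<lambda>_. 1) (lc a x b y) (\<lambda>_. - 1) (lc a x' b y')
    = lc a (lc (\<lambda>_. 1) x (\<lambda>_. - 1) x') b (lc (\<lambda>_. 1) y (\<lambda>_. - 1) y')"
proof -
  have "lc (\<lambda>_. 1) (lc a x b y) (\<lambda>_. - 1) (lc a x' b y')
    = lc (\<lambda>_. 1) (lc a x (\<lambda>\<omega>. - a \<omega>) x') (\<lambda>_. 1) (lc b y (\<lambda>\<omega>. - b \<omega>) y')"
    by (subst lc_lc_swap) simp_all
  also have "\<dots> = lc a (lc (\<lambda>_. 1) x (\<lambda>_. - 1) x') b (lc (\<lambda>_. 1) y (\<lambda>_. - 1) y')"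
    by (simp add: lc_def sc_r_distr sc_sc del: sc_minus)
  finally show ?thesis .
qed

text \<open>Together with \<open>D_lc_same\<close>, which varies the weights, this pointwise
  Lipschitz bound carries most continuity and locality arguments: combinations agree wherever their
  endpoints do.\<close>

lemma D_lc:
  assumes [measurable]: "a \<in> borel_measurable M" "b \<in> borel_measurable M"
    and [simp]: "x \<in> carrier E" "y \<in> carrier E" "x' \<in> carrier E" "y' \<in> carrier E"
  shows "AE \<omega> in M. D (lc a x b y) (lc a x' b y') \<omega> \<le> \<bar>a \<omega>\<bar> * D x x' \<omega> + \<bar>b \<omega>\<bar> * D y y' \<omega>"
  unfolding D_def lc_diff[OF assms] by (intro N_lc) auto

lemma D_self: "x \<in> carrier E \<Longrightarrow> AE \<omega> in M. D x x \<omega> = 0"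
  using N_zero by (simp add: D_def lc_def M.r_neg)

lemma D_commute:
  assumes [simp]: "x \<in> carrier E" "y \<in> carrier E"
  shows "AE \<omega> in M. D x y \<omega> = D y x \<omega>"
proof -
  have "x \<ominus>\<^bsub>E\<^esub> y = sc (\<lambda>_. - 1) (y \<ominus>\<^bsub>E\<^esub> x)"
    by (simp del: sc_minus add: minus_eq_lc) (simp add: lc_def sc_r_distr sc_sc M.a_comm del: sc_minus)
  then show ?thesis using N_sc[of "\<lambda>_. - 1" "y \<ominus>\<^bsub>E\<^esub> x"] by (simp add: D_eq_N del: sc_minus)
qed

lemma D_triangle:
  assumes [simp]: "x \<in> carrier E" "y \<in> carrier E" "z \<in> carrier E"
  shows "AE \<omega> in M. D x z \<omega> \<le> D x y \<omega> + D y z \<omega>"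
proof -
  have "(x \<ominus>\<^bsub>E\<^esub> y) \<oplus>\<^bsub>E\<^esub> (y \<ominus>\<^bsub>E\<^esub> z) = x \<ominus>\<^bsub>E\<^esub> z"
    by (simp add: M.minus_eq M.a_assoc M.r_neg1)
  then show ?thesis using N_add[of "x \<ominus>\<^bsub>E\<^esub> y" "y \<ominus>\<^bsub>E\<^esub> z"] by (simp add: D_eq_N)
qed

lemma D_zeroD:
  assumes "x \<in> carrier E" "y \<in> carrier E" "AE \<omega> in M. D x y \<omega> = 0"
  shows "x = y"
proof -
  have "x \<ominus>\<^bsub>E\<^esub> y = \<zero>\<^bsub>E\<^esub>" using N_zeroD[of "x \<ominus>\<^bsub>E\<^esub> y"] assms by (simp add: D_eq_N)
  moreover have "x = (x \<ominus>\<^bsub>E\<^esub> y) \<oplus>\<^bsub>E\<^esub> y" using assms by (simp add: M.minus_eq M.a_assoc M.l_neg)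
  ultimately show ?thesis using assms by simp
qed

subsection \<open>The base algebra and the product with it\<close>

text \<open>Puts scalars on the same footing as vectors, so that results on maps between modules
  cover functionals with values in \<open>L0 M\<close>.\<close>

lemma L0_rn_module: "rn_module M (L0 M)"
proof -
  have ag: "abelian_group (L0 M)" by (rule R.abelian_group_axioms)
  have "module (L0 M) (L0 M)"
  proof (intro module.intro module_axioms.intro)
    show "cring (L0 M)" by (rule R.cring_axioms)
    show "abelian_group (L0 M)" by (rule ag)
  qed (auto elim!: ae_classesE simp: algebra_simps)
  moreover have "rn_module_axioms M (L0 M)"
  proof
    fix x y :: "('w \<Rightarrow> real) set" and \<xi>
    assume x: "x \<in> carrier (L0 M)"
    then obtain f where f: "f \<in> borel_measurable M" "x = ae_class M f" by (auto elim!: ae_classesE)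
    show "rnorm (L0 M) x \<in> L0_plus M"
      using f by (simp add: L0_plus_def lift1_ae_class cls_le_ae_class)
    show "x = \<zero>\<^bsub>L0 M\<^esub>" if "rnorm (L0 M) x = \<zero>\<^bsub>L0 M\<^esub>"
      using f that by (simp add: lift1_ae_class ae_class_eq_iff)
    show "rnorm (L0 M) (\<xi> \<odot>\<^bsub>L0 M\<^esub> x) = lift1 M abs \<xi> \<otimes>\<^bsub>L0 M\<^esub> rnorm (L0 M) x"
      if "\<xi> \<in> carrier (L0 M)"
      using f that by (auto elim!: ae_classesE simp: lift1_ae_class abs_mult)
    show "cls_le M (rnorm (L0 M) (x \<oplus>\<^bsub>L0 M\<^esub> y)) (rnorm (L0 M) x \<oplus>\<^bsub>L0 M\<^esub> rnorm (L0 M) y)"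
      if "y \<in> carrier (L0 M)"
      using f that by (auto elim!: ae_classesE simp: lift1_ae_class cls_le_ae_class abs_triangle_ineq)
  qed
  ultimately show ?thesis by (intro rn_module.intro prob_space_axioms)
qed

lemma times_simps [simp]:
  "carrier (times_L0 M E) = carrier E \<times> ae_classes M"
  "\<zero>\<^bsub>times_L0 M E\<^esub> = (\<zero>\<^bsub>E\<^esub>, ae_class M (\<lambda>_. 0))"
  "(x, r) \<oplus>\<^bsub>times_L0 M E\<^esub> (y, s) = (x \<oplus>\<^bsub>E\<^esub> y, cls_add M r s)"
  "\<xi> \<odot>\<^bsub>times_L0 M E\<^esub> (x, r) = (\<xi> \<odot>\<^bsub>E\<^esub> x, cls_mult M \<xi> r)"
  "rnorm (times_L0 M E) (x, r) = cls_add M (rnorm E x) (lift1 M abs r)"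
  by (simp_all add: times_L0_def)

text \<open>Epigraphs live in this product. As a random normed module it inherits the sequential
  description of closed sets in \<open>closedin_AE_iff\<close>.\<close>

lemma times_rn_module: "rn_module M (times_L0 M E)"
proof -
  interpret L: rn_module M "L0 M" by (rule L0_rn_module)
  have ag: "abelian_group (times_L0 M E)"
  proof (intro abelian_groupI)
    show "\<exists>y\<in>carrier (times_L0 M E). y \<oplus>\<^bsub>times_L0 M E\<^esub> x = \<zero>\<^bsub>times_L0 M E\<^esub>"
      if x: "x \<in> carrier (times_L0 M E)" for x
    proof -
      obtain z f where "x = (z, ae_class M f)" "z \<in> carrier E" "f \<in> borel_measurable M"
        using x by (cases x) (auto elim!: ae_classesE)
      then show ?thesis
        by (intro bexI[of _ "(\<ominus>\<^bsub>E\<^esub> z, ae_class M (\<lambda>\<omega>. - f \<omega>))"]) (auto simp: M.l_neg)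
    qed
  qed (auto elim!: ae_classesE simp: M.a_ac algebra_simps)
  have "module (L0 M) (times_L0 M E)"
  proof (intro module.intro module_axioms.intro)
    show "cring (L0 M)" by (rule R.cring_axioms)
    show "abelian_group (times_L0 M E)" by (rule ag)
    show "\<one>\<^bsub>L0 M\<^esub> \<odot>\<^bsub>times_L0 M E\<^esub> x = x" if "x \<in> carrier (times_L0 M E)" for x
      using that smult_one by (auto elim!: ae_classesE)
  qed (use smult_closed smult_r_distr in \<open>auto elim!: ae_classesE
        simp: algebra_simps sc_add[unfolded sc_def, symmetric] sc_sc[unfolded sc_def, symmetric]\<close>)
  moreover have "rn_module_axioms M (times_L0 M E)"
  proof
    fix x y :: "'e \<times> ('w \<Rightarrow> real) set" and \<xi>
    assume x: "x \<in> carrier (times_L0 M E)"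
    obtain z f where f: "x = (z, ae_class M f)" "z \<in> carrier E" "f \<in> borel_measurable M"
      using x by (cases x) (auto elim!: ae_classesE)
    have n: "rnorm (times_L0 M E) (z, ae_class M f) = ae_class M (\<lambda>\<omega>. N z \<omega> + \<bar>f \<omega>\<bar>)"
      if "z \<in> carrier E" "f \<in> borel_measurable M" for z f
      using that by (simp add: rnorm_eq lift1_ae_class)
    show "rnorm (times_L0 M E) x \<in> L0_plus M"
      using f by (simp add: n L0_plus_def cls_le_ae_class del: times_simps(5))
    show "x = \<zero>\<^bsub>times_L0 M E\<^esub>" if "rnorm (times_L0 M E) x = \<zero>\<^bsub>L0 M\<^esub>"
    proof -
      have ae: "AE \<omega> in M. N z \<omega> + \<bar>f \<omega>\<bar> = 0"
        using f that by (simp add: n ae_class_eq_iff del: times_simps(5))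
      then have "AE \<omega> in M. N z \<omega> = 0" "AE \<omega> in M. f \<omega> = 0"
        by (eventually_elim, use N_nonneg[of z] in \<open>smt (verit)\<close>)+
      then show ?thesis using f N_zeroD[of z] by (simp add: ae_class_eq_iff)
    qed
    show "rnorm (times_L0 M E) (\<xi> \<odot>\<^bsub>times_L0 M E\<^esub> x)
        = lift1 M abs \<xi> \<otimes>\<^bsub>L0 M\<^esub> rnorm (times_L0 M E) x"
      if xi: "\<xi> \<in> carrier (L0 M)"
    proof -
      obtain a where a: "a \<in> borel_measurable M" "\<xi> = ae_class M a"
        using xi by (auto elim!: ae_classesE)
      have "AE \<omega> in M. N (sc a z) \<omega> + \<bar>a \<omega> * f \<omega>\<bar> = \<bar>a \<omega>\<bar> * (N z \<omega> + \<bar>f \<omega>\<bar>)"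
        using N_sc[OF a(1) f(2)] by eventually_elim (simp add: abs_mult algebra_simps)
      then show ?thesis using a f n[of "sc a z" "\<lambda>\<omega>. a \<omega> * f \<omega>"]
        by (simp add: n lift1_ae_class sc_def ae_class_eq_iff del: times_simps(5))
    qed
    show "cls_le M (rnorm (times_L0 M E) (x \<oplus>\<^bsub>times_L0 M E\<^esub> y))
        (rnorm (times_L0 M E) x \<oplus>\<^bsub>L0 M\<^esub> rnorm (times_L0 M E) y)"
      if y: "y \<in> carrier (times_L0 M E)"
    proof -
      obtain u g where g: "y = (u, ae_class M g)" "u \<in> carrier E" "g \<in> borel_measurable M"
        using y by (cases y) (auto elim!: ae_classesE)
      have "AE \<omega> in M. N (z \<oplus>\<^bsub>E\<^esub> u) \<omega> + \<bar>f \<omega> + g \<omega>\<bar> \<le> N z \<omega> + \<bar>f \<omega>\<bar> + (N u \<omega> + \<bar>g \<omega>\<bar>)"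
        using N_add[OF f(2) g(2)] by eventually_elim auto
      then show ?thesis using f g n[of "z \<oplus>\<^bsub>E\<^esub> u" "\<lambda>\<omega>. f \<omega> + g \<omega>"]
        by (simp add: n cls_le_ae_class del: times_simps(5))
    qed
  qed
  ultimately show ?thesis by (intro rn_module.intro prob_space_axioms)
qed

lemma N_L0:
  assumes [measurable]: "f \<in> borel_measurable M"
  shows "AE \<omega> in M. rn_module.N (L0 M) (ae_class M f) \<omega> = \<bar>f \<omega>\<bar>"
proof -
  interpret L: rn_module M "L0 M" by (rule L0_rn_module)
  show ?thesis unfolding L.N_def
    using rep_ae_class[of "\<lambda>\<omega>. \<bar>f \<omega>\<bar>" M] by (simp add: lift1_ae_class) (auto elim: eventually_mono)
qed

lemma sc_L0 [simp]:
  assumes [measurable]: "a \<in> borel_measurable M" "f \<in> borel_measurable M"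
  shows "rn_module.sc M (L0 M) a (ae_class M f) = ae_class M (\<lambda>\<omega>. a \<omega> * f \<omega>)"
  by (simp add: rn_module.sc_def[OF L0_rn_module])

lemma lc_L0 [simp]:
  assumes [measurable]: "a \<in> borel_measurable M" "f \<in> borel_measurable M"
    "b \<in> borel_measurable M" "g \<in> borel_measurable M"
  shows "rn_module.lc M (L0 M) a (ae_class M f) b (ae_class M g)
    = ae_class M (\<lambda>\<omega>. a \<omega> * f \<omega> + b \<omega> * g \<omega>)"
  by (simp add: rn_module.lc_def[OF L0_rn_module])

lemma D_L0:
  assumes [measurable]: "f \<in> borel_measurable M" "g \<in> borel_measurable M"
  shows "AE \<omega> in M. rn_module.D M (L0 M) (ae_class M f) (ae_class M g) \<omega> = \<bar>f \<omega> - g \<omega>\<bar>"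
  using N_L0[of "\<lambda>\<omega>. f \<omega> - g \<omega>"] by (simp add: rn_module.D_def[OF L0_rn_module])

lemma D_times:
  assumes [measurable]: "f \<in> borel_measurable M" "g \<in> borel_measurable M"
    and [simp]: "x \<in> carrier E" "y \<in> carrier E"
  shows "AE \<omega> in M. rn_module.D M (times_L0 M E) (x, ae_class M f) (y, ae_class M g) \<omega>
    = D x y \<omega> + \<bar>f \<omega> - g \<omega>\<bar>"
proof -
  interpret P: rn_module M "times_L0 M E" by (rule times_rn_module)
  have eq: "P.lc (\<lambda>_. 1) (x, ae_class M f) (\<lambda>_. - 1) (y, ae_class M g)
    = (lc (\<lambda>_. 1) x (\<lambda>_. - 1) y, ae_class M (\<lambda>\<omega>. f \<omega> - g \<omega>))"
    unfolding P.lc_def P.sc_def lc_def sc_def by simp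
  have "rnorm (times_L0 M E) (lc (\<lambda>_. 1) x (\<lambda>_. - 1) y, ae_class M (\<lambda>\<omega>. f \<omega> - g \<omega>))
    = ae_class M (\<lambda>\<omega>. D x y \<omega> + \<bar>f \<omega> - g \<omega>\<bar>)"
    by (simp add: rnorm_eq lift1_ae_class D_def)
  then have "AE \<omega> in M. rep (rnorm (times_L0 M E) (lc (\<lambda>_. 1) x (\<lambda>_. - 1) y,
      ae_class M (\<lambda>\<omega>. f \<omega> - g \<omega>))) \<omega> = D x y \<omega> + \<bar>f \<omega> - g \<omega>\<bar>"
    using rep_ae_class[of "\<lambda>\<omega>. D x y \<omega> + \<bar>f \<omega> - g \<omega>\<bar>" M] by simp
  then show ?thesis unfolding P.D_def P.N_def eq by eventually_elim simp
qed

subsection \<open>The topology of convergence in probability\<close>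

text \<open>The mean of the truncated distance is the usual metric for convergence in probability.
  The value 0 outside the carrier keeps it symmetric and nonnegative for all arguments, as
  \<open>Metric_space\<close> demands.\<close>

definition dst :: "'e \<Rightarrow> 'e \<Rightarrow> real" where
  "dst x y = (if x \<in> carrier E \<and> y \<in> carrier E then LINT \<omega>|M. min 1 (D x y \<omega>) else 0)"

lemma integrable_min1:
  assumes "f \<in> borel_measurable M" "AE \<omega> in M. 0 \<le> f \<omega>"
  shows "integrable M (\<lambda>\<omega>. min 1 (f \<omega>) :: real)"
proof (rule integrable_const_bound[of _ 1])
  show "AE \<omega> in M. norm (min 1 (f \<omega>)) \<le> 1" using assms(2) by eventually_elim auto
qed (use assms in measurable)

lemma dst_nonneg [simp]: "0 \<le> dst x y"
  by (simp add: dst_def)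

lemma dst_eq: "x \<in> carrier E \<Longrightarrow> y \<in> carrier E \<Longrightarrow> dst x y = (LINT \<omega>|M. min 1 (D x y \<omega>))"
  by (simp add: dst_def)

lemma dst_le:
  assumes "x \<in> carrier E" "y \<in> carrier E" "integrable M g" "AE \<omega> in M. min 1 (D x y \<omega>) \<le> g \<omega>"
  shows "dst x y \<le> (LINT \<omega>|M. g \<omega>)"
  unfolding dst_eq[OF assms(1,2)] using assms
  by (intro integral_mono_AE integrable_min1) auto

sublocale dm: Metric_space "carrier E" dst
proof
  show "dst x y = dst y x" for x y
    using D_commute[of x y] by (auto simp: dst_def intro!: integral_cong_AE)
  show "dst x y = 0 \<longleftrightarrow> x = y" if [simp]: "x \<in> carrier E" "y \<in> carrier E" for x y
  proof -
    have "dst x y = 0 \<longleftrightarrow> (AE \<omega> in M. min 1 (D x y \<omega>) = 0)"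
      by (simp add: dst_eq integral_nonneg_eq_0_iff_AE integrable_min1)
    also have "\<dots> \<longleftrightarrow> (AE \<omega> in M. D x y \<omega> = 0)"
      by (intro eventually_subst always_eventually allI) (auto simp: min_def)
    also have "\<dots> \<longleftrightarrow> x = y" using D_zeroD[of x y] D_self[of x] by auto
    finally show ?thesis .
  qed
  show "dst x z \<le> dst x y + dst y z"
    if [simp]: "x \<in> carrier E" "y \<in> carrier E" "z \<in> carrier E" for x y z
  proof -
    have "dst x z \<le> (LINT \<omega>|M. min 1 (D x y \<omega>) + min 1 (D y z \<omega>))"
      using D_triangle[of x y z]
      by (intro dst_le Bochner_Integration.integrable_add integrable_min1)
        (auto elim!: eventually_mono simp: add_increasing add_increasing2 min_def)
    also have "\<dots> = dst x y + dst y z"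
      by (simp add: dst_eq integrable_min1)
    finally show ?thesis .
  qed
qed simp

lemma dst_tendsto_AE:
  assumes s: "\<And>n. s n \<in> carrier E" and l: "l \<in> carrier E"
    and ae: "AE \<omega> in M. (\<lambda>n. D (s n) l \<omega>) \<longlonglongrightarrow> 0"
  shows "(\<lambda>n. dst (s n) l) \<longlonglongrightarrow> 0"
proof -
  have "(\<lambda>n. LINT \<omega>|M. min 1 (D (s n) l \<omega>)) \<longlonglongrightarrow> (LINT \<omega>|M. (0::real))"
  proof (rule integral_dominated_convergence[where w = "\<lambda>_. 1"])
    show "AE \<omega> in M. (\<lambda>n. min 1 (D (s n) l \<omega>)) \<longlonglongrightarrow> 0"
      using ae
    proof eventually_elim
      case (elim \<omega>)
      show ?case using tendsto_min[OF tendsto_const elim, of 1] by simp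
    qed
  qed (use s l in auto)
  then show ?thesis using s l by (simp add: dst_eq)
qed

lemma dst_AE_subseq:
  assumes s: "\<And>n. s n \<in> carrier E" and l: "l \<in> carrier E"
    and lim: "(\<lambda>n. dst (s n) l) \<longlonglongrightarrow> 0"
  obtains r :: "nat \<Rightarrow> nat" where "strict_mono r" "AE \<omega> in M. (\<lambda>n. D (s (r n)) l \<omega>) \<longlonglongrightarrow> 0"
proof -
  have "\<exists>r::nat\<Rightarrow>nat. strict_mono r \<and> (AE \<omega> in M. (\<lambda>n. min 1 (D (s (r n)) l \<omega>)) \<longlonglongrightarrow> 0)"
    using lim s l by (intro tendsto_L1_AE_subseq integrable_min1) (auto simp: dst_eq)
  then obtain r :: "nat \<Rightarrow> nat" where r: "strict_mono r"
    "AE \<omega> in M. (\<lambda>n. min 1 (D (s (r n)) l \<omega>)) \<longlonglongrightarrow> 0" by blast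
  have "AE \<omega> in M. (\<lambda>n. D (s (r n)) l \<omega>) \<longlonglongrightarrow> 0"
    using r(2)
  proof eventually_elim
    case (elim \<omega>)
    \<comment> \<open>The limit 0 lies below 1, so the truncation is inactive from some index on and
      the limit passes to \<open>D\<close> itself.\<close>
    then have "\<forall>\<^sub>F n in sequentially. min 1 (D (s (r n)) l \<omega>) < 1"
      by (rule order_tendstoD) simp
    then have "\<forall>\<^sub>F n in sequentially. min 1 (D (s (r n)) l \<omega>) = D (s (r n)) l \<omega>"
      by eventually_elim auto
    with elim show ?case by (rule Lim_transform_eventually)
  qed
  with r(1) show ?thesis by (rule that)
qed

lemma el_nbhd_iff:
  assumes [simp]: "x \<in> carrier E" "y \<in> carrier E"
  shows "y \<ominus>\<^bsub>E\<^esub> x \<in> el_nbhd M E \<epsilon> \<delta> \<longleftrightarrow> measure M {\<omega> \<in> space M. \<epsilon> \<le> D y x \<omega>} < \<delta>"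
proof -
  have "measure M {\<omega> \<in> space M. rep (rnorm E (y \<ominus>\<^bsub>E\<^esub> x)) \<omega> < \<epsilon>}
    = measure M {\<omega> \<in> space M. D y x \<omega> < \<epsilon>}"
    using rep_rnorm[of "y \<ominus>\<^bsub>E\<^esub> x"]
    by (intro finite_measure_eq_AE) (auto simp: D_eq_N)
  also have "{\<omega> \<in> space M. D y x \<omega> < \<epsilon>} = space M - {\<omega> \<in> space M. \<epsilon> \<le> D y x \<omega>}" by auto
  also have "measure M \<dots> = 1 - measure M {\<omega> \<in> space M. \<epsilon> \<le> D y x \<omega>}"
    by (intro prob_compl) simp
  finally show ?thesis by (auto simp: el_nbhd_def)
qed

text \<open>The truncated distance is at most \<open>\<epsilon>\<close> plus the indicator of the
  event that \<open>D\<close> reaches \<open>\<epsilon>\<close>. The converse estimate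
  \<open>prob_less_of_dst\<close> is Markov's inequality.\<close>

lemma dst_less_of_prob:
  assumes [simp]: "x \<in> carrier E" "y \<in> carrier E" and "0 < \<epsilon>" "measure M {\<omega> \<in> space M. \<epsilon> \<le> D y x \<omega>} < \<delta>"
  shows "dst y x < \<epsilon> + \<delta>"
proof -
  have int: "integrable M (indicat_real {\<omega> \<in> space M. \<epsilon> \<le> D y x \<omega>})"
    by (rule integrable_real_indicator) (auto simp: emeasure_eq_measure)
  have "dst y x \<le> (LINT \<omega>|M. \<epsilon> + indicator {\<omega> \<in> space M. \<epsilon> \<le> D y x \<omega>} \<omega>)"
    using assms(3) by (intro dst_le Bochner_Integration.integrable_add int)
      (auto split: split_indicator)
  also have "\<dots> = \<epsilon> + measure M {\<omega> \<in> space M. \<epsilon> \<le> D y x \<omega>}"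
    by (subst Bochner_Integration.integral_add) (auto simp: prob_space int)
  finally show ?thesis using assms(4) by simp
qed

lemma prob_less_of_dst:
  assumes [simp]: "x \<in> carrier E" "y \<in> carrier E" and "0 < \<epsilon>" "\<epsilon> \<le> 1" "dst y x < \<epsilon> * \<delta>"
  shows "measure M {\<omega> \<in> space M. \<epsilon> \<le> D y x \<omega>} < \<delta>"
proof -
  have "\<epsilon> * measure M {\<omega> \<in> space M. \<epsilon> \<le> D y x \<omega>}
    = (LINT \<omega>|M. \<epsilon> * indicator {\<omega> \<in> space M. \<epsilon> \<le> D y x \<omega>} \<omega>)"
    by simp
  also have "\<dots> \<le> dst y x" unfolding dst_eq[OF assms(2,1)]
    using assms(3,4) by (intro integral_mono integrable_min1 integrable_mult_right integrable_real_indicator)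
      (auto simp: emeasure_eq_measure split: split_indicator)
  finally show ?thesis using assms(3,5) by (smt (verit) mult_le_cancel_left_pos)
qed

lemma el_topology_eq: "el_topology M E = dm.mtopology"
proof -
  have "el_open M E U \<longleftrightarrow> dm.mopen U" for U
  proof (cases "U \<subseteq> carrier E")
    case sub: True
    have "(\<exists>\<epsilon> \<delta>. 0 < \<epsilon> \<and> 0 < \<delta> \<and> \<delta> < 1 \<and> {y \<in> carrier E. y \<ominus>\<^bsub>E\<^esub> x \<in> el_nbhd M E \<epsilon> \<delta>} \<subseteq> U)
      \<longleftrightarrow> (\<exists>r>0. dm.mball x r \<subseteq> U)" if "x \<in> U" for x
    proof
      have x: "x \<in> carrier E" using sub that by blast
      {
        assume "\<exists>\<epsilon> \<delta>. 0 < \<epsilon> \<and> 0 < \<delta> \<and> \<delta> < 1 \<and> {y \<in> carrier E. y \<ominus>\<^bsub>E\<^esub> x \<in> el_nbhd M E \<epsilon> \<delta>} \<subseteq> U"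
        then obtain \<epsilon> \<delta> :: real where *: "0 < \<epsilon>" "0 < \<delta>"
          "{y \<in> carrier E. y \<ominus>\<^bsub>E\<^esub> x \<in> el_nbhd M E \<epsilon> \<delta>} \<subseteq> U" by blast
        \<comment> \<open>The radius comes from Markov's inequality at the threshold
          \<open>min 1 \<epsilon>\<close>, which has to be at most 1 because \<open>dst\<close> is
          truncated.\<close>
        have "dm.mball x (min 1 \<epsilon> * \<delta>) \<subseteq> U"
        proof
          fix y assume "y \<in> dm.mball x (min 1 \<epsilon> * \<delta>)"
          then have y: "y \<in> carrier E" "dst y x < min 1 \<epsilon> * \<delta>" by (auto simp: dm.commute)
          have "measure M {\<omega> \<in> space M. min 1 \<epsilon> \<le> D y x \<omega>} < \<delta>"
            using * y x by (intro prob_less_of_dst) auto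
          moreover have "measure M {\<omega> \<in> space M. \<epsilon> \<le> D y x \<omega>}
              \<le> measure M {\<omega> \<in> space M. min 1 \<epsilon> \<le> D y x \<omega>}"
            using x y by (intro finite_measure_mono) auto
          ultimately show "y \<in> U" using * y x by (auto simp: el_nbhd_iff)
        qed
        then show "\<exists>r>0. dm.mball x r \<subseteq> U" using * by (intro exI[of _ "min 1 \<epsilon> * \<delta>"]) auto
      next
        assume "\<exists>r>0. dm.mball x r \<subseteq> U"
        then obtain r where r: "r > 0" "dm.mball x r \<subseteq> U" by blast
        \<comment> \<open>Half of \<open>r\<close> goes to the threshold and half to the
          probability; the bound \<open>1 / 2\<close> keeps the second parameter below 1.\<close>
        define \<epsilon> where "\<epsilon> = min (r / 2) (1 / 2)"
        have "{y \<in> carrier E. y \<ominus>\<^bsub>E\<^esub> x \<in> el_nbhd M E \<epsilon> \<epsilon>} \<subseteq> U"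
        proof clarsimp
          fix y assume y: "y \<in> carrier E" "y \<ominus>\<^bsub>E\<^esub> x \<in> el_nbhd M E \<epsilon> \<epsilon>"
          then have "dst y x < \<epsilon> + \<epsilon>" 
            using x r by (intro dst_less_of_prob) (auto simp: el_nbhd_iff \<epsilon>_def)
          then have "y \<in> dm.mball x r" using x y by (auto simp: dm.commute \<epsilon>_def)
          then show "y \<in> U" using r by blast
        qed
        then show "\<exists>\<epsilon> \<delta>. 0 < \<epsilon> \<and> 0 < \<delta> \<and> \<delta> < 1 \<and> {y \<in> carrier E. y \<ominus>\<^bsub>E\<^esub> x \<in> el_nbhd M E \<epsilon> \<delta>} \<subseteq> U"
          using r by (intro exI[of _ \<epsilon>]) (auto simp: \<epsilon>_def)
      }
    qed
    then show ?thesis using sub by (auto simp: el_open_def dm.mopen_def)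
  qed (auto simp: el_open_def dm.mopen_def)
  then have "el_open M E = dm.mopen" by blast
  then show ?thesis by (simp add: el_topology_def dm.mtopology_def)
qed

text \<open>A sequence converging in probability has an almost everywhere convergent subsequence,
  and almost everywhere convergence implies convergence in probability. So closedness can be tested
  where all estimates are pointwise.\<close>

lemma closedin_AE_iff:
  "closedin (el_topology M E) S \<longleftrightarrow> S \<subseteq> carrier E \<and>
    (\<forall>s l. (\<forall>n. s n \<in> S) \<and> l \<in> carrier E \<and> (AE \<omega> in M. (\<lambda>n. D (s n) l \<omega>) \<longlonglongrightarrow> 0) \<longrightarrow> l \<in> S)"
  (is "?L \<longleftrightarrow> _ \<and> ?R")
proof (cases "S \<subseteq> carrier E")
  case sub: True
  show ?thesis
  proof
    assume L: ?L
    have ?R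
    proof clarify
      fix s l assume *: "\<forall>n. s n \<in> S" "l \<in> carrier E" "AE \<omega> in M. (\<lambda>n. D (s n) l \<omega>) \<longlonglongrightarrow> 0"
      have "(\<lambda>n. dst (s n) l) \<longlonglongrightarrow> 0" using * sub by (intro dst_tendsto_AE) auto
      then have "limitin dm.mtopology s l sequentially"
 unfolding dm.limitin_metric_dist_null
        using * sub by (auto intro!: always_eventually)
      then show "l \<in> S" using L *(1) unfolding el_topology_eq dm.metric_closedin_iff_sequentially_closed by blast
    qed
    with sub show "S \<subseteq> carrier E \<and> ?R" by blast
  next
    assume R: "S \<subseteq> carrier E \<and> ?R"
    show ?L unfolding el_topology_eq dm.metric_closedin_iff_sequentially_closed
    proof (intro conjI sub allI impI)
      fix s l assume *: "range s \<subseteq> S \<and> limitin dm.mtopology s l sequentially"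
      then have l: "l \<in> carrier E" "(\<lambda>n. dst (s n) l) \<longlonglongrightarrow> 0" and s: "\<And>n. s n \<in> S"
        by (auto simp: dm.limitin_metric_dist_null)
      obtain r :: "nat \<Rightarrow> nat" where r: "strict_mono r" "AE \<omega> in M. (\<lambda>n. D (s (r n)) l \<omega>) \<longlonglongrightarrow> 0"
        using dst_AE_subseq[OF _ l] s sub by blast
      then show "l \<in> S" using R[THEN conjunct2, rule_format, of "\<lambda>n. s (r n)" l] l s by auto
    qed
  qed
next
  case False
  then show ?thesis using closedin_subset[of dm.mtopology S] by (auto simp: el_topology_eq)
qed

end

section \<open>Almost sure summability from summable means\<close>

lemma AE_summable_of_integral:
  fixes f :: "nat \<Rightarrow> 'a \<Rightarrow> real"
  assumes int: "\<And>k. integrable M (f k)" and nn: "\<And>k \<omega>. 0 \<le> f k \<omega>"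
    and sum: "summable (\<lambda>k. LINT \<omega>|M. f k \<omega>)"
  shows "AE \<omega> in M. summable (\<lambda>k. f k \<omega>)"
proof -
  have [measurable]: "f k \<in> borel_measurable M" for k using int[of k] by auto
  have "(\<integral>\<^sup>+ \<omega>. (\<Sum>k. ennreal (f k \<omega>)) \<partial>M) = (\<Sum>k. \<integral>\<^sup>+ \<omega>. ennreal (f k \<omega>) \<partial>M)"
    by (rule nn_integral_suminf) measurable
  also have "\<dots> = (\<Sum>k. ennreal (LINT \<omega>|M. f k \<omega>))"
    by (rule suminf_cong, rule nn_integral_eq_integral[OF int]) (simp add: nn)
  also have "\<dots> < \<infinity>"
    by (subst suminf_ennreal2) (use nn sum in auto)
  finally have "AE \<omega> in M. (\<Sum>k. ennreal (f k \<omega>)) \<noteq> \<infinity>"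
    by (intro nn_integral_PInf_AE) auto
  then show ?thesis
    by eventually_elim (use nn in \<open>auto intro!: summable_suminf_not_top\<close>)
qed

context rn_module
begin

subsection \<open>Completeness and automatic continuity\<close>

lemma dst_zero_eq: "x \<in> carrier E \<Longrightarrow> dst x \<zero>\<^bsub>E\<^esub> = (LINT \<omega>|M. min 1 (N x \<omega>))"
  by (simp add: dst_eq N_eq_D)

lemma dst_minus: "x \<in> carrier E \<Longrightarrow> y \<in> carrier E \<Longrightarrow> dst x y = dst (x \<ominus>\<^bsub>E\<^esub> y) \<zero>\<^bsub>E\<^esub>"
  by (simp add: dst_zero_eq) (simp add: dst_eq D_eq_N)

lemma mcomplete:
  assumes "rn_complete M E"
  shows "dm.mcomplete"
  unfolding dm.mcomplete_def
proof (intro allI impI)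
  fix s assume s: "dm.MCauchy s"
  then have sc: "\<And>n. s n \<in> carrier E" by (auto simp: dm.MCauchy_def)
  have "rn_Cauchy M E s"
    unfolding rn_Cauchy_def
  proof (intro conjI allI impI)
    show "range s \<subseteq> carrier E" using sc by auto
    fix \<epsilon> \<delta> :: real assume *: "0 < \<epsilon> \<and> 0 < \<delta> \<and> \<delta> < 1"
    then obtain K where K: "\<And>m n. K \<le> m \<Longrightarrow> K \<le> n \<Longrightarrow> dst (s m) (s n) < min 1 \<epsilon> * \<delta>"
      using s unfolding dm.MCauchy_def by (metis mult_pos_pos min_less_iff_conj zero_less_one)
    have "s m \<ominus>\<^bsub>E\<^esub> s n \<in> el_nbhd M E \<epsilon> \<delta>" if "K \<le> m" "K \<le> n" for m n
    proof -
      have "measure M {\<omega> \<in> space M. min 1 \<epsilon> \<le> D (s m) (s n) \<omega>} < \<delta>"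
        using K[OF that] * sc by (intro prob_less_of_dst) auto
      moreover have "measure M {\<omega> \<in> space M. \<epsilon> \<le> D (s m) (s n) \<omega>}
          \<le> measure M {\<omega> \<in> space M. min 1 \<epsilon> \<le> D (s m) (s n) \<omega>}"
        using sc by (intro finite_measure_mono) auto
      ultimately show ?thesis using sc by (simp add: el_nbhd_iff)
    qed
    then show "\<exists>K. \<forall>m\<ge>K. \<forall>n\<ge>K. s m \<ominus>\<^bsub>E\<^esub> s n \<in> el_nbhd M E \<epsilon> \<delta>" by blast
  qed
  then show "\<exists>x. limitin dm.mtopology s x sequentially"
    using assms by (simp add: rn_complete_def el_topology_eq)
qed

text \<open>Summable increments make the sequence Cauchy for \<open>dst\<close>, which yields a
  limit in probability; the tail sums then upgrade this to almost everywhere convergence of the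
  whole sequence.\<close>

lemma complete_AE:
  assumes comp: "rn_complete M E" and s: "\<And>n. s n \<in> carrier E"
    and sum: "AE \<omega> in M. summable (\<lambda>n. D (s (Suc n)) (s n) \<omega>)"
  obtains l where "l \<in> carrier E" "AE \<omega> in M. (\<lambda>n. D (s n) l \<omega>) \<longlonglongrightarrow> 0"
proof -
  \<comment> \<open>The tail sum from \<open>n\<close> on; it dominates the distance of
    \<open>s n\<close> to every later element.\<close>
  define t where "t n \<omega> = (\<Sum>k. D (s (Suc (k + n))) (s (k + n)) \<omega>)" for n \<omega>
  have tmeas [measurable]: "t n \<in> borel_measurable M" for n unfolding t_def using s by measurable
  have t0: "AE \<omega> in M. (\<lambda>n. t n \<omega>) \<longlonglongrightarrow> 0"
    using sum
  proof eventually_elim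
    case (elim \<omega>)
    show ?case unfolding t_def using suminf_exist_split2[OF elim] by simp
  qed
  have tri: "AE \<omega> in M. \<forall>m n. D (s m) (s n) \<omega> = D (s n) (s m) \<omega> \<and> D (s n) (s n) \<omega> = 0 \<and>
      (\<forall>k. D (s m) (s n) \<omega> \<le> D (s m) (s k) \<omega> + D (s k) (s n) \<omega>)"
    unfolding AE_all_countable AE_conj_iff using s D_commute D_self D_triangle by simp
  have tail: "AE \<omega> in M. \<forall>n m. n \<le> m \<longrightarrow> D (s m) (s n) \<omega> \<le> t n \<omega>"
    using tri sum
  proof eventually_elim
    case (elim \<omega>)
    have "D (s (n + k)) (s n) \<omega> \<le> (\<Sum>j<k. D (s (Suc (j + n))) (s (j + n)) \<omega>)" for n k
    proof (induction k)
      case 0 show ?case using elim(1) by simp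
    next
      case (Suc k)
      have "D (s (n + Suc k)) (s n) \<omega> \<le> D (s (Suc (k + n))) (s (k + n)) \<omega> + D (s (n + k)) (s n) \<omega>"
        using elim(1)[rule_format, of "n + Suc k" n] by (auto simp: add.commute)
      with Suc show ?case by simp
    qed
    also have "(\<Sum>j<k. D (s (Suc (j + n))) (s (j + n)) \<omega>) \<le> t n \<omega>" for n k
      unfolding t_def
      by (rule sum_le_suminf) (use summable_ignore_initial_segment[OF elim(2), of n] in auto)
    finally show ?case by (metis le_iff_add)
  qed
  have tnn: "AE \<omega> in M. \<forall>n. 0 \<le> t n \<omega>"
    using tail by eventually_elim (meson D_nonneg order_refl order_trans)
  have lim: "(\<lambda>n. LINT \<omega>|M. min 1 (t n \<omega>)) \<longlonglongrightarrow> (LINT \<omega>|M. (0::real))"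
  proof (rule integral_dominated_convergence[where w = "\<lambda>_. 1"])
    show "AE \<omega> in M. (\<lambda>n. min 1 (t n \<omega>)) \<longlonglongrightarrow> 0"
      using t0
    proof eventually_elim
      case (elim \<omega>)
      show ?case using tendsto_min[OF tendsto_const elim, of 1] by simp
    qed
    show "AE \<omega> in M. norm (min 1 (t n \<omega>)) \<le> 1" for n using tnn by eventually_elim auto
  qed auto
  have le: "dst (s m) (s n) \<le> (LINT \<omega>|M. min 1 (t n \<omega>))" if "n \<le> m" for m n
  proof (rule dst_le)
    show "integrable M (\<lambda>\<omega>. min 1 (t n \<omega>))" using tnn by (intro integrable_min1) auto
    show "AE \<omega> in M. min 1 (D (s m) (s n) \<omega>) \<le> min 1 (t n \<omega>)"
      using tail by eventually_elim (use that in \<open>meson min.mono order_refl\<close>)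
  qed (use s in auto)
  have "dm.MCauchy s"
    unfolding dm.MCauchy_def
  proof (intro conjI allI impI)
    fix \<epsilon> :: real assume "\<epsilon> > 0"
    then have "\<forall>\<^sub>F n in sequentially. (LINT \<omega>|M. min 1 (t n \<omega>)) < \<epsilon>"
      using lim by (intro order_tendstoD) auto
    then obtain K where K: "\<And>n. K \<le> n \<Longrightarrow> (LINT \<omega>|M. min 1 (t n \<omega>)) < \<epsilon>"
      by (auto simp: eventually_sequentially)
    have "dst (s m) (s n) < \<epsilon>" if "K \<le> m" "K \<le> n" for m n
      using le[of n m] le[of m n] K that dm.commute[of "s m" "s n"] by (cases "n \<le> m") fastforce+
    then show "\<exists>K. \<forall>m n. K \<le> m \<longrightarrow> K \<le> n \<longrightarrow> dst (s m) (s n) < \<epsilon>" by blast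
  qed (use s in auto)
  then obtain l where l: "l \<in> carrier E" "(\<lambda>n. dst (s n) l) \<longlonglongrightarrow> 0"
    using mcomplete[OF comp] unfolding dm.mcomplete_def dm.limitin_metric_dist_null by blast
  obtain r :: "nat \<Rightarrow> nat" where r: "strict_mono r" "AE \<omega> in M. (\<lambda>n. D (s (r n)) l \<omega>) \<longlonglongrightarrow> 0"
    using dst_AE_subseq[OF s l] by blast
  have tri2: "AE \<omega> in M. \<forall>m n. D (s n) l \<omega> \<le> D (s n) (s m) \<omega> + D (s m) l \<omega>"
    unfolding AE_all_countable using s l D_triangle by simp
  have "AE \<omega> in M. (\<lambda>n. D (s n) l \<omega>) \<longlonglongrightarrow> 0"
    using tri2 tri r(2) tail t0
  proof eventually_elim
    case (elim \<omega>)
    \<comment> \<open>Only the subsequence \<open>r\<close> is known to converge at this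
      \<open>\<omega>\<close>. For fixed \<open>n\<close>, passing from \<open>s n\<close> to
      \<open>s (r k)\<close> costs at most \<open>t n \<omega>\<close>, and the remaining distance
      vanishes as \<open>k\<close> grows.\<close>
    have "D (s n) l \<omega> \<le> t n \<omega>" for n
    proof (rule LIMSEQ_le_const)
      show "(\<lambda>k. t n \<omega> + D (s (r k)) l \<omega>) \<longlonglongrightarrow> t n \<omega>"
        using tendsto_add[OF tendsto_const elim(3), of "t n \<omega>"] by simp
      have "D (s n) l \<omega> \<le> t n \<omega> + D (s (r k)) l \<omega>" if "n \<le> k" for k
      proof -
        have "n \<le> r k" using seq_suble[OF r(1), of k] that by simp
        then have "D (s (r k)) (s n) \<omega> \<le> t n \<omega>" using elim(4) by blast
        moreover have "D (s n) (s (r k)) \<omega> = D (s (r k)) (s n) \<omega>" using elim(2) by blast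
        moreover have "D (s n) l \<omega> \<le> D (s n) (s (r k)) \<omega> + D (s (r k)) l \<omega>" using elim(1) by blast
        ultimately show ?thesis by linarith
      qed
      then show "\<exists>N. \<forall>k\<ge>N. D (s n) l \<omega> \<le> t n \<omega> + D (s (r k)) l \<omega>" by blast
    qed
    then show ?case by (intro tendsto_sandwich[OF _ _ tendsto_const elim(5)]) auto
  qed
  with l(1) show ?thesis by (rule that)
qed

lemma cont_hom_tendsto:
  assumes h: "h \<in> cont_homs M E F" and F: "rn_module M F"
    and s: "\<And>n. s n \<in> carrier E" and l: "l \<in> carrier E"
    and lim: "(\<lambda>n. dst (s n) l) \<longlonglongrightarrow> 0"
  shows "(\<lambda>n. rn_module.dst M F (h (s n)) (h l)) \<longlonglongrightarrow> 0"
proof -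
  interpret F: rn_module M F by fact
  have "limitin dm.mtopology s l sequentially"
    unfolding dm.limitin_metric_dist_null using s l lim by (auto intro: always_eventually)
  moreover have "continuous_map dm.mtopology F.dm.mtopology h"
    using h by (simp add: cont_homs_def el_topology_eq F.el_topology_eq)
  ultimately have "limitin F.dm.mtopology (h \<circ> s) (h l) sequentially"
    by (rule continuous_map_limit[rotated])
  then show ?thesis by (simp add: F.dm.limitin_metric_dist_null o_def)
qed

text \<open>Additivity transports continuity at the origin to every point, so a bound on the mean of
  the truncated norm near the origin is enough.\<close>

lemma cont_homI:
  assumes F: "rn_module M F" and h: "h \<in> carrier E \<rightarrow> carrier F"
    and add: "\<And>x y. x \<in> carrier E \<Longrightarrow> y \<in> carrier E \<Longrightarrow> h (x \<oplus>\<^bsub>E\<^esub> y) = h x \<oplus>\<^bsub>F\<^esub> h y"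
    and smult: "\<And>\<xi> x. \<xi> \<in> ae_classes M \<Longrightarrow> x \<in> carrier E \<Longrightarrow> h (\<xi> \<odot>\<^bsub>E\<^esub> x) = \<xi> \<odot>\<^bsub>F\<^esub> h x"
    and cont: "\<And>\<epsilon>. \<epsilon> > 0 \<Longrightarrow> \<exists>r>0. \<forall>x\<in>carrier E. dst x \<zero>\<^bsub>E\<^esub> < r \<longrightarrow>
      (LINT \<omega>|M. min 1 (rn_module.N F (h x) \<omega>)) < \<epsilon>"
  shows "h \<in> cont_homs M E F"
proof -
  interpret F: rn_module M F by fact
  have diff: "h x \<ominus>\<^bsub>F\<^esub> h y = h (x \<ominus>\<^bsub>E\<^esub> y)" if [simp]: "x \<in> carrier E" "y \<in> carrier E" for x y
    using h smult add by (simp add: F.minus_eq_lc minus_eq_lc Pi_iff F.lc_def F.sc_def lc_def sc_def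
        del: sc_minus F.sc_minus)
  have "continuous_map dm.mtopology F.dm.mtopology h"
    unfolding dm.metric_continuous_map[OF F.dm.Metric_space_axioms]
  proof (intro conjI ballI allI impI)
    fix a and \<epsilon> :: real assume a: "a \<in> carrier E" and "\<epsilon> > 0"
    then obtain r where r: "r > 0" "\<And>x. x \<in> carrier E \<Longrightarrow> dst x \<zero>\<^bsub>E\<^esub> < r \<Longrightarrow>
      (LINT \<omega>|M. min 1 (F.N (h x) \<omega>)) < \<epsilon>" using cont by blast
    have "F.dst (h a) (h x) < \<epsilon>" if x: "x \<in> carrier E" "dst a x < r" for x
    proof -
      have "(LINT \<omega>|M. min 1 (F.N (h (a \<ominus>\<^bsub>E\<^esub> x)) \<omega>)) < \<epsilon>"
        using r(2)[of "a \<ominus>\<^bsub>E\<^esub> x"] x a dst_minus[of a x] by simp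
      moreover have "F.dst (h a) (h x) = (LINT \<omega>|M. min 1 (F.N (h (a \<ominus>\<^bsub>E\<^esub> x)) \<omega>))"
        using diff[OF a x(1)] h a x by (simp add: F.dst_eq Pi_iff F.D_eq_N)
      ultimately show ?thesis by simp
    qed
    then show "\<exists>\<delta>>0. \<forall>x. x \<in> carrier E \<and> dst a x < \<delta> \<longrightarrow> F.dst (h a) (h x) < \<epsilon>"
      using r by blast
  qed (use h in auto)
  then show ?thesis
    using h add smult by (auto simp: cont_homs_def el_topology_eq F.el_topology_eq)
qed

text \<open>Zabreiko's lemma: a countably subadditive seminorm on a complete module is continuous.
  Baire's theorem makes the closure of a sublevel set a neighbourhood of the origin; an
  element near the origin is then a convergent series of elements of small seminorm.\<close>

lemma zabreiko:
  assumes comp: "rn_complete M E"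
    and qmeas [measurable]: "\<And>x. x \<in> carrier E \<Longrightarrow> q x \<in> borel_measurable M"
    and q0: "\<And>x \<omega>. 0 \<le> q x \<omega>"
    and qadd: "\<And>x y. x \<in> carrier E \<Longrightarrow> y \<in> carrier E \<Longrightarrow> 
      AE \<omega> in M. q (x \<oplus>\<^bsub>E\<^esub> y) \<omega> \<le> q x \<omega> + q y \<omega>"
    and qsc: "\<And>x c. x \<in> carrier E \<Longrightarrow> AE \<omega> in M. q (sc (\<lambda>_. c) x) \<omega> = \<bar>c\<bar> * q x \<omega>"
    and csa: "\<And>s x. (\<And>n. s n \<in> carrier E) \<Longrightarrow> x \<in> carrier E \<Longrightarrow> s 0 = \<zero>\<^bsub>E\<^esub> \<Longrightarrow>
      AE \<omega> in M. (\<lambda>n. D (s n) x \<omega>) \<longlonglongrightarrow> 0 \<Longrightarrow>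
      AE \<omega> in M. summable (\<lambda>n. q (s (Suc n) \<ominus>\<^bsub>E\<^esub> s n) \<omega>) \<Longrightarrow>
      AE \<omega> in M. q x \<omega> \<le> (\<Sum>n. q (s (Suc n) \<ominus>\<^bsub>E\<^esub> s n) \<omega>)"
    and "\<epsilon> > 0"
  shows "\<exists>r>0. \<forall>x\<in>carrier E. dst x \<zero>\<^bsub>E\<^esub> < r \<longrightarrow> (LINT \<omega>|M. min 1 (q x \<omega>)) < \<epsilon>"
proof -
  define Q where "Q x = (LINT \<omega>|M. min 1 (q x \<omega>))" for x
  have int [intro]: "integrable M (\<lambda>\<omega>. min 1 (q x \<omega>))" if "x \<in> carrier E" for x
    using that q0 by (intro integrable_min1) auto
  have Qadd: "Q (x \<oplus>\<^bsub>E\<^esub> y) \<le> Q x + Q y" if [simp]: "x \<in> carrier E" "y \<in> carrier E" for x y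
  proof -
    have "Q (x \<oplus>\<^bsub>E\<^esub> y) \<le> (LINT \<omega>|M. min 1 (q x \<omega>) + min 1 (q y \<omega>))"
      unfolding Q_def
    proof (intro integral_mono_AE Bochner_Integration.integrable_add int)
      show "AE \<omega> in M. min 1 (q (x \<oplus>\<^bsub>E\<^esub> y) \<omega>) \<le> min 1 (q x \<omega>) + min 1 (q y \<omega>)"
        using qadd[OF that]
      proof eventually_elim
        case (elim \<omega>) then show ?case using q0[of x \<omega>] q0[of y \<omega>] by (auto simp: min_def)
      qed
    qed auto
    then show ?thesis by (simp add: Q_def int)
  qed
  \<comment> \<open>Absolute homogeneity makes \<open>q\<close> even, so subadditivity controls
    differences as well; later two elements of a sublevel set are subtracted.\<close>
  have sc_scale: "Q (sc (\<lambda>_. c) (x \<ominus>\<^bsub>E\<^esub> y)) \<le> Q (sc (\<lambda>_. c) x) + Q (sc (\<lambda>_. c) y)"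
    if [simp]: "x \<in> carrier E" "y \<in> carrier E" for c x y
  proof -
    have "sc (\<lambda>_. c) (x \<ominus>\<^bsub>E\<^esub> y) = sc (\<lambda>_. c) x \<oplus>\<^bsub>E\<^esub> sc (\<lambda>_. - c) y"
      by (simp add: minus_eq_lc lc_def sc_r_distr sc_sc del: sc_minus)
    then have "Q (sc (\<lambda>_. c) (x \<ominus>\<^bsub>E\<^esub> y)) \<le> Q (sc (\<lambda>_. c) x) + Q (sc (\<lambda>_. - c) y)"
      using Qadd[of "sc (\<lambda>_. c) x" "sc (\<lambda>_. - c) y"] by simp
    moreover have "Q (sc (\<lambda>_. - c) y) = Q (sc (\<lambda>_. c) y)"
      unfolding Q_def
    proof (rule integral_cong_AE)
      show "AE \<omega> in M. min 1 (q (sc (\<lambda>_. - c) y) \<omega>) = min 1 (q (sc (\<lambda>_. c) y) \<omega>)"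
        using qsc[of y c] qsc[of y "- c"] by auto
    qed auto
    ultimately show ?thesis by simp
  qed
  \<comment> \<open>Truncation destroys homogeneity: for a factor of modulus below 1 a large
    distance may stay truncated at 1, which is the reason for the maximum with 1.\<close>
  have dscale: "dst (sc (\<lambda>_. c) x) (sc (\<lambda>_. c) y) \<le> max 1 \<bar>c\<bar> * dst x y"
    if [simp]: "x \<in> carrier E" "y \<in> carrier E" for c x y
  proof -
    have "dst (sc (\<lambda>_. c) x) (sc (\<lambda>_. c) y) \<le> (LINT \<omega>|M. max 1 \<bar>c\<bar> * min 1 (D x y \<omega>))"
    proof (intro dst_le integrable_mult_right integrable_min1)
      have eq: "sc (\<lambda>_. c) x \<ominus>\<^bsub>E\<^esub> sc (\<lambda>_. c) y = sc (\<lambda>_. c) (x \<ominus>\<^bsub>E\<^esub> y)"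
        by (simp add: minus_eq_lc lc_def sc_r_distr sc_sc del: sc_minus)
      show "AE \<omega> in M. min 1 (D (sc (\<lambda>_. c) x) (sc (\<lambda>_. c) y) \<omega>) \<le> max 1 \<bar>c\<bar> * min 1 (D x y \<omega>)"
        using N_sc[of "\<lambda>_. c" "x \<ominus>\<^bsub>E\<^esub> y", OF borel_measurable_const M.minus_closed[OF that]]
      proof (simp add: D_eq_N eq, eventually_elim)
        case (elim \<omega>)
        let ?t = "N (x \<ominus>\<^bsub>E\<^esub> y) \<omega>"
        show ?case
        proof (cases "?t \<le> 1")
          case True
          have "\<bar>c\<bar> * ?t \<le> max 1 \<bar>c\<bar> * ?t" by (intro mult_right_mono) auto
          then show ?thesis using True elim by (simp add: min_def)
        next
          case False
          then show ?thesis using elim by (simp add: min_def max_def)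
        qed
      qed
    qed auto
    then show ?thesis by (simp add: dst_eq)
  qed
  have dadd: "dst (x \<ominus>\<^bsub>E\<^esub> y) (u \<ominus>\<^bsub>E\<^esub> v) \<le> dst x u + dst y v"
    if [simp]: "x \<in> carrier E" "y \<in> carrier E" "u \<in> carrier E" "v \<in> carrier E" for x y u v
  proof -
    have "dst (x \<ominus>\<^bsub>E\<^esub> y) (u \<ominus>\<^bsub>E\<^esub> v) \<le> (LINT \<omega>|M. min 1 (D x u \<omega>) + min 1 (D y v \<omega>))"
      using D_lc[of "\<lambda>_. 1" "\<lambda>_. - 1" x y u v]
      by (intro dst_le Bochner_Integration.integrable_add integrable_min1)
        (auto simp: minus_eq_lc elim!: eventually_mono simp: add_increasing add_increasing2 min_def)
    then show ?thesis by (simp add: dst_eq integrable_min1)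
  qed
  have nbhd: "\<exists>r>0. \<forall>h\<in>carrier E. dst h \<zero>\<^bsub>E\<^esub> < r \<longrightarrow>
      (\<forall>\<delta>>0. \<exists>u\<in>carrier E. Q u \<le> 2 * e \<and> dst u h < \<delta>)" if e: "e > 0" for e
  proof -
    \<comment> \<open>Elements whose dilate by \<open>1 / (n + 1)\<close> has small
      \<open>Q\<close>. Since \<open>q\<close> is finite, every element lies in some
      \<open>A n\<close>, so Baire's theorem applies to the closures.\<close>
    define A where "A n = {x \<in> carrier E. Q (sc (\<lambda>_. 1 / real (Suc n)) x) \<le> e}" for n
    have cover: "\<exists>n. x \<in> A n" if x [simp]: "x \<in> carrier E" for x
    proof -
      have "(\<lambda>n. LINT \<omega>|M. min 1 (q (sc (\<lambda>_. 1 / real (Suc n)) x) \<omega>)) \<longlonglongrightarrow> (LINT \<omega>|M. (0::real))"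
      proof (rule integral_dominated_convergence[where w = "\<lambda>_. 1"])
        have "AE \<omega> in M. \<forall>n. q (sc (\<lambda>_. 1 / real (Suc n)) x) \<omega> = \<bar>1 / real (Suc n)\<bar> * q x \<omega>"
          unfolding AE_all_countable by (intro allI qsc x)
        then show "AE \<omega> in M. (\<lambda>n. min 1 (q (sc (\<lambda>_. 1 / real (Suc n)) x) \<omega>)) \<longlonglongrightarrow> 0"
        proof eventually_elim
          case (elim \<omega>)
          have "(\<lambda>n. \<bar>1 / real (Suc n)\<bar> * q x \<omega>) \<longlonglongrightarrow> 0"
            using tendsto_mult_left_zero[OF LIMSEQ_inverse_real_of_nat, of "q x \<omega>"]
            by (simp add: inverse_eq_divide)
          then have "(\<lambda>n. q (sc (\<lambda>_. 1 / real (Suc n)) x) \<omega>) \<longlonglongrightarrow> 0" using elim by simp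
          from tendsto_min[OF tendsto_const this, of 1] show ?case by simp
        qed
      qed (use q0 in auto)
      then have "\<forall>\<^sub>F n in sequentially. Q (sc (\<lambda>_. 1 / real (Suc n)) x) < e"
        unfolding Q_def using e by (intro order_tendstoD) auto
      then obtain n where "Q (sc (\<lambda>_. 1 / real (Suc n)) x) < e"
        by (auto simp: eventually_sequentially)
      then show ?thesis by (auto simp: A_def intro: less_imp_le)
    qed
    have "\<exists>n. dm.mtopology interior_of (dm.mtopology closure_of A n) \<noteq> {}"
    proof (rule ccontr)
      assume "\<not> ?thesis"
      then have "dm.mtopology interior_of \<Union>(range (\<lambda>n. dm.mtopology closure_of A n)) = {}"
        by (intro dm.metric_Baire_category_alt mcomplete comp) auto
      moreover have "\<Union>(range (\<lambda>n. dm.mtopology closure_of A n)) = carrier E"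
      proof
        show "carrier E \<subseteq> \<Union>(range (\<lambda>n. dm.mtopology closure_of A n))"
        proof
          fix x assume "x \<in> carrier E"
          then obtain n where "x \<in> A n" using cover by blast
          moreover have "A n \<subseteq> dm.mtopology closure_of A n"
            by (rule closure_of_subset) (auto simp: A_def)
          ultimately show "x \<in> \<Union>(range (\<lambda>n. dm.mtopology closure_of A n))" by blast
        qed
        have "dm.mtopology closure_of A n \<subseteq> carrier E" for n
          using closure_of_subset_topspace[of dm.mtopology "A n"] by (simp only: dm.topspace_mtopology)
        then show "\<Union>(range (\<lambda>n. dm.mtopology closure_of A n)) \<subseteq> carrier E"
          by (rule UN_least)
      qed
      ultimately show False using interior_of_topspace[of dm.mtopology] M.zero_closed by auto
    qed
    then obtain n a where a: "a \<in> dm.mtopology interior_of (dm.mtopology closure_of A n)" by blast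
    then obtain \<rho> where \<rho>: "\<rho> > 0" "dm.mball a \<rho> \<subseteq> dm.mtopology closure_of A n" and aE: "a \<in> carrier E"
      using openin_interior_of[of dm.mtopology "dm.mtopology closure_of A n"]
        interior_of_subset[of dm.mtopology "dm.mtopology closure_of A n"]
      unfolding dm.openin_mtopology by blast
    define c where "c = real (Suc n)"
    have c: "c \<ge> 1" by (simp add: c_def)
    have apx: "\<exists>u\<in>carrier E. Q (sc (\<lambda>_. 1 / c) u) \<le> e \<and> dst u z < \<delta>" if z: "dst a z < \<rho>" "z \<in> carrier E" and "\<delta> > 0" for z \<delta>
    proof -
      have "z \<in> dm.mtopology closure_of A n" using z aE \<rho> by (auto simp: subset_iff)
      then obtain u where "u \<in> A n" "dst z u < \<delta>"
        using \<open>\<delta> > 0\<close> unfolding dm.metric_closure_of by (auto simp: )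
      then show ?thesis by (auto simp: A_def c_def dm.commute)
    qed
    have "\<exists>u\<in>carrier E. Q u \<le> 2 * e \<and> dst u h < \<delta>"
      if h [simp]: "h \<in> carrier E" and hr: "dst h \<zero>\<^bsub>E\<^esub> < \<rho> / c" and d: "\<delta> > 0" for h \<delta>
    proof -
      \<comment> \<open>Moves \<open>h\<close> into the ball around \<open>a\<close>. Both
        \<open>z\<close> and \<open>a\<close> are limits of elements \<open>u\<close> and
        \<open>v\<close> of \<open>A n\<close>, and \<open>(u - v) / c\<close> approximates
        \<open>(z - a) / c = h\<close> with \<open>Q\<close> at most \<open>2 * e\<close>.\<close>
      define z where "z = a \<oplus>\<^bsub>E\<^esub> sc (\<lambda>_. c) h"
      have zE [simp]: "z \<in> carrier E" using aE by (simp add: z_def)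
      have za: "z \<ominus>\<^bsub>E\<^esub> a = sc (\<lambda>_. c) h"
        unfolding z_def M.minus_eq using aE by (metis M.a_comm M.a_assoc M.r_neg M.r_zero M.a_inv_closed sc_closed borel_measurable_const h)
      have "dst a z = dst (sc (\<lambda>_. c) h) (sc (\<lambda>_. c) \<zero>\<^bsub>E\<^esub>)"
        using dst_minus[OF zE aE] za by (simp add: dm.commute sc_def)
      also have "\<dots> \<le> c * dst h \<zero>\<^bsub>E\<^esub>" using dscale[of h "\<zero>\<^bsub>E\<^esub>" c] c by simp
      also have "\<dots> < \<rho>" using hr c by (simp add: field_simps)
      finally have az: "dst a z < \<rho>" .
      obtain u where u [simp]: "u \<in> carrier E" and u2: "Q (sc (\<lambda>_. 1 / c) u) \<le> e" "dst u z < \<delta> / 2"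
        using apx[OF az zE, of "\<delta> / 2"] d by auto
      obtain v where v [simp]: "v \<in> carrier E" and v2: "Q (sc (\<lambda>_. 1 / c) v) \<le> e" "dst v a < \<delta> / 2"
        using apx[of a "\<delta> / 2"] aE \<rho> d by auto
      define w where "w = sc (\<lambda>_. 1 / c) (u \<ominus>\<^bsub>E\<^esub> v)"
      have "Q w \<le> 2 * e" using sc_scale[of u v "1 / c"] u2 v2 by (simp add: w_def)
      moreover have "dst w h < \<delta>"
      proof -
        have "h = sc (\<lambda>_. 1 / c) (sc (\<lambda>_. c) h)" using c by (simp add: sc_sc)
        then have "dst w h = dst w (sc (\<lambda>_. 1 / c) (z \<ominus>\<^bsub>E\<^esub> a))" using za by simp
        also have "\<dots> \<le> max 1 \<bar>1 / c\<bar> * dst (u \<ominus>\<^bsub>E\<^esub> v) (z \<ominus>\<^bsub>E\<^esub> a)"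
          unfolding w_def using aE by (intro dscale) auto
        also have "\<dots> = dst (u \<ominus>\<^bsub>E\<^esub> v) (z \<ominus>\<^bsub>E\<^esub> a)" using c by (simp add: max_def)
        also have "\<dots> \<le> dst u z + dst v a" using aE by (intro dadd) auto
        finally show ?thesis using u2 v2 by linarith
      qed
      ultimately show ?thesis by (auto simp: w_def)
    qed
    then show ?thesis using \<rho>(1) c by (intro exI[of _ "\<rho> / c"]) auto
  qed
  \<comment> \<open>The increments constructed below satisfy \<open>Q \<le> 2 * ek k\<close>, and
    these bounds sum to \<open>\<epsilon> / 4\<close>.\<close>
  define ek where "ek k = \<epsilon> / 16 * (1/2) ^ k" for k :: nat
  have ek: "ek k > 0" for k using \<open>\<epsilon> > 0\<close> by (simp add: ek_def)
  obtain r' where r': "\<And>k. r' k > 0" "\<And>k h \<delta>. h \<in> carrier E \<Longrightarrow> dst h \<zero>\<^bsub>E\<^esub> < r' k \<Longrightarrow> \<delta> > 0 \<Longrightarrow>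
      \<exists>u\<in>carrier E. Q u \<le> 2 * ek k \<and> dst u h < \<delta>"
    using nbhd[OF ek] by metis
  \<comment> \<open>The bound by \<open>(1/2) ^ k\<close> makes the distances to \<open>x\<close>
    summable, which forces almost everywhere convergence.\<close>
  define r where "r k = min (r' k) ((1/2) ^ k)" for k
  have r: "r k > 0" "r k \<le> (1/2) ^ k" "r k \<le> r' k" for k using r'(1) by (auto simp: r_def)
  have "Q x < \<epsilon>" if x [simp]: "x \<in> carrier E" and xr: "dst x \<zero>\<^bsub>E\<^esub> < r 0" for x
  proof -
    have "\<exists>s. s 0 = \<zero>\<^bsub>E\<^esub> \<and> (\<forall>k. s k \<in> carrier E \<and> dst (s k) x < r k \<and> Q (s (Suc k) \<ominus>\<^bsub>E\<^esub> s k) \<le> 2 * ek k)"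
    proof -
      \<comment> \<open>\<open>s (Suc k)\<close> corrects \<open>s k\<close> by an approximation
        \<open>u\<close> of the remainder \<open>x - s k\<close>. That remainder is smaller than
        \<open>r k\<close>, so \<open>u\<close> can be chosen with
        \<open>Q u \<le> 2 * ek k\<close>. The start at the origin is required by
        \<open>csa\<close>.\<close>
      define P where "P k y \<longleftrightarrow> y \<in> carrier E \<and> dst y x < r k \<and> (k = 0 \<longrightarrow> y = \<zero>\<^bsub>E\<^esub>)" for k y
      define R where "R k y y' \<longleftrightarrow> Q (y' \<ominus>\<^bsub>E\<^esub> y) \<le> 2 * ek k" for k y y'
      have "\<exists>s. \<forall>k. P k (s k) \<and> R k (s k) (s (Suc k))"
      proof (rule dependent_nat_choice)
        show "\<exists>y. P 0 y" using xr by (auto simp: P_def dm.commute)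
        fix y k assume "P k y"
        then have y [simp]: "y \<in> carrier E" and yr: "dst y x < r k" by (auto simp: P_def)
        have "dst (x \<ominus>\<^bsub>E\<^esub> y) \<zero>\<^bsub>E\<^esub> < r' k" using yr r(3)[of k] dst_minus[of x y] by (simp add: dm.commute)
        then obtain u where u [simp]: "u \<in> carrier E" and u2: "Q u \<le> 2 * ek k" "dst u (x \<ominus>\<^bsub>E\<^esub> y) < r (Suc k)"
          using r'(2)[of "x \<ominus>\<^bsub>E\<^esub> y" k "r (Suc k)"] r(1) by auto
        have 1: "(y \<oplus>\<^bsub>E\<^esub> u) \<ominus>\<^bsub>E\<^esub> y = u"
          unfolding M.minus_eq by (metis M.a_comm M.a_assoc M.r_neg M.r_zero M.a_inv_closed y u)
        have 2: "(y \<oplus>\<^bsub>E\<^esub> u) \<ominus>\<^bsub>E\<^esub> x = u \<ominus>\<^bsub>E\<^esub> (x \<ominus>\<^bsub>E\<^esub> y)"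
          by (simp add: M.minus_eq M.minus_add M.a_ac)
        have "dst (y \<oplus>\<^bsub>E\<^esub> u) x = dst u (x \<ominus>\<^bsub>E\<^esub> y)"
          using dst_minus[of "y \<oplus>\<^bsub>E\<^esub> u" x] dst_minus[of u "x \<ominus>\<^bsub>E\<^esub> y"] 2 by simp
        then show "\<exists>y'. P (Suc k) y' \<and> R k y y'"
          using u2 1 by (intro exI[of _ "y \<oplus>\<^bsub>E\<^esub> u"]) (simp add: P_def R_def)
      qed
      then show ?thesis by (auto simp: P_def R_def)
    qed
    then obtain s where s0: "s 0 = \<zero>\<^bsub>E\<^esub>" and s [simp]: "\<And>k. s k \<in> carrier E"
      and sx: "\<And>k. dst (s k) x < r k" and sQ: "\<And>k. Q (s (Suc k) \<ominus>\<^bsub>E\<^esub> s k) \<le> 2 * ek k"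
      by blast
    have geo: "summable (\<lambda>k. (1/2::real) ^ k)" by (rule summable_geometric) simp
    have sx2: "dst (s k) x \<le> (1/2) ^ k" for k using sx[of k] r(2)[of k] by linarith
    have "AE \<omega> in M. summable (\<lambda>k. min 1 (D (s k) x \<omega>))"
    proof (rule AE_summable_of_integral)
      show "integrable M (\<lambda>\<omega>. min 1 (D (s k) x \<omega>))" for k by (intro integrable_min1) auto
      show "summable (\<lambda>k. LINT \<omega>|M. min 1 (D (s k) x \<omega>))"
        using sx2 by (intro summable_comparison_test'[OF geo, of 0]) (auto simp: dst_eq[symmetric])
    qed auto
    then have lim: "AE \<omega> in M. (\<lambda>k. D (s k) x \<omega>) \<longlonglongrightarrow> 0"
    proof eventually_elim
      case (elim \<omega>)
      have "(\<lambda>k. min 1 (D (s k) x \<omega>)) \<longlonglongrightarrow> 0" by (rule summable_LIMSEQ_zero[OF elim])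
      moreover from this have "\<forall>\<^sub>F n in sequentially. min 1 (D (s n) x \<omega>) < 1"
        by (rule order_tendstoD) simp
      then have "\<forall>\<^sub>F n in sequentially. min 1 (D (s n) x \<omega>) = D (s n) x \<omega>"
        by eventually_elim auto
      ultimately show ?case by (rule Lim_transform_eventually)
    qed
    let ?u = "\<lambda>k. s (Suc k) \<ominus>\<^bsub>E\<^esub> s k"
    have sumQ: "summable (\<lambda>k. 2 * ek k)" unfolding ek_def using geo by (intro summable_mult) auto
    have Q0: "0 \<le> Q y" for y unfolding Q_def using q0 by (intro integral_nonneg_AE) auto
    have sumQu: "summable (\<lambda>k. LINT \<omega>|M. min 1 (q (?u k) \<omega>))"
      using sQ Q0 unfolding Q_def[symmetric] by (intro summable_comparison_test'[OF sumQ, of 0]) auto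
    have sumin: "AE \<omega> in M. summable (\<lambda>k. min 1 (q (?u k) \<omega>))"
      using q0 by (intro AE_summable_of_integral sumQu int) auto
    have sumu: "AE \<omega> in M. summable (\<lambda>k. q (?u k) \<omega>)"
      using sumin
    proof eventually_elim
      case (elim \<omega>)
      have "\<forall>\<^sub>F n in sequentially. min 1 (q (?u n) \<omega>) < 1"
        using summable_LIMSEQ_zero[OF elim] by (rule order_tendstoD) simp
      then have "\<forall>\<^sub>F n in sequentially. min 1 (q (?u n) \<omega>) = q (?u n) \<omega>"
        by eventually_elim auto
      then show ?case using elim summable_cong by fastforce
    qed
    have qle: "AE \<omega> in M. q x \<omega> \<le> (\<Sum>k. q (?u k) \<omega>)"
      by (rule csa[OF s x s0 lim sumu])
    have "AE \<omega> in M. min 1 (q x \<omega>) \<le> (\<Sum>k. min 1 (q (?u k) \<omega>))"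
      using qle sumin sumu
    proof eventually_elim
      case (elim \<omega>)
      show ?case
      \<comment> \<open>Truncation passes through the series up to an inequality: either one term
        reaches 1 and so does the right side, or no term is truncated at all.\<close>
      proof (cases "\<exists>k. 1 \<le> q (?u k) \<omega>")
        case True
        then obtain k where "1 \<le> q (?u k) \<omega>" by blast
        then have "1 \<le> (\<Sum>j\<in>{k}. min 1 (q (?u j) \<omega>))" by simp
        also have "\<dots> \<le> (\<Sum>k. min 1 (q (?u k) \<omega>))"
          using elim(2) q0 by (intro sum_le_suminf) auto
        finally show ?thesis by simp
      next
        case False
        then have "min 1 (q (?u k) \<omega>) = q (?u k) \<omega>" for k by (intro min_absorb2) (simp add: not_le less_imp_le)
        then show ?thesis using elim(1) by simp
      qed
    qed
    then have "Q x \<le> (LINT \<omega>|M. (\<Sum>k. min 1 (q (?u k) \<omega>)))"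
      unfolding Q_def using q0 sumin sumQu by (intro integral_mono_AE int integrable_suminf) auto
    also have "\<dots> = (\<Sum>k. Q (?u k))"
      unfolding Q_def using q0 sumin sumQu by (intro integral_suminf int) auto
    also have "\<dots> \<le> (\<Sum>k. 2 * ek k)"
      using sumQu sumQ sQ unfolding Q_def[symmetric] by (intro suminf_le) auto
    also have "\<dots> = \<epsilon> / 4"
      unfolding ek_def using suminf_mult[OF geo, of "\<epsilon> / 8"] suminf_geometric[of "1/2::real"] by simp
    finally show ?thesis using \<open>\<epsilon> > 0\<close> by simp
  qed
  then show ?thesis using r(1) unfolding Q_def by blast
qed

subsection \<open>Gluing elements\<close>

text \<open>With weights of the form \<open>a\<close> and \<open>1 - a\<close>, gluing is itself a
  convex combination, so convexity of a function applies to it directly.\<close>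

definition gl :: "'w set \<Rightarrow> 'e \<Rightarrow> 'e \<Rightarrow> 'e" where
  "gl A x y = lc (indicator A) x (\<lambda>\<omega>. 1 - indicator A \<omega>) y"

lemma gl_closed [simp, intro]: "A \<in> sets M \<Longrightarrow> x \<in> carrier E \<Longrightarrow> y \<in> carrier E \<Longrightarrow> gl A x y \<in> carrier E"
  unfolding gl_def by (intro lc_closed) auto

lemma gl_left:
  assumes A [measurable]: "A \<in> sets M" and [simp]: "x \<in> carrier E" "y \<in> carrier E"
  shows "AE \<omega> in M. \<omega> \<in> A \<longrightarrow> D (gl A x y) x \<omega> = 0"
proof -
  have "AE \<omega> in M. D (gl A x y) (lc (\<lambda>_. 1) x (\<lambda>_. 0) y) \<omega>
    \<le> \<bar>indicator A \<omega> - 1\<bar> * N x \<omega> + \<bar>1 - indicator A \<omega> - 0\<bar> * N y \<omega>"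
    unfolding gl_def by (rule D_lc_same) auto
  then show ?thesis unfolding left_eq_lc[of x y, OF assms(2,3), symmetric]
    by eventually_elim (auto intro: antisym)
qed

lemma gl_right:
  assumes A [measurable]: "A \<in> sets M" and [simp]: "x \<in> carrier E" "y \<in> carrier E"
  shows "AE \<omega> in M. \<omega> \<notin> A \<longrightarrow> D (gl A x y) y \<omega> = 0"
proof -
  have "AE \<omega> in M. D (gl A x y) (lc (\<lambda>_. 0) x (\<lambda>_. 1) y) \<omega>
    \<le> \<bar>indicator A \<omega> - 0\<bar> * N x \<omega> + \<bar>1 - indicator A \<omega> - 1\<bar> * N y \<omega>"
    unfolding gl_def by (rule D_lc_same) auto
  then show ?thesis unfolding right_eq_lc[of x y, OF assms(2,3), symmetric]
    by eventually_elim (auto intro: antisym)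
qed

lemma eq_glI:
  assumes A [measurable]: "A \<in> sets M" and [simp]: "x \<in> carrier E" "y \<in> carrier E" "z \<in> carrier E"
    and "AE \<omega> in M. \<omega> \<in> A \<longrightarrow> D x z \<omega> = 0" "AE \<omega> in M. \<omega> \<notin> A \<longrightarrow> D y z \<omega> = 0"
  shows "gl A x y = z"
proof (rule D_zeroD)
  show "AE \<omega> in M. D (gl A x y) z \<omega> = 0"
    using gl_left[OF assms(1-3)] gl_right[OF assms(1-3)] assms(5,6)
      D_triangle[OF gl_closed[OF assms(1-3)] assms(2,4)] D_triangle[OF gl_closed[OF assms(1-3)] assms(3,4)]
  proof eventually_elim
    case (elim \<omega>)
    then show ?case using D_nonneg[of "gl A x y" z \<omega>] by (cases "\<omega> \<in> A") auto
  qed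
qed auto

text \<open>The value at \<open>\<omega>\<close> may depend only on the argument at
  \<open>\<omega>\<close>. This is what makes a pointwise formula compatible with gluing of
  arguments (\<open>local_fun_gl\<close>).\<close>

definition local_fun :: "('e \<Rightarrow> 'w \<Rightarrow> 'b) \<Rightarrow> bool" where
  "local_fun G \<longleftrightarrow> (\<forall>x\<in>carrier E. \<forall>y\<in>carrier E. AE \<omega> in M. D x y \<omega> = 0 \<longrightarrow> G x \<omega> = G y \<omega>)"

lemma local_funD:
  "local_fun G \<Longrightarrow> x \<in> carrier E \<Longrightarrow> y \<in> carrier E \<Longrightarrow> AE \<omega> in M. D x y \<omega> = 0 \<longrightarrow> G x \<omega> = G y \<omega>"
  by (simp add: local_fun_def)

lemma local_fun_gl:
  assumes G: "local_fun G" and A: "A \<in> sets M" and xy: "x \<in> carrier E" "y \<in> carrier E"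
  shows "AE \<omega> in M. G (gl A x y) \<omega> = (if \<omega> \<in> A then G x \<omega> else G y \<omega>)"
  using gl_left[OF A xy] gl_right[OF A xy] local_funD[OF G gl_closed[OF A xy] xy(1)]
    local_funD[OF G gl_closed[OF A xy] xy(2)]
  by eventually_elim auto

subsection \<open>Proper lower semicontinuous convex functions\<close>

lemma convex_funs_closed [simp, intro]:
  "f \<in> convex_funs M E \<Longrightarrow> x \<in> carrier E \<Longrightarrow> f x \<in> ae_classes M"
  by (auto simp: convex_funs_def)

lemma convex_funs_measurable [measurable]:
  "f \<in> convex_funs M E \<Longrightarrow> x \<in> carrier E \<Longrightarrow> rep (f x) \<in> borel_measurable M"
  by simp

lemma convex_funs_proper:
  assumes "f \<in> convex_funs M E" "x \<in> carrier E"
  shows "AE \<omega> in M. - \<infinity> < rep (f x) \<omega>"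
proof -
  have "cls_less M (ae_class M (\<lambda>_. - \<infinity>)) (ae_class M (rep (f x)))"
    using assms by (auto simp: convex_funs_def)
  then show ?thesis using assms by (subst (asm) cls_less_ae_class) auto
qed

lemma effective_dom_iff:
  assumes "f \<in> carrier E \<rightarrow> ae_classes M"
  shows "x \<in> effective_dom M E f \<longleftrightarrow> x \<in> carrier E \<and> (AE \<omega> in M. rep (f x) \<omega> < \<infinity>)"
proof (cases "x \<in> carrier E")
  case True
  then have f: "f x \<in> ae_classes M" using assms by auto
  have "cls_less M (ae_class M (rep (f x))) (ae_class M (\<lambda>_. \<infinity>)) \<longleftrightarrow> (AE \<omega> in M. rep (f x) \<omega> < \<infinity>)"
    using f by (subst cls_less_ae_class) auto
  then show ?thesis using True f by (simp add: effective_dom_def)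
qed (simp add: effective_dom_def)

lemma convex_funs_dom:
  assumes "f \<in> convex_funs M E"
  obtains d where "d \<in> carrier E" "AE \<omega> in M. rep (f d) \<omega> < \<infinity>"
proof -
  have "effective_dom M E f \<noteq> {}" "f \<in> carrier E \<rightarrow> ae_classes M" using assms by (auto simp: convex_funs_def)
  then show ?thesis using effective_dom_iff[of f] that by blast
qed

section \<open>Convexity and closedness in terms of representatives\<close>

lemma L0_plus_iff: "a \<in> borel_measurable M \<Longrightarrow> ae_class M a \<in> L0_plus M \<longleftrightarrow> (AE \<omega> in M. 0 \<le> a \<omega>)"
  by (simp add: L0_plus_def cls_le_ae_class)

lemma scale_ext_eq:
  assumes "a \<in> borel_measurable M" "X \<in> ae_classes M"
  shows "scale_ext M (ae_class M a) X = ae_class M (\<lambda>\<omega>. ereal (a \<omega>) * rep X \<omega>)"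
proof -
  have "scale_ext M (ae_class M a) (ae_class M (rep X)) = ae_class M (\<lambda>\<omega>. ereal (a \<omega>) * rep X \<omega>)"
    using assms by (simp del: ae_class_rep)
  then show ?thesis using assms by simp
qed

lemma convex_ineq_iff:
  assumes f: "f \<in> carrier E \<rightarrow> ae_classes M" and xy: "x \<in> carrier E" "y \<in> carrier E"
    and a [measurable]: "a \<in> borel_measurable M"
  shows "cls_le M (f (ae_class M a \<odot>\<^bsub>E\<^esub> x \<oplus>\<^bsub>E\<^esub> (\<one>\<^bsub>L0 M\<^esub> \<ominus>\<^bsub>L0 M\<^esub> ae_class M a) \<odot>\<^bsub>E\<^esub> y))
      (cls_add M (scale_ext M (ae_class M a) (f x))
        (scale_ext M (\<one>\<^bsub>L0 M\<^esub> \<ominus>\<^bsub>L0 M\<^esub> ae_class M a) (f y)))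
    \<longleftrightarrow> (AE \<omega> in M. rep (f (lc a x (\<lambda>\<omega>. 1 - a \<omega>) y)) \<omega>
          \<le> ereal (a \<omega>) * rep (f x) \<omega> + ereal (1 - a \<omega>) * rep (f y) \<omega>)"
proof -
  have fx [simp]: "f z \<in> ae_classes M" if "z \<in> carrier E" for z using f that by auto
  have one: "\<one>\<^bsub>L0 M\<^esub> \<ominus>\<^bsub>L0 M\<^esub> ae_class M a = ae_class M (\<lambda>\<omega>. 1 - a \<omega>)"
    using L0_minus[OF R.cring_axioms, of "\<lambda>_. 1" a] by simp
  have z: "ae_class M a \<odot>\<^bsub>E\<^esub> x \<oplus>\<^bsub>E\<^esub> ae_class M (\<lambda>\<omega>. 1 - a \<omega>) \<odot>\<^bsub>E\<^esub> y = lc a x (\<lambda>\<omega>. 1 - a \<omega>) y"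
    by (simp add: lc_def sc_def)
  have "cls_le M (ae_class M (rep (f (lc a x (\<lambda>\<omega>. 1 - a \<omega>) y))))
     (ae_class M (\<lambda>\<omega>. ereal (a \<omega>) * rep (f x) \<omega> + ereal (1 - a \<omega>) * rep (f y) \<omega>))
    \<longleftrightarrow> (AE \<omega> in M. rep (f (lc a x (\<lambda>\<omega>. 1 - a \<omega>) y)) \<omega>
          \<le> ereal (a \<omega>) * rep (f x) \<omega> + ereal (1 - a \<omega>) * rep (f y) \<omega>)"
    using xy by (subst cls_le_ae_class) auto
  then show ?thesis unfolding one z using xy by (simp add: scale_ext_eq del: to_ext_ae_class)
qed

lemma epi_iff:
  assumes "f \<in> carrier E \<rightarrow> ae_classes M" "x \<in> carrier E" "r \<in> borel_measurable M"
  shows "(x, ae_class M r) \<in> epi M E f \<longleftrightarrow> (AE \<omega> in M. rep (f x) \<omega> \<le> ereal (r \<omega>))"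
proof -
  have f: "f x \<in> ae_classes M" using assms by auto
  have "cls_le M (ae_class M (rep (f x))) (ae_class M (\<lambda>\<omega>. ereal (r \<omega>)))
    \<longleftrightarrow> (AE \<omega> in M. rep (f x) \<omega> \<le> ereal (r \<omega>))"
    using f assms(3) by (subst cls_le_ae_class) auto
  then show ?thesis using assms f by (simp add: epi_def)
qed

text \<open>The distance in the product module is \<open>D\<close> plus the difference of the
  heights, so points and heights may be required to converge separately.\<close>

lemma epi_closed_iff:
  assumes f: "f \<in> carrier E \<rightarrow> ae_classes M"
  shows "closedin (el_topology M (times_L0 M E)) (epi M E f) \<longleftrightarrow>
    (\<forall>xs rs x r. (\<forall>n. xs n \<in> carrier E) \<and> (\<forall>n. rs n \<in> borel_measurable M) \<and> x \<in> carrier E \<and>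
      r \<in> borel_measurable M \<and> (\<forall>n. AE \<omega> in M. rep (f (xs n)) \<omega> \<le> ereal (rs n \<omega>)) \<and>
      (AE \<omega> in M. (\<lambda>n. D (xs n) x \<omega>) \<longlonglongrightarrow> 0) \<and> (AE \<omega> in M. (\<lambda>n. rs n \<omega>) \<longlonglongrightarrow> r \<omega>) \<longrightarrow>
      (AE \<omega> in M. rep (f x) \<omega> \<le> ereal (r \<omega>)))" (is "?L \<longleftrightarrow> ?R")
proof
  interpret P: rn_module M "times_L0 M E" by (rule times_rn_module)
  {
    assume L: ?L
    show ?R
    proof (intro allI impI, elim conjE)
      fix xs rs x r
      assume *: "\<forall>n. xs n \<in> carrier E" "\<forall>n. rs n \<in> borel_measurable M" "x \<in> carrier E"
        "r \<in> borel_measurable M" "\<forall>n. AE \<omega> in M. rep (f (xs n)) \<omega> \<le> ereal (rs n \<omega>)"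
        "AE \<omega> in M. (\<lambda>n. D (xs n) x \<omega>) \<longlonglongrightarrow> 0" "AE \<omega> in M. (\<lambda>n. rs n \<omega>) \<longlonglongrightarrow> r \<omega>"
      have "AE \<omega> in M. \<forall>n. P.D (xs n, ae_class M (rs n)) (x, ae_class M r) \<omega> = D (xs n) x \<omega> + \<bar>rs n \<omega> - r \<omega>\<bar>"
        unfolding AE_all_countable using * by (intro allI D_times) auto
      then have "AE \<omega> in M. (\<lambda>n. P.D (xs n, ae_class M (rs n)) (x, ae_class M r) \<omega>) \<longlonglongrightarrow> 0"
        using *(6,7)
      proof eventually_elim
        case (elim \<omega>)
        have "(\<lambda>n. \<bar>rs n \<omega> - r \<omega>\<bar>) \<longlonglongrightarrow> 0"
          using elim(3) by (simp add: LIM_zero tendsto_rabs_zero)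
        from tendsto_add[OF elim(2) this] show ?case using elim(1) by simp
      qed
      moreover have "(xs n, ae_class M (rs n)) \<in> epi M E f" for n using epi_iff[OF f] * by simp
      ultimately have "(x, ae_class M r) \<in> epi M E f"
        using L[unfolded P.closedin_AE_iff, THEN conjunct2, rule_format,
            of "\<lambda>n. (xs n, ae_class M (rs n))" "(x, ae_class M r)"] * by simp
      then show "AE \<omega> in M. rep (f x) \<omega> \<le> ereal (r \<omega>)" using epi_iff[OF f] * by simp
    qed
  next
    assume R: ?R
    show ?L unfolding P.closedin_AE_iff
    proof (intro conjI allI impI, goal_cases)
      case 1 show ?case by (auto simp: epi_def)
    next
      case (2 s l)
      define xs where "xs n = fst (s n)" for n
      define rs where "rs n = rep (snd (s n))" for n
      define x where "x = fst l"
      define r where "r = rep (snd l)"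
      have sn: "xs n \<in> carrier E" "snd (s n) \<in> ae_classes M" for n
      proof -
        have "s n \<in> epi M E f" using 2 by blast
        then show "xs n \<in> carrier E" "snd (s n) \<in> ae_classes M" by (auto simp: epi_def xs_def)
      qed
      then have [measurable]: "rs n \<in> borel_measurable M" and s_eq: "s n = (xs n, ae_class M (rs n))" for n
        by (auto simp: rs_def xs_def)
      have lx: "x \<in> carrier E" "snd l \<in> ae_classes M" using 2 by (auto simp: x_def)
      then have [measurable]: "r \<in> borel_measurable M" and l_eq: "l = (x, ae_class M r)"
        by (auto simp: r_def x_def)
      have "AE \<omega> in M. \<forall>n. P.D (s n) l \<omega> = D (xs n) x \<omega> + \<bar>rs n \<omega> - r \<omega>\<bar>"
        unfolding AE_all_countable s_eq l_eq using sn lx by (intro allI D_times) auto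
      then have lim: "AE \<omega> in M. (\<lambda>n. D (xs n) x \<omega>) \<longlonglongrightarrow> 0 \<and> (\<lambda>n. rs n \<omega>) \<longlonglongrightarrow> r \<omega>"
        using 2[THEN conjunct2, THEN conjunct2]
      proof eventually_elim
        case (elim \<omega>)
        then have t: "(\<lambda>n. D (xs n) x \<omega> + \<bar>rs n \<omega> - r \<omega>\<bar>) \<longlonglongrightarrow> 0" by simp
        have "(\<lambda>n. D (xs n) x \<omega>) \<longlonglongrightarrow> 0" by (rule tendsto_sandwich[OF _ _ tendsto_const t]) auto
        moreover have "(\<lambda>n. \<bar>rs n \<omega> - r \<omega>\<bar>) \<longlonglongrightarrow> 0"
          by (rule tendsto_sandwich[OF _ _ tendsto_const t]) auto
        then have "(\<lambda>n. rs n \<omega>) \<longlonglongrightarrow> r \<omega>" by (rule LIM_zero_cancel[OF tendsto_rabs_zero_cancel])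
        ultimately show ?case by blast
      qed
      have "\<forall>n. AE \<omega> in M. rep (f (xs n)) \<omega> \<le> ereal (rs n \<omega>)"
      proof
        fix n
        have "(xs n, ae_class M (rs n)) \<in> epi M E f" using 2 s_eq[of n] by metis
        then show "AE \<omega> in M. rep (f (xs n)) \<omega> \<le> ereal (rs n \<omega>)"
          using epi_iff[OF f] sn by simp
      qed
      then have "AE \<omega> in M. rep (f x) \<omega> \<le> ereal (r \<omega>)"
        using R[rule_format, of xs rs x r] sn lx lim by auto
      then show ?case using epi_iff[OF f] lx unfolding l_eq by simp
    qed
  }
qed

lemma convex_funs_convex:
  assumes f: "f \<in> convex_funs M E" and xy: "x \<in> carrier E" "y \<in> carrier E"
    and a: "a \<in> borel_measurable M" "AE \<omega> in M. 0 \<le> a \<omega>" "AE \<omega> in M. a \<omega> \<le> 1"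
  shows "AE \<omega> in M. rep (f (lc a x (\<lambda>\<omega>. 1 - a \<omega>) y)) \<omega>
    \<le> ereal (a \<omega>) * rep (f x) \<omega> + ereal (1 - a \<omega>) * rep (f y) \<omega>"
proof -
  have fc: "f \<in> carrier E \<rightarrow> ae_classes M" using f by auto
  have "ae_class M a \<in> L0_plus M" using a by (simp add: L0_plus_iff)
  moreover have "cls_le M (ae_class M a) \<one>\<^bsub>L0 M\<^esub>" using a by (simp add: cls_le_ae_class)
  ultimately show ?thesis
    using f xy unfolding convex_ineq_iff[OF fc xy a(1), symmetric] by (auto simp: convex_funs_def)
qed

lemma convex_funs_lsc:
  assumes f: "f \<in> convex_funs M E" and "\<And>n. xs n \<in> carrier E" "\<And>n. rs n \<in> borel_measurable M"
    "x \<in> carrier E" "r \<in> borel_measurable M" "\<And>n. AE \<omega> in M. rep (f (xs n)) \<omega> \<le> ereal (rs n \<omega>)"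
    "AE \<omega> in M. (\<lambda>n. D (xs n) x \<omega>) \<longlonglongrightarrow> 0" "AE \<omega> in M. (\<lambda>n. rs n \<omega>) \<longlonglongrightarrow> r \<omega>"
  shows "AE \<omega> in M. rep (f x) \<omega> \<le> ereal (r \<omega>)"
proof -
  have fc: "f \<in> carrier E \<rightarrow> ae_classes M" using f by auto
  have "closedin (el_topology M (times_L0 M E)) (epi M E f)" using f by (auto simp: convex_funs_def)
  then show ?thesis using assms unfolding epi_closed_iff[OF fc] by blast
qed

text \<open>Random weights force locality: with \<open>A\<close> the set where \<open>x\<close> and
  \<open>y\<close> agree, the combination with weight \<open>indicator A\<close> is
  \<open>y\<close>, and convexity gives \<open>f y \<le> f x\<close> on \<open>A\<close>.\<close>

lemma convex_funs_local:
  assumes f: "f \<in> convex_funs M E"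
  shows "local_fun (\<lambda>x. rep (f x))"
  unfolding local_fun_def
proof (intro ballI)
  have le: "AE \<omega> in M. D x y \<omega> = 0 \<longrightarrow> rep (f y) \<omega> \<le> rep (f x) \<omega>"
    if [simp]: "x \<in> carrier E" "y \<in> carrier E" for x y
  proof -
    define A where "A = {\<omega> \<in> space M. D x y \<omega> = 0}"
    have A [measurable]: "A \<in> sets M" unfolding A_def by measurable
    have "gl A x y = y" by (rule eq_glI) (use D_self[of y] in \<open>auto simp: A_def\<close>)
    then have "AE \<omega> in M. rep (f y) \<omega>
      \<le> ereal (indicator A \<omega>) * rep (f x) \<omega> + ereal (1 - indicator A \<omega>) * rep (f y) \<omega>"
      using convex_funs_convex[OF f that, of "indicator A"] by (simp add: gl_def)
    moreover have "AE \<omega> in M. \<omega> \<in> space M" by (rule AE_space)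
    ultimately show ?thesis by eventually_elim (auto simp: A_def zero_ereal_def[symmetric] one_ereal_def[symmetric])
  qed
  fix x y assume xy: "x \<in> carrier E" "y \<in> carrier E"
  show "AE \<omega> in M. D x y \<omega> = 0 \<longrightarrow> rep (f x) \<omega> = rep (f y) \<omega>"
    using le[OF xy] le[OF xy(2,1)] D_commute[OF xy] by eventually_elim (auto intro: antisym)
qed

definition mkf :: "('e \<Rightarrow> 'w \<Rightarrow> ereal) \<Rightarrow> 'e \<Rightarrow> ('w \<Rightarrow> ereal) set" where
  "mkf G = (\<lambda>x\<in>carrier E. ae_class M (G x))"

lemma rep_mkf:
  assumes "x \<in> carrier E" "G x \<in> borel_measurable M"
  shows "AE \<omega> in M. rep (mkf G x) \<omega> = G x \<omega>"
  using rep_ae_class[OF assms(2)] assms(1) by (simp add: mkf_def)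

text \<open>By locality it suffices to check convexity on the effective domain.\<close>

lemma mkf_convex_funs:
  assumes meas [measurable]: "\<And>x. x \<in> carrier E \<Longrightarrow> G x \<in> borel_measurable M"
    and proper: "\<And>x. x \<in> carrier E \<Longrightarrow> AE \<omega> in M. - \<infinity> < G x \<omega>"
    and loc: "local_fun G"
    and d: "d \<in> carrier E" "AE \<omega> in M. G d \<omega> < \<infinity>"
    and conv: "\<And>x y a. \<lbrakk>x \<in> carrier E; y \<in> carrier E; a \<in> borel_measurable M;
      AE \<omega> in M. 0 \<le> a \<omega>; AE \<omega> in M. a \<omega> \<le> 1; AE \<omega> in M. G x \<omega> < \<infinity>; AE \<omega> in M. G y \<omega> < \<infinity>\<rbrakk> \<Longrightarrow>
      AE \<omega> in M. G (lc a x (\<lambda>\<omega>. 1 - a \<omega>) y) \<omega> \<le> ereal (a \<omega>) * G x \<omega> + ereal (1 - a \<omega>) * G y \<omega>"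
    and lsc: "\<And>xs rs x r. \<lbrakk>\<And>n. xs n \<in> carrier E; \<And>n. rs n \<in> borel_measurable M; x \<in> carrier E;
      r \<in> borel_measurable M; \<And>n. AE \<omega> in M. G (xs n) \<omega> \<le> ereal (rs n \<omega>);
      AE \<omega> in M. (\<lambda>n. D (xs n) x \<omega>) \<longlonglongrightarrow> 0; AE \<omega> in M. (\<lambda>n. rs n \<omega>) \<longlonglongrightarrow> r \<omega>\<rbrakk> \<Longrightarrow>
      AE \<omega> in M. G x \<omega> \<le> ereal (r \<omega>)"
  shows "mkf G \<in> convex_funs M E"
proof -
  have fc: "mkf G \<in> carrier E \<rightarrow> ae_classes M" by (auto simp: mkf_def)
  have rep: "AE \<omega> in M. rep (mkf G x) \<omega> = G x \<omega>" if "x \<in> carrier E" for x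
    using that by (intro rep_mkf) auto
  have conv': "AE \<omega> in M. G (lc a x (\<lambda>\<omega>. 1 - a \<omega>) y) \<omega> \<le> ereal (a \<omega>) * G x \<omega> + ereal (1 - a \<omega>) * G y \<omega>"
    if xy [simp]: "x \<in> carrier E" "y \<in> carrier E" and a [measurable]: "a \<in> borel_measurable M"
      and a01: "AE \<omega> in M. 0 \<le> a \<omega>" "AE \<omega> in M. a \<omega> \<le> 1" for x y a
  proof -
    define A where "A = {\<omega> \<in> space M. G x \<omega> < \<infinity>}"
    define B where "B = {\<omega> \<in> space M. G y \<omega> < \<infinity>}"
    have A [measurable]: "A \<in> sets M" and B [measurable]: "B \<in> sets M"
      unfolding A_def B_def using xy by measurable
    note [simp] = d(1)
    \<comment> \<open>Where \<open>G x\<close> or \<open>G y\<close> is infinite, the point is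
      replaced by \<open>d\<close>; this puts both arguments into the effective domain.\<close>
    let ?x = "gl A x d" and ?y = "gl B y d"
    let ?z = "lc a x (\<lambda>\<omega>. 1 - a \<omega>) y" and ?z' = "lc a ?x (\<lambda>\<omega>. 1 - a \<omega>) ?y"
    have gx: "AE \<omega> in M. G ?x \<omega> = (if \<omega> \<in> A then G x \<omega> else G d \<omega>)"
      and gy: "AE \<omega> in M. G ?y \<omega> = (if \<omega> \<in> B then G y \<omega> else G d \<omega>)"
      by (rule local_fun_gl[OF loc]; simp)+
    have "AE \<omega> in M. G ?x \<omega> < \<infinity>" using gx d(2) by eventually_elim (auto simp: A_def)
    moreover have "AE \<omega> in M. G ?y \<omega> < \<infinity>" using gy d(2) by eventually_elim (auto simp: B_def)
    ultimately have c: "AE \<omega> in M. G ?z' \<omega> \<le> ereal (a \<omega>) * G ?x \<omega> + ereal (1 - a \<omega>) * G ?y \<omega>"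
      using a01 by (intro conv) auto
    have zz: "AE \<omega> in M. D ?z' ?z \<omega> = 0 \<longrightarrow> G ?z' \<omega> = G ?z \<omega>"
      by (intro local_funD[OF loc]) auto
    have dz: "AE \<omega> in M. D ?z' ?z \<omega> \<le> \<bar>a \<omega>\<bar> * D ?x x \<omega> + \<bar>1 - a \<omega>\<bar> * D ?y y \<omega>"
      by (intro D_lc) auto
    show ?thesis
      using gx gy c zz dz a01 gl_left[OF A xy(1) d(1)] gl_left[OF B xy(2) d(1)]
        proper[OF xy(1)] proper[OF xy(2)] AE_space
    proof eventually_elim
      case (elim \<omega>)
      show ?case
      \<comment> \<open>A point of weight 0 may leave the domain, since
        \<open>0 * \<infinity> = 0\<close>. In the remaining case a positive weight meets an
        infinite value while the other summand is not \<open>- \<infinity>\<close>, so the right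
        side is \<open>\<infinity>\<close>.\<close>
      proof (cases "(a \<omega> = 0 \<or> \<omega> \<in> A) \<and> (1 - a \<omega> = 0 \<or> \<omega> \<in> B)")
        case True
        then have "\<bar>a \<omega>\<bar> * D ?x x \<omega> + \<bar>1 - a \<omega>\<bar> * D ?y y \<omega> = 0" using elim by auto
        then have "D ?z' ?z \<omega> = 0" using elim(5) D_nonneg[of ?z' ?z \<omega>] by linarith
        then have "G ?z \<omega> \<le> ereal (a \<omega>) * G ?x \<omega> + ereal (1 - a \<omega>) * G ?y \<omega>" using elim by auto
        moreover have "ereal (a \<omega>) * G ?x \<omega> = ereal (a \<omega>) * G x \<omega>"
          using True elim(1) by (auto simp: zero_ereal_def[symmetric])
        moreover have "ereal (1 - a \<omega>) * G ?y \<omega> = ereal (1 - a \<omega>) * G y \<omega>"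
          using True elim(2) by (auto simp: zero_ereal_def[symmetric])
        ultimately show ?thesis by simp
      next
        case False
        have ne: "ereal t * g \<noteq> - \<infinity>" if "0 \<le> t" "- \<infinity> < g" for t g
          using that by (cases g; cases "t = 0") (auto simp: zero_ereal_def[symmetric])
        have "ereal (a \<omega>) * G x \<omega> + ereal (1 - a \<omega>) * G y \<omega> = \<infinity>"
        proof (cases "a \<omega> = 0 \<or> \<omega> \<in> A")
          case True
          then have "1 - a \<omega> > 0" "G y \<omega> = \<infinity>" using False elim by (auto simp: B_def)
          then show ?thesis using ne[of "a \<omega>" "G x \<omega>"] elim by (simp add: less_top)
        next
          case False
          then have "a \<omega> > 0" "G x \<omega> = \<infinity>" using elim by (auto simp: A_def)
          then show ?thesis using ne[of "1 - a \<omega>" "G y \<omega>"] elim by (simp add: less_top)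
        qed
        then show ?thesis by (metis ereal_less_eq(1))
      qed
    qed
  qed
  show ?thesis
    unfolding convex_funs_def
  proof (intro CollectI conjI ballI impI)
    show "mkf G \<in> carrier E \<rightarrow>\<^sub>E carrier (L0_bar M)" by (auto simp: mkf_def)
    show "cls_less M (ae_class M (\<lambda>_. - \<infinity>)) (mkf G x)" if "x \<in> carrier E" for x
      using that proper[OF that] by (simp add: mkf_def cls_less_ae_class)
    have "d \<in> effective_dom M E (mkf G)" using d by (simp add: effective_dom_def mkf_def cls_less_ae_class)
    then show "effective_dom M E (mkf G) \<noteq> {}" by blast
    show "closedin (el_topology M (times_L0 M E)) (epi M E (mkf G))"
      unfolding epi_closed_iff[OF fc]
    proof (intro allI impI, elim conjE)
      fix xs rs x r
      assume *: "\<forall>n. xs n \<in> carrier E" "\<forall>n. rs n \<in> borel_measurable M" "x \<in> carrier E"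
        "r \<in> borel_measurable M" "\<forall>n. AE \<omega> in M. rep (mkf G (xs n)) \<omega> \<le> ereal (rs n \<omega>)"
        "AE \<omega> in M. (\<lambda>n. D (xs n) x \<omega>) \<longlonglongrightarrow> 0" "AE \<omega> in M. (\<lambda>n. rs n \<omega>) \<longlonglongrightarrow> r \<omega>"
      have "AE \<omega> in M. G (xs n) \<omega> \<le> ereal (rs n \<omega>)" for n
        using rep[of "xs n"] * by (auto dest!: spec[of _ n] elim: eventually_elim2)
      then have "AE \<omega> in M. G x \<omega> \<le> ereal (r \<omega>)" using * by (intro lsc[of xs rs x r]) auto
      then show "AE \<omega> in M. rep (mkf G x) \<omega> \<le> ereal (r \<omega>)"
        using rep[OF *(3)] by eventually_elim simp
    qed
    fix x y \<xi> assume xy: "x \<in> carrier E" "y \<in> carrier E" and xi: "\<xi> \<in> L0_plus M" "cls_le M \<xi> \<one>\<^bsub>L0 M\<^esub>"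
    obtain a where a [measurable]: "a \<in> borel_measurable M" and xi_eq: "\<xi> = ae_class M a"
      using xi by (auto simp: L0_plus_def elim!: ae_classesE)
    have a01: "AE \<omega> in M. 0 \<le> a \<omega>" "AE \<omega> in M. a \<omega> \<le> 1"
      using xi by (simp_all add: xi_eq L0_plus_iff cls_le_ae_class)
    have "AE \<omega> in M. rep (mkf G (lc a x (\<lambda>\<omega>. 1 - a \<omega>) y)) \<omega>
        \<le> ereal (a \<omega>) * rep (mkf G x) \<omega> + ereal (1 - a \<omega>) * rep (mkf G y) \<omega>"
      using conv'[OF xy a a01] rep[OF xy(1)] rep[OF xy(2)] 
        rep[OF lc_closed[OF a xy(1) borel_measurable_diff[OF borel_measurable_const a] xy(2)], of 1]
      by eventually_elim simp
    then show "cls_le M (mkf G (\<xi> \<odot>\<^bsub>E\<^esub> x \<oplus>\<^bsub>E\<^esub> (\<one>\<^bsub>L0 M\<^esub> \<ominus>\<^bsub>L0 M\<^esub> \<xi>) \<odot>\<^bsub>E\<^esub> y))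
      (cls_add M (scale_ext M \<xi> (mkf G x)) (scale_ext M (\<one>\<^bsub>L0 M\<^esub> \<ominus>\<^bsub>L0 M\<^esub> \<xi>) (mkf G y)))"
      unfolding xi_eq convex_ineq_iff[OF fc xy a] .
  qed
qed

section \<open>Order and equality of convex functions\<close>

lemma convex_funs_eqI:
  assumes f: "f \<in> convex_funs M E" "g \<in> convex_funs M E"
    and "\<And>x. x \<in> carrier E \<Longrightarrow> AE \<omega> in M. rep (f x) \<omega> = rep (g x) \<omega>"
  shows "f = g"
proof (rule extensionalityI)
  show "f x = g x" if "x \<in> carrier E" for x
    using ae_classes_eqI[OF _ _ assms(3)[OF that]] that f by auto
  show "f \<in> extensional (carrier E)" "g \<in> extensional (carrier E)"
    using f unfolding convex_funs_def PiE_def by blast+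
qed

lemma fun_le_iff: "fun_le M E f g \<longleftrightarrow> (\<forall>x\<in>carrier E. AE \<omega> in M. rep (f x) \<omega> \<le> rep (g x) \<omega>)"
  by (simp add: fun_le_def cls_le_def)

lemma fun_le_antisym:
  assumes "f \<in> convex_funs M E" "g \<in> convex_funs M E" "fun_le M E f g" "fun_le M E g f"
  shows "f = g"
proof (rule convex_funs_eqI[OF assms(1,2)])
  show "AE \<omega> in M. rep (f x) \<omega> = rep (g x) \<omega>" if "x \<in> carrier E" for x
  proof -
    have "AE \<omega> in M. rep (f x) \<omega> \<le> rep (g x) \<omega>" "AE \<omega> in M. rep (g x) \<omega> \<le> rep (f x) \<omega>"
      using assms(3,4) that by (auto simp: fun_le_iff)
    then show ?thesis by eventually_elim auto
  qed
qed

text \<open>Real heights only see points of the effective domain. Gluing \<open>x\<close> with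
  \<open>d\<close> where \<open>G2 x\<close> is infinite reduces to such a point, and locality
  brings the inequality back.\<close>

lemma le_of_epi:
  assumes G1: "local_fun G1" and G2: "local_fun G2"
    and meas [measurable]: "\<And>x. x \<in> carrier E \<Longrightarrow> G2 x \<in> borel_measurable M"
    and proper: "\<And>x. x \<in> carrier E \<Longrightarrow> AE \<omega> in M. - \<infinity> < G2 x \<omega>"
    and d: "d \<in> carrier E" "AE \<omega> in M. G2 d \<omega> < \<infinity>"
    and sub: "\<And>x r. x \<in> carrier E \<Longrightarrow> r \<in> borel_measurable M \<Longrightarrow> AE \<omega> in M. G2 x \<omega> \<le> ereal (r \<omega>) \<Longrightarrow>
      AE \<omega> in M. G1 x \<omega> \<le> ereal (r \<omega>)"
    and x [simp]: "x \<in> carrier E"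
  shows "AE \<omega> in M. G1 x \<omega> \<le> G2 x \<omega>"
proof -
  define A where "A = {\<omega> \<in> space M. G2 x \<omega> < \<infinity>}"
  have A [measurable]: "A \<in> sets M" unfolding A_def by measurable
  note [simp] = d(1)
  let ?x = "gl A x d"
  have g2: "AE \<omega> in M. G2 ?x \<omega> = (if \<omega> \<in> A then G2 x \<omega> else G2 d \<omega>)"
    and g1: "AE \<omega> in M. G1 ?x \<omega> = (if \<omega> \<in> A then G1 x \<omega> else G1 d \<omega>)"
    by (rule local_fun_gl[OF G2] local_fun_gl[OF G1]; simp)+
  have fin: "AE \<omega> in M. ereal (real_of_ereal (G2 ?x \<omega>)) = G2 ?x \<omega>"
    using g2 d(2) proper[OF gl_closed[OF A x d(1)]]
    by eventually_elim (auto simp: A_def ereal_real)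
  then have "AE \<omega> in M. G1 ?x \<omega> \<le> ereal (real_of_ereal (G2 ?x \<omega>))"
    by (intro sub) (auto elim: eventually_mono)
  with fin g1 g2 AE_space show ?thesis
    by eventually_elim (auto simp: A_def split: if_splits)
qed

subsection \<open>Gluing functions\<close>

lemma glue_eq_mkf:
  assumes f: "f \<in> convex_funs M E" and g: "g \<in> convex_funs M E" and A [measurable]: "A \<in> sets M"
  shows "glue M E A f g = mkf (\<lambda>x \<omega>. if \<omega> \<in> A then rep (f x) \<omega> else rep (g x) \<omega>)"
proof (rule extensionalityI[of _ "carrier E"])
  fix x assume x: "x \<in> carrier E"
  note [measurable] = convex_funs_measurable[OF f x] convex_funs_measurable[OF g x]
  have "glue M E A f g x = ae_class M (\<lambda>\<omega>. ereal (indicator A \<omega>) * rep (f x) \<omega>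
      + ereal (indicator (space M - A) \<omega>) * rep (g x) \<omega>)"
    using x f g by (simp add: glue_def cls_indicator_def scale_ext_eq del: to_ext_ae_class)
  also have "\<dots> = ae_class M (\<lambda>\<omega>. if \<omega> \<in> A then rep (f x) \<omega> else rep (g x) \<omega>)"
    by (rule ae_class_cong, use AE_space in eventually_elim)
      (auto simp: indicator_def zero_ereal_def[symmetric] one_ereal_def[symmetric])
  finally show "glue M E A f g x = mkf (\<lambda>x \<omega>. if \<omega> \<in> A then rep (f x) \<omega> else rep (g x) \<omega>) x"
    using x by (simp add: mkf_def)
qed (simp_all add: glue_def mkf_def)

lemma rep_glue:
  assumes f: "f \<in> convex_funs M E" and g: "g \<in> convex_funs M E" and A [measurable]: "A \<in> sets M"
    and x: "x \<in> carrier E"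
  shows "AE \<omega> in M. rep (glue M E A f g x) \<omega> = (if \<omega> \<in> A then rep (f x) \<omega> else rep (g x) \<omega>)"
proof -
  note [measurable] = convex_funs_measurable[OF f x] convex_funs_measurable[OF g x]
  show ?thesis unfolding glue_eq_mkf[OF f g A] by (rule rep_mkf[OF x]) measurable
qed

lemma glue_convex_funs:
  assumes f: "f \<in> convex_funs M E" and g: "g \<in> convex_funs M E" and A [measurable]: "A \<in> sets M"
  shows "glue M E A f g \<in> convex_funs M E"
proof -
  let ?G = "\<lambda>x \<omega>. if \<omega> \<in> A then rep (f x) \<omega> else rep (g x) \<omega>"
  note [measurable] = convex_funs_measurable[OF f] convex_funs_measurable[OF g]
  obtain d where d: "d \<in> carrier E" "AE \<omega> in M. rep (f d) \<omega> < \<infinity>" using f by (rule convex_funs_dom)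
  obtain e where e: "e \<in> carrier E" "AE \<omega> in M. rep (g e) \<omega> < \<infinity>" using g by (rule convex_funs_dom)
  note locf = convex_funs_local[OF f] and locg = convex_funs_local[OF g]
  note [simp] = d(1) e(1)
  show ?thesis unfolding glue_eq_mkf[OF assms]
  proof (rule mkf_convex_funs)
    show "AE \<omega> in M. - \<infinity> < ?G x \<omega>" if "x \<in> carrier E" for x
      using convex_funs_proper[OF f that] convex_funs_proper[OF g that] by eventually_elim simp
    show "local_fun ?G" unfolding local_fun_def
    proof (intro ballI)
      fix x y assume xy: "x \<in> carrier E" "y \<in> carrier E"
      show "AE \<omega> in M. D x y \<omega> = 0 \<longrightarrow> ?G x \<omega> = ?G y \<omega>"
        using local_funD[OF locf xy] local_funD[OF locg xy] by eventually_elim simp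
    qed
    show "AE \<omega> in M. ?G (gl A d e) \<omega> < \<infinity>"
      using local_fun_gl[OF locf A d(1) e(1)] local_fun_gl[OF locg A d(1) e(1)] d(2) e(2)
      by eventually_elim simp
    show "AE \<omega> in M. ?G (lc a x (\<lambda>\<omega>. 1 - a \<omega>) y) \<omega> \<le> ereal (a \<omega>) * ?G x \<omega> + ereal (1 - a \<omega>) * ?G y \<omega>"
      if "x \<in> carrier E" "y \<in> carrier E" "a \<in> borel_measurable M" "AE \<omega> in M. 0 \<le> a \<omega>" "AE \<omega> in M. a \<omega> \<le> 1"
      for x y a
      using convex_funs_convex[OF f that] convex_funs_convex[OF g that] by eventually_elim simp
    fix xs rs x r
    assume [simp, measurable]: "\<And>n. xs n \<in> carrier E" "\<And>n. rs n \<in> borel_measurable M" "x \<in> carrier E"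
        "r \<in> borel_measurable M" and le: "\<And>n. AE \<omega> in M. ?G (xs n) \<omega> \<le> ereal (rs n \<omega>)"
        and lim: "AE \<omega> in M. (\<lambda>n. D (xs n) x \<omega>) \<longlonglongrightarrow> 0" "AE \<omega> in M. (\<lambda>n. rs n \<omega>) \<longlonglongrightarrow> r \<omega>"
    \<comment> \<open>The bound by the heights is available on \<open>B\<close> only. Off
      \<open>B\<close> the sequence is replaced by the constant \<open>b\<close>, where
      \<open>h\<close> is finite, so that lower semicontinuity of \<open>h\<close> can be used on
      the whole space.\<close>
    have *: "AE \<omega> in M. \<omega> \<in> B \<longrightarrow> rep (h x) \<omega> \<le> ereal (r \<omega>)"
      if h: "h \<in> convex_funs M E" and B [measurable]: "B \<in> sets M" and b [simp]: "b \<in> carrier E"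
        and bf: "AE \<omega> in M. rep (h b) \<omega> < \<infinity>"
        and hB: "\<And>n. AE \<omega> in M. \<omega> \<in> B \<longrightarrow> rep (h (xs n)) \<omega> \<le> ereal (rs n \<omega>)" for h B b
    proof -
      note [measurable] = convex_funs_measurable[OF h]
      note loch = convex_funs_local[OF h]
      let ?r = "\<lambda>\<omega>. if \<omega> \<in> B then r \<omega> else real_of_ereal (rep (h b) \<omega>)"
      have "AE \<omega> in M. rep (h (gl B x b)) \<omega> \<le> ereal (?r \<omega>)"
      proof (rule convex_funs_lsc[OF h, of "\<lambda>n. gl B (xs n) b"
            "\<lambda>n \<omega>. if \<omega> \<in> B then rs n \<omega> else real_of_ereal (rep (h b) \<omega>)"])
        show "AE \<omega> in M. rep (h (gl B (xs n) b)) \<omega>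
            \<le> ereal (if \<omega> \<in> B then rs n \<omega> else real_of_ereal (rep (h b) \<omega>))" for n
          using local_fun_gl[OF loch B _ b, of "xs n", simplified] hB[of n] bf convex_funs_proper[OF h b]
          by eventually_elim (auto simp: ereal_real)
        have "AE \<omega> in M. \<forall>n. D (gl B (xs n) b) (gl B x b) \<omega>
            \<le> \<bar>indicator B \<omega>\<bar> * D (xs n) x \<omega> + \<bar>1 - indicator B \<omega>\<bar> * D b b \<omega>"
          unfolding AE_all_countable gl_def by (intro allI D_lc) auto
        then show "AE \<omega> in M. (\<lambda>n. D (gl B (xs n) b) (gl B x b) \<omega>) \<longlonglongrightarrow> 0"
          using lim(1) D_self[OF b]
        proof eventually_elim
          case (elim \<omega>)
          have "D (gl B (xs n) b) (gl B x b) \<omega> \<le> D (xs n) x \<omega>" for n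
            using elim(1)[rule_format, of n] elim(3) D_nonneg[of "xs n" x \<omega>]
            by (cases "\<omega> \<in> B") (auto intro: order_trans)
          then show ?case by (intro tendsto_sandwich[OF _ _ tendsto_const elim(2)]) auto
        qed
        show "AE \<omega> in M. (\<lambda>n. if \<omega> \<in> B then rs n \<omega> else real_of_ereal (rep (h b) \<omega>)) \<longlonglongrightarrow> ?r \<omega>"
          using lim(2) by eventually_elim auto
      qed auto
      with local_fun_gl[OF loch B _ b, of x, simplified] show ?thesis by eventually_elim auto
    qed
    have "AE \<omega> in M. \<omega> \<in> A \<longrightarrow> rep (f (xs n)) \<omega> \<le> ereal (rs n \<omega>)" for n
      using le[of n] by eventually_elim (auto split: if_splits)
    then have "AE \<omega> in M. \<omega> \<in> A \<longrightarrow> rep (f x) \<omega> \<le> ereal (r \<omega>)"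
      by (rule *[OF f A d])
    moreover have "AE \<omega> in M. \<omega> \<in> space M - A \<longrightarrow> rep (g (xs n)) \<omega> \<le> ereal (rs n \<omega>)" for n
      using le[of n] by eventually_elim (auto split: if_splits)
    then have "AE \<omega> in M. \<omega> \<in> space M - A \<longrightarrow> rep (g x) \<omega> \<le> ereal (r \<omega>)"
      by (intro *[OF g _ e]) auto
    ultimately show "AE \<omega> in M. ?G x \<omega> \<le> ereal (r \<omega>)" using AE_space by eventually_elim auto
  qed auto
qed

subsection \<open>Point functions\<close>

text \<open>The indicator function of convex analysis for the single element \<open>x\<close>,
  raised by \<open>r\<close>. The case distinction is made separately at each
  \<open>\<omega>\<close>, which makes it local.\<close>

definition pt :: "'e \<Rightarrow> ('w \<Rightarrow> real) \<Rightarrow> 'e \<Rightarrow> ('w \<Rightarrow> ereal) set" where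
  "pt x r = mkf (\<lambda>z \<omega>. if D z x \<omega> = 0 then ereal (r \<omega>) else \<infinity>)"

lemma lc_same:
  assumes "a \<in> borel_measurable M" "x \<in> carrier E"
  shows "lc a x (\<lambda>\<omega>. 1 - a \<omega>) x = x"
  using assms by (simp add: lc_def sc_add)

lemma rep_pt:
  assumes [measurable]: "r \<in> borel_measurable M" and [simp]: "x \<in> carrier E" "z \<in> carrier E"
  shows "AE \<omega> in M. rep (pt x r z) \<omega> = (if D z x \<omega> = 0 then ereal (r \<omega>) else \<infinity>)"
  unfolding pt_def by (rule rep_mkf) auto

lemma rep_pt_self:
  assumes "r \<in> borel_measurable M" "x \<in> carrier E"
  shows "AE \<omega> in M. rep (pt x r x) \<omega> = ereal (r \<omega>)"
  using rep_pt[OF assms assms(2)] D_self[OF assms(2)] by eventually_elim simp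

lemma pt_convex_funs [simp, intro]:
  assumes r [measurable]: "r \<in> borel_measurable M" and x [simp]: "x \<in> carrier E"
  shows "pt x r \<in> convex_funs M E"
  unfolding pt_def
proof (rule mkf_convex_funs)
  let ?G = "\<lambda>z \<omega>. if D z x \<omega> = 0 then ereal (r \<omega>) else \<infinity>"
  \<comment> \<open>The effective domain is \<open>x\<close> alone: convexity then only concerns
    \<open>x\<close> itself, and a sequence lying below real heights is constant.\<close>
  have dom: "z = x" if "z \<in> carrier E" "AE \<omega> in M. ?G z \<omega> < \<infinity>" for z
    using that(2) by (intro D_zeroD[OF that(1) x]) (auto elim: eventually_mono split: if_splits)
  show "local_fun ?G" unfolding local_fun_def
  proof (intro ballI)
    fix y z assume yz: "y \<in> carrier E" "z \<in> carrier E"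
    show "AE \<omega> in M. D y z \<omega> = 0 \<longrightarrow> ?G y \<omega> = ?G z \<omega>"
      using D_triangle[OF yz x] D_triangle[OF yz(2,1) x] D_commute[OF yz]
      by eventually_elim (auto intro: antisym simp: D_nonneg)
  qed
  show "AE \<omega> in M. ?G x \<omega> < \<infinity>" using D_self[OF x] by eventually_elim simp
  show "AE \<omega> in M. ?G (lc a y (\<lambda>\<omega>. 1 - a \<omega>) z) \<omega> \<le> ereal (a \<omega>) * ?G y \<omega> + ereal (1 - a \<omega>) * ?G z \<omega>"
    if "y \<in> carrier E" "z \<in> carrier E" "a \<in> borel_measurable M"
      "AE \<omega> in M. ?G y \<omega> < \<infinity>" "AE \<omega> in M. ?G z \<omega> < \<infinity>" for y z a
  proof -
    have "y = x" "z = x" using dom that by auto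
    then have "lc a y (\<lambda>\<omega>. 1 - a \<omega>) z = x" using that by (simp add: lc_same)
    then show ?thesis using D_self[OF x] \<open>y = x\<close> \<open>z = x\<close>
      by simp (eventually_elim, simp add: algebra_simps)
  qed
  fix xs rs z t
  assume [simp]: "\<And>n. xs n \<in> carrier E" and [measurable]: "\<And>n. rs n \<in> borel_measurable M"
    and z [simp]: "z \<in> carrier E" and le: "\<And>n. AE \<omega> in M. ?G (xs n) \<omega> \<le> ereal (rs n \<omega>)"
    and lim: "AE \<omega> in M. (\<lambda>n. D (xs n) z \<omega>) \<longlonglongrightarrow> 0" "AE \<omega> in M. (\<lambda>n. rs n \<omega>) \<longlonglongrightarrow> t \<omega>"
  have xs: "xs n = x" for n
    using le[of n] by (intro dom) (auto elim!: eventually_mono simp: less_top[symmetric] split: if_splits)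
  have "AE \<omega> in M. D x z \<omega> = 0" using lim(1) by eventually_elim (simp add: xs LIMSEQ_const_iff)
  then have zx: "z = x" using D_zeroD[OF x z] by simp
  have "AE \<omega> in M. \<forall>n. ?G (xs n) \<omega> \<le> ereal (rs n \<omega>)" using le by (simp add: AE_all_countable)
  then show "AE \<omega> in M. ?G z \<omega> \<le> ereal (t \<omega>)"
    using lim(2) D_self[OF x]
  proof eventually_elim
    case (elim \<omega>)
    then have "r \<omega> \<le> rs n \<omega>" for n using xs by simp
    then have "r \<omega> \<le> t \<omega>" using elim(2) by (intro LIMSEQ_le_const) auto
    then show ?case using elim zx by simp
  qed
qed auto

text \<open>Expresses membership in the epigraph by the order alone, which is what order
  automorphisms preserve. A bound at \<open>x\<close> suffices because \<open>pt x r\<close> is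
  infinite wherever its argument differs from \<open>x\<close>, and \<open>f\<close> is
  local.\<close>

lemma le_pt_iff:
  assumes f: "f \<in> convex_funs M E" and r [measurable]: "r \<in> borel_measurable M" and x: "x \<in> carrier E"
  shows "fun_le M E f (pt x r) \<longleftrightarrow> (AE \<omega> in M. rep (f x) \<omega> \<le> ereal (r \<omega>))"
proof
  assume "fun_le M E f (pt x r)"
  then have "AE \<omega> in M. rep (f x) \<omega> \<le> rep (pt x r x) \<omega>" using x by (auto simp: fun_le_iff)
  then show "AE \<omega> in M. rep (f x) \<omega> \<le> ereal (r \<omega>)"
    using rep_pt_self[OF r x] by eventually_elim simp
next
  assume le: "AE \<omega> in M. rep (f x) \<omega> \<le> ereal (r \<omega>)"
  show "fun_le M E f (pt x r)"
    unfolding fun_le_iff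
  proof
    fix z assume z: "z \<in> carrier E"
    show "AE \<omega> in M. rep (f z) \<omega> \<le> rep (pt x r z) \<omega>"
      using le rep_pt[OF r x z] local_funD[OF convex_funs_local[OF f] z x]
      by eventually_elim auto
  qed
qed

lemma pt_le_pt_iff:
  assumes r [measurable]: "r \<in> borel_measurable M" and s [measurable]: "s \<in> borel_measurable M"
    and x: "x \<in> carrier E" and y: "y \<in> carrier E"
  shows "fun_le M E (pt x r) (pt y s) \<longleftrightarrow> x = y \<and> (AE \<omega> in M. r \<omega> \<le> s \<omega>)"
proof
  assume "fun_le M E (pt x r) (pt y s)"
  then have le: "AE \<omega> in M. rep (pt x r y) \<omega> \<le> ereal (s \<omega>)" using le_pt_iff[OF pt_convex_funs[OF r x] s y] by simp
  have "AE \<omega> in M. D y x \<omega> = 0 \<and> r \<omega> \<le> s \<omega>"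
    using le rep_pt[OF r x y] by eventually_elim (auto split: if_splits)
  then show "x = y \<and> (AE \<omega> in M. r \<omega> \<le> s \<omega>)" using D_zeroD[OF y x] by auto
next
  assume *: "x = y \<and> (AE \<omega> in M. r \<omega> \<le> s \<omega>)"
  then have "AE \<omega> in M. rep (pt x r y) \<omega> \<le> ereal (s \<omega>)"
    using rep_pt_self[OF r x] by (auto elim: eventually_elim2)
  then show "fun_le M E (pt x r) (pt y s)" using le_pt_iff[OF pt_convex_funs[OF r x] s y] by simp
qed

lemma fun_le_refl: "fun_le M E f f"
  by (simp add: fun_le_iff)

lemma pt_eq_iff:
  assumes "r \<in> borel_measurable M" "s \<in> borel_measurable M" "x \<in> carrier E" "y \<in> carrier E"
  shows "pt x r = pt y s \<longleftrightarrow> x = y \<and> (AE \<omega> in M. r \<omega> = s \<omega>)"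
proof
  assume eq: "pt x r = pt y s"
  have "fun_le M E (pt x r) (pt y s)" "fun_le M E (pt y s) (pt x r)"
    unfolding eq by (rule fun_le_refl)+
  then have "x = y" and le: "AE \<omega> in M. r \<omega> \<le> s \<omega>" "AE \<omega> in M. s \<omega> \<le> r \<omega>"
    using assms by (simp_all add: pt_le_pt_iff)
  from le have "AE \<omega> in M. r \<omega> = s \<omega>" by eventually_elim simp
  with \<open>x = y\<close> show "x = y \<and> (AE \<omega> in M. r \<omega> = s \<omega>)" by blast
next
  assume *: "x = y \<and> (AE \<omega> in M. r \<omega> = s \<omega>)"
  then have "AE \<omega> in M. r \<omega> \<le> s \<omega>" "AE \<omega> in M. s \<omega> \<le> r \<omega>" by (auto elim: eventually_mono)
  then show "pt x r = pt y s" using * assms by (intro fun_le_antisym) (auto simp: pt_le_pt_iff)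
qed

lemma glue_pt:
  assumes r [measurable]: "r \<in> borel_measurable M" and s [measurable]: "s \<in> borel_measurable M"
    and x: "x \<in> carrier E" and y: "y \<in> carrier E" and A [measurable]: "A \<in> sets M"
  shows "glue M E A (pt x r) (pt y s) = pt (gl A x y) (\<lambda>\<omega>. if \<omega> \<in> A then r \<omega> else s \<omega>)"
proof (rule convex_funs_eqI)
  show "glue M E A (pt x r) (pt y s) \<in> convex_funs M E"
    using assms by (intro glue_convex_funs) auto
  have ifm: "(\<lambda>\<omega>. if \<omega> \<in> A then r \<omega> else s \<omega>) \<in> borel_measurable M" by measurable
  have g: "gl A x y \<in> carrier E" using x y by auto
  show "pt (gl A x y) (\<lambda>\<omega>. if \<omega> \<in> A then r \<omega> else s \<omega>) \<in> convex_funs M E"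
    by (rule pt_convex_funs[OF ifm g])
  fix z assume z: "z \<in> carrier E"
  show "AE \<omega> in M. rep (glue M E A (pt x r) (pt y s) z) \<omega>
    = rep (pt (gl A x y) (\<lambda>\<omega>. if \<omega> \<in> A then r \<omega> else s \<omega>) z) \<omega>"
    using rep_glue[OF pt_convex_funs[OF r x] pt_convex_funs[OF s y] A z] rep_pt[OF ifm g z]
      rep_pt[OF r x z] rep_pt[OF s y z] gl_left[OF A x y] gl_right[OF A x y]
      D_triangle[OF z x g] D_triangle[OF z g x] D_triangle[OF z y g] D_triangle[OF z g y]
      D_commute[OF x g] D_commute[OF y g]
  proof eventually_elim
    case (elim \<omega>)
    show ?case
    proof (cases "\<omega> \<in> A")
      case True
      then have "D z x \<omega> = 0 \<longleftrightarrow> D z (gl A x y) \<omega> = 0"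
        using elim D_nonneg[of z x \<omega>] D_nonneg[of z "gl A x y" \<omega>] by (smt (verit))
      then show ?thesis using elim(1-4) True by simp
    next
      case False
      then have "D z y \<omega> = 0 \<longleftrightarrow> D z (gl A x y) \<omega> = 0"
        using elim D_nonneg[of z y \<omega>] D_nonneg[of z "gl A x y" \<omega>] by (smt (verit))
      then show ?thesis using elim(1-4) False by simp
    qed
  qed
qed

subsection \<open>Segment functions\<close>

text \<open>If \<open>D x y\<close> never vanishes, the weight of \<open>x\<close> in a convex combination \<open>z\<close> of \<open>x\<close> and \<open>y\<close>
  is recovered as \<open>D z y / D x y\<close>; this gives the convex hull of two points in closed form.\<close>

definition wt :: "'e \<Rightarrow> 'e \<Rightarrow> 'e \<Rightarrow> 'w \<Rightarrow> real" where "wt x y z \<omega> = D z y \<omega> / D x y \<omega>"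

text \<open>Rebuilds a point from the weight read off \<open>z\<close>. That weight is never
  negative, so for separated endpoints \<open>z\<close> lies on the segment exactly when the weight
  is at most 1 and the rebuilt point is \<open>z\<close>; \<open>segf\<close> tests this at every
  \<open>\<omega>\<close>.\<close>

definition onl :: "'e \<Rightarrow> 'e \<Rightarrow> 'e \<Rightarrow> 'e" where "onl x y z = lc (wt x y z) x (\<lambda>\<omega>. 1 - wt x y z \<omega>) y"

definition segf :: "'e \<Rightarrow> ('w \<Rightarrow> real) \<Rightarrow> 'e \<Rightarrow> ('w \<Rightarrow> real) \<Rightarrow> 'e \<Rightarrow> 'w \<Rightarrow> ereal" where
  "segf x r y s z \<omega> = (if wt x y z \<omega> \<le> 1 \<and> D z (onl x y z) \<omega> = 0
     then ereal (wt x y z \<omega> * r \<omega> + (1 - wt x y z \<omega>) * s \<omega>) else \<infinity>)"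

text \<open>Mere inequality of \<open>x\<close> and \<open>y\<close> makes the distance positive
  only with positive probability; dividing by it in \<open>wt\<close> asks for positivity almost
  everywhere.\<close>

definition sep :: "'e \<Rightarrow> 'e \<Rightarrow> bool" where "sep x y \<longleftrightarrow> (AE \<omega> in M. 0 < D x y \<omega>)"

lemma wt_measurable [measurable]:
  "x \<in> carrier E \<Longrightarrow> y \<in> carrier E \<Longrightarrow> z \<in> carrier E \<Longrightarrow> wt x y z \<in> borel_measurable M"
  unfolding wt_def by measurable

lemma wt_nonneg [simp]: "0 \<le> wt x y z \<omega>" by (simp add: wt_def)

lemma onl_closed [simp]:
  "x \<in> carrier E \<Longrightarrow> y \<in> carrier E \<Longrightarrow> z \<in> carrier E \<Longrightarrow> onl x y z \<in> carrier E"
  unfolding onl_def by (intro lc_closed) auto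

lemma segf_measurable [measurable]:
  assumes [measurable]: "x \<in> carrier E" "y \<in> carrier E" "z \<in> carrier E"
    "r \<in> borel_measurable M" "s \<in> borel_measurable M"
  shows "segf x r y s z \<in> borel_measurable M"
proof -
  have [measurable]: "D z (onl x y z) \<in> borel_measurable M" using assms by (intro D_measurable) auto
  show ?thesis unfolding segf_def by measurable
qed

lemma D_lc_right:
  assumes [measurable]: "a \<in> borel_measurable M" and [simp]: "x \<in> carrier E" "y \<in> carrier E"
  shows "AE \<omega> in M. D (lc a x (\<lambda>\<omega>. 1 - a \<omega>) y) y \<omega> = \<bar>a \<omega>\<bar> * D x y \<omega>"
proof -
  have "lc (\<lambda>_. 1) (lc a x (\<lambda>\<omega>. 1 - a \<omega>) y) (\<lambda>_. - 1) (lc (\<lambda>_. 0) x (\<lambda>_. 1) y) = lc a x (\<lambda>\<omega>. - a \<omega>) y"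
    by (simp add: lc_lc)
  then have 1: "lc (\<lambda>_. 1) (lc a x (\<lambda>\<omega>. 1 - a \<omega>) y) (\<lambda>_. - 1) y = lc a x (\<lambda>\<omega>. - a \<omega>) y"
    using right_eq_lc[of x y] by simp
  have 2: "sc a (lc (\<lambda>_. 1) x (\<lambda>_. - 1) y) = lc a x (\<lambda>\<omega>. - a \<omega>) y"
    by (simp add: lc_def sc_r_distr sc_sc del: sc_minus)
  show ?thesis unfolding D_def using N_sc[of a "lc (\<lambda>_. 1) x (\<lambda>_. - 1) y"] by (simp add: 1 2)
qed

lemma wt_lc:
  assumes sep: "sep x y" and a: "a \<in> borel_measurable M" "AE \<omega> in M. 0 \<le> a \<omega>"
    and xy: "x \<in> carrier E" "y \<in> carrier E"
  shows "AE \<omega> in M. wt x y (lc a x (\<lambda>\<omega>. 1 - a \<omega>) y) \<omega> = a \<omega>"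
  using D_lc_right[OF a(1) xy] sep[unfolded sep_def] a(2)
  by eventually_elim (simp add: wt_def)

text \<open>The weight is read off the distance to \<open>y\<close>, which reveals its modulus;
  hence the sign conditions.\<close>

lemma lc_weight_unique:
  assumes "sep x y" "x \<in> carrier E" "y \<in> carrier E"
    "a \<in> borel_measurable M" "AE \<omega> in M. 0 \<le> a \<omega>" "b \<in> borel_measurable M" "AE \<omega> in M. 0 \<le> b \<omega>"
    "lc a x (\<lambda>\<omega>. 1 - a \<omega>) y = lc b x (\<lambda>\<omega>. 1 - b \<omega>) y"
  shows "AE \<omega> in M. a \<omega> = b \<omega>"
  using wt_lc[OF assms(1,4,5,2,3)] wt_lc[OF assms(1,6,7,2,3)] unfolding assms(8)
  by eventually_elim simp

lemma segf_lc:
  assumes sep: "sep x y" and xy [simp]: "x \<in> carrier E" "y \<in> carrier E"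
    and a [measurable]: "a \<in> borel_measurable M" "AE \<omega> in M. 0 \<le> a \<omega>" "AE \<omega> in M. a \<omega> \<le> 1"
  shows "AE \<omega> in M. segf x r y s (lc a x (\<lambda>\<omega>. 1 - a \<omega>) y) \<omega> = ereal (a \<omega> * r \<omega> + (1 - a \<omega>) * s \<omega>)"
proof -
  let ?z = "lc a x (\<lambda>\<omega>. 1 - a \<omega>) y"
  have w: "AE \<omega> in M. wt x y ?z \<omega> = a \<omega>" by (rule wt_lc[OF sep a(1,2) xy])
  then have "onl x y ?z = ?z" unfolding onl_def by (intro lc_cong) (auto elim: eventually_mono)
  moreover have "AE \<omega> in M. D ?z ?z \<omega> = 0" by (intro D_self) auto
  ultimately have "AE \<omega> in M. D ?z (onl x y ?z) \<omega> = 0" by simp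
  with w a(3) show ?thesis by eventually_elim (simp add: segf_def)
qed

lemma segf_finiteD:
  assumes "x \<in> carrier E" "y \<in> carrier E" "z \<in> carrier E" "AE \<omega> in M. segf x r y s z \<omega> < \<infinity>"
  shows "AE \<omega> in M. wt x y z \<omega> \<le> 1" and "lc (wt x y z) x (\<lambda>\<omega>. 1 - wt x y z \<omega>) y = z"
proof -
  show "AE \<omega> in M. wt x y z \<omega> \<le> 1"
    using assms(4) by eventually_elim (auto simp: segf_def split: if_splits)
  have "AE \<omega> in M. D z (onl x y z) \<omega> = 0"
    using assms(4) by eventually_elim (auto simp: segf_def split: if_splits)
  then show "lc (wt x y z) x (\<lambda>\<omega>. 1 - wt x y z \<omega>) y = z"
    using D_zeroD[of z "onl x y z"] assms by (simp add: onl_def)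
qed

lemma segf_local:
  assumes xy [simp]: "x \<in> carrier E" "y \<in> carrier E"
  shows "local_fun (segf x r y s)"
  unfolding local_fun_def
proof (intro ballI)
  fix u v assume uv [simp]: "u \<in> carrier E" "v \<in> carrier E"
  have o [simp]: "onl x y u \<in> carrier E" "onl x y v \<in> carrier E" by auto
  have d: "AE \<omega> in M. D (onl x y u) (onl x y v) \<omega>
    \<le> \<bar>wt x y u \<omega> - wt x y v \<omega>\<bar> * N x \<omega> + \<bar>1 - wt x y u \<omega> - (1 - wt x y v \<omega>)\<bar> * N y \<omega>"
    unfolding onl_def by (rule D_lc_same) auto
  show "AE \<omega> in M. D u v \<omega> = 0 \<longrightarrow> segf x r y s u \<omega> = segf x r y s v \<omega>"
    using d D_triangle[OF uv xy(2)] D_triangle[OF uv(2,1) xy(2)] D_commute[OF uv]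
      D_triangle[OF uv o(2)] D_triangle[OF uv(2,1) o(1)] D_triangle[OF uv(1) o(2,1)]
      D_triangle[OF uv(2) o(1,2)] D_commute[OF o]
  proof eventually_elim
    case (elim \<omega>)
    show ?case
    proof
      assume 0: "D u v \<omega> = 0"
      then have w: "wt x y u \<omega> = wt x y v \<omega>" using elim(2,3,4) by (simp add: wt_def)
      then have "D (onl x y u) (onl x y v) \<omega> = 0" using elim(1) by (simp add: antisym)
      then have "D u (onl x y u) \<omega> = 0 \<longleftrightarrow> D v (onl x y v) \<omega> = 0"
        using 0 elim D_nonneg[of u "onl x y u" \<omega>] D_nonneg[of v "onl x y v" \<omega>] by (smt (verit))
      then show "segf x r y s u \<omega> = segf x r y s v \<omega>" using w by (simp add: segf_def)
    qed
  qed
qed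

lemma segf_convex_funs:
  assumes sep: "sep x y" and xy [simp]: "x \<in> carrier E" "y \<in> carrier E"
    and r [measurable]: "r \<in> borel_measurable M" and s [measurable]: "s \<in> borel_measurable M"
  shows "mkf (segf x r y s) \<in> convex_funs M E"
proof (rule mkf_convex_funs)
  let ?G = "segf x r y s"
  show "local_fun ?G" by (rule segf_local) auto
  show "AE \<omega> in M. - \<infinity> < ?G z \<omega>" for z by (simp add: segf_def)
  have "AE \<omega> in M. ?G (lc (\<lambda>_. 1) x (\<lambda>\<omega>. 1 - 1) y) \<omega> = ereal (1 * r \<omega> + (1 - 1) * s \<omega>)"
    by (rule segf_lc[OF sep]) auto
  then show "AE \<omega> in M. ?G x \<omega> < \<infinity>" using left_eq_lc[of x y] by (auto elim: eventually_mono)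
  show "AE \<omega> in M. ?G (lc t u (\<lambda>\<omega>. 1 - t \<omega>) v) \<omega> \<le> ereal (t \<omega>) * ?G u \<omega> + ereal (1 - t \<omega>) * ?G v \<omega>"
    if uv [simp]: "u \<in> carrier E" "v \<in> carrier E" and t [measurable]: "t \<in> borel_measurable M"
      and t01: "AE \<omega> in M. 0 \<le> t \<omega>" "AE \<omega> in M. t \<omega> \<le> 1"
      and fin: "AE \<omega> in M. ?G u \<omega> < \<infinity>" "AE \<omega> in M. ?G v \<omega> < \<infinity>" for u v t
  proof -
    define a where "a = wt x y u"
    define b where "b = wt x y v"
    have [measurable]: "a \<in> borel_measurable M" "b \<in> borel_measurable M" by (auto simp: a_def b_def)
    have ab: "AE \<omega> in M. a \<omega> \<le> 1" "AE \<omega> in M. b \<omega> \<le> 1" "\<And>\<omega>. 0 \<le> a \<omega>" "\<And>\<omega>. 0 \<le> b \<omega>"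
      and u: "lc a x (\<lambda>\<omega>. 1 - a \<omega>) y = u" and v: "lc b x (\<lambda>\<omega>. 1 - b \<omega>) y = v"
      using segf_finiteD[OF xy uv(1) fin(1)] segf_finiteD[OF xy uv(2) fin(2)] by (simp_all add: a_def b_def)
    \<comment> \<open>The weight of a combination of two points of the segment. The heights combine
      in the same way, so the required inequality holds as an equality.\<close>
    define c where "c \<omega> = t \<omega> * a \<omega> + (1 - t \<omega>) * b \<omega>" for \<omega>
    have [measurable]: "c \<in> borel_measurable M" unfolding c_def by measurable
    have "lc t u (\<lambda>\<omega>. 1 - t \<omega>) v = lc c x (\<lambda>\<omega>. t \<omega> * (1 - a \<omega>) + (1 - t \<omega>) * (1 - b \<omega>)) y"
      unfolding u[symmetric] v[symmetric] by (subst lc_lc) (simp_all add: c_def[abs_def])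
    also have "\<dots> = lc c x (\<lambda>\<omega>. 1 - c \<omega>) y" by (intro lc_cong) (simp_all add: c_def algebra_simps)
    finally have eq: "lc t u (\<lambda>\<omega>. 1 - t \<omega>) v = lc c x (\<lambda>\<omega>. 1 - c \<omega>) y" .
    have c0: "AE \<omega> in M. 0 \<le> c \<omega>" using t01 by eventually_elim (simp add: c_def ab)
    have c1: "AE \<omega> in M. c \<omega> \<le> 1" using t01 ab(1,2)
    proof eventually_elim
      case (elim \<omega>)
      have "c \<omega> \<le> t \<omega> * 1 + (1 - t \<omega>) * 1" unfolding c_def using elim by (intro add_mono mult_left_mono) auto
      then show ?case by simp
    qed
    have gc: "AE \<omega> in M. ?G (lc t u (\<lambda>\<omega>. 1 - t \<omega>) v) \<omega> = ereal (c \<omega> * r \<omega> + (1 - c \<omega>) * s \<omega>)"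
      unfolding eq by (rule segf_lc[OF sep xy _ c0 c1]) auto
    have ga: "AE \<omega> in M. ?G u \<omega> = ereal (a \<omega> * r \<omega> + (1 - a \<omega>) * s \<omega>)"
      using segf_lc[OF sep xy, of a] ab u by simp
    have gb: "AE \<omega> in M. ?G v \<omega> = ereal (b \<omega> * r \<omega> + (1 - b \<omega>) * s \<omega>)"
      using segf_lc[OF sep xy, of b] ab v by simp
    show ?thesis using gc ga gb by eventually_elim (simp add: c_def algebra_simps)
  qed
  fix xs rs z t
  assume xs [simp]: "\<And>n. xs n \<in> carrier E" and rs [measurable]: "\<And>n. rs n \<in> borel_measurable M"
    and z [simp]: "z \<in> carrier E" and le: "\<And>n. AE \<omega> in M. ?G (xs n) \<omega> \<le> ereal (rs n \<omega>)"
    and lim: "AE \<omega> in M. (\<lambda>n. D (xs n) z \<omega>) \<longlonglongrightarrow> 0" "AE \<omega> in M. (\<lambda>n. rs n \<omega>) \<longlonglongrightarrow> t \<omega>"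
  \<comment> \<open>Points below a real height lie on the segment and so have weights
    \<open>a n\<close>. These converge because a weight is a quotient of distances, and the limit
    weight rebuilds \<open>z\<close>.\<close>
  define a where "a n = wt x y (xs n)" for n
  have a [measurable]: "a n \<in> borel_measurable M" for n by (simp add: a_def)
  have fin: "AE \<omega> in M. ?G (xs n) \<omega> < \<infinity>" for n using le[of n] by eventually_elim auto
  have a1: "AE \<omega> in M. \<forall>n. a n \<omega> \<le> 1"
    unfolding AE_all_countable a_def using segf_finiteD(1)[OF xy xs fin] by blast
  have xeq: "xs n = lc (a n) x (\<lambda>\<omega>. 1 - a n \<omega>) y" for n
    unfolding a_def using segf_finiteD(2)[OF xy xs fin] by simp
  have val: "AE \<omega> in M. \<forall>n. a n \<omega> * r \<omega> + (1 - a n \<omega>) * s \<omega> \<le> rs n \<omega>"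
    unfolding AE_all_countable
  proof
    fix n show "AE \<omega> in M. a n \<omega> * r \<omega> + (1 - a n \<omega>) * s \<omega> \<le> rs n \<omega>"
      using le[of n] by eventually_elim (auto simp: segf_def a_def split: if_splits)
  qed
  define b where "b = wt x y z"
  have b [measurable]: "b \<in> borel_measurable M" by (simp add: b_def)
  have d1: "AE \<omega> in M. \<forall>n. D (xs n) y \<omega> \<le> D (xs n) z \<omega> + D z y \<omega> \<and> D z y \<omega> \<le> D z (xs n) \<omega> + D (xs n) y \<omega>
      \<and> D z (xs n) \<omega> = D (xs n) z \<omega> \<and> D z (onl x y z) \<omega> \<le> D z (xs n) \<omega> + D (xs n) (onl x y z) \<omega>"
    unfolding AE_all_countable AE_conj_iff by (intro allI conjI D_triangle D_commute) auto
  have d2: "AE \<omega> in M. \<forall>n. D (xs n) (onl x y z) \<omega>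
      \<le> \<bar>a n \<omega> - b \<omega>\<bar> * N x \<omega> + \<bar>1 - a n \<omega> - (1 - b \<omega>)\<bar> * N y \<omega>"
    unfolding AE_all_countable onl_def xeq b_def[symmetric] by (intro allI D_lc_same) auto
  show "AE \<omega> in M. ?G z \<omega> \<le> ereal (t \<omega>)"
    using a1 val d1 d2 lim sep[unfolded sep_def]
  proof eventually_elim
    case (elim \<omega>)
    have "(\<lambda>n. \<bar>D (xs n) y \<omega> - D z y \<omega>\<bar>) \<longlonglongrightarrow> 0"
    proof (rule tendsto_sandwich[OF _ _ tendsto_const elim(5)])
      have "\<bar>D (xs n) y \<omega> - D z y \<omega>\<bar> \<le> D (xs n) z \<omega>" for n
        using elim(3)[rule_format, of n] by linarith
      then show "\<forall>\<^sub>F n in sequentially. \<bar>D (xs n) y \<omega> - D z y \<omega>\<bar> \<le> D (xs n) z \<omega>" by simp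
    qed simp
    then have "(\<lambda>n. D (xs n) y \<omega>) \<longlonglongrightarrow> D z y \<omega>" by (rule LIM_zero_cancel[OF tendsto_rabs_zero_cancel])
    then have ab: "(\<lambda>n. a n \<omega>) \<longlonglongrightarrow> b \<omega>"
      unfolding a_def b_def wt_def using elim(7) by (intro tendsto_divide) auto
    have b1: "b \<omega> \<le> 1" using elim(1) by (intro LIMSEQ_le_const2[OF ab]) auto
    have "(\<lambda>n. D (xs n) z \<omega> + (\<bar>a n \<omega> - b \<omega>\<bar> * N x \<omega> + \<bar>1 - a n \<omega> - (1 - b \<omega>)\<bar> * N y \<omega>))
        \<longlonglongrightarrow> 0 + (\<bar>b \<omega> - b \<omega>\<bar> * N x \<omega> + \<bar>1 - b \<omega> - (1 - b \<omega>)\<bar> * N y \<omega>)"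
      by (intro tendsto_intros elim ab)
    then have "D z (onl x y z) \<omega> \<le> 0 + (\<bar>b \<omega> - b \<omega>\<bar> * N x \<omega> + \<bar>1 - b \<omega> - (1 - b \<omega>)\<bar> * N y \<omega>)"
    proof (rule LIMSEQ_le_const, intro exI allI impI)
      fix n show "D z (onl x y z) \<omega> \<le> D (xs n) z \<omega> + (\<bar>a n \<omega> - b \<omega>\<bar> * N x \<omega> + \<bar>1 - a n \<omega> - (1 - b \<omega>)\<bar> * N y \<omega>)"
        using elim(3)[rule_format, of n] elim(4)[rule_format, of n] by linarith
    qed
    then have D0: "D z (onl x y z) \<omega> = 0" using D_nonneg[of z "onl x y z" \<omega>] by simp
    have "(\<lambda>n. a n \<omega> * r \<omega> + (1 - a n \<omega>) * s \<omega>) \<longlonglongrightarrow> b \<omega> * r \<omega> + (1 - b \<omega>) * s \<omega>"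
      by (intro tendsto_intros ab)
    then have "b \<omega> * r \<omega> + (1 - b \<omega>) * s \<omega> \<le> t \<omega>"
      using elim(2,6) by (intro LIMSEQ_le[where X = "\<lambda>n. a n \<omega> * r \<omega> + (1 - a n \<omega>) * s \<omega>"]) auto
    then show ?case using b1 D0 by (simp add: segf_def b_def)
  qed
qed auto

text \<open>Necessity is tested with the single function \<open>segf x r y s\<close>; sufficiency is
  convexity. The left side mentions only the order and point functions, so order automorphisms
  transport it.\<close>

lemma between_iff:
  assumes sep: "sep x y" and xyz [simp]: "x \<in> carrier E" "y \<in> carrier E" "z \<in> carrier E"
    and r [measurable]: "r \<in> borel_measurable M" and s [measurable]: "s \<in> borel_measurable M"
    and t [measurable]: "t \<in> borel_measurable M"
  shows "(\<forall>f\<in>convex_funs M E. fun_le M E f (pt x r) \<and> fun_le M E f (pt y s) \<longrightarrow> fun_le M E f (pt z t)) \<longleftrightarrow>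
    (\<exists>a\<in>borel_measurable M. (AE \<omega> in M. 0 \<le> a \<omega>) \<and> (AE \<omega> in M. a \<omega> \<le> 1) \<and>
      z = lc a x (\<lambda>\<omega>. 1 - a \<omega>) y \<and> (AE \<omega> in M. a \<omega> * r \<omega> + (1 - a \<omega>) * s \<omega> \<le> t \<omega>))"
  (is "?L \<longleftrightarrow> ?R")
proof
  assume L: ?L
  let ?f = "mkf (segf x r y s)"
  have f: "?f \<in> convex_funs M E" by (rule segf_convex_funs[OF sep]) auto
  have rep: "AE \<omega> in M. rep (?f u) \<omega> = segf x r y s u \<omega>" if "u \<in> carrier E" for u
    using that by (intro rep_mkf) auto
  have "AE \<omega> in M. segf x r y s (lc (\<lambda>_. 1) x (\<lambda>\<omega>. 1 - 1) y) \<omega> = ereal (1 * r \<omega> + (1 - 1) * s \<omega>)"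
    by (rule segf_lc[OF sep]) auto
  then have "fun_le M E ?f (pt x r)"
    unfolding le_pt_iff[OF f r xyz(1)] using left_eq_lc[of x y] rep[of x] by (auto elim: eventually_elim2)
  moreover have "AE \<omega> in M. segf x r y s (lc (\<lambda>_. 0) x (\<lambda>\<omega>. 1 - 0) y) \<omega> = ereal (0 * r \<omega> + (1 - 0) * s \<omega>)"
    by (rule segf_lc[OF sep]) auto
  then have "fun_le M E ?f (pt y s)"
    unfolding le_pt_iff[OF f s xyz(2)] using right_eq_lc[of x y] rep[of y] by (auto elim: eventually_elim2)
  ultimately have "fun_le M E ?f (pt z t)" using L f by blast
  then have le: "AE \<omega> in M. segf x r y s z \<omega> \<le> ereal (t \<omega>)"
    unfolding le_pt_iff[OF f t xyz(3)] using rep[OF xyz(3)] by (auto elim: eventually_elim2)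
  then have fin: "AE \<omega> in M. segf x r y s z \<omega> < \<infinity>" by eventually_elim auto
  have "AE \<omega> in M. wt x y z \<omega> * r \<omega> + (1 - wt x y z \<omega>) * s \<omega> \<le> t \<omega>"
    using le by eventually_elim (auto simp: segf_def split: if_splits)
  then show ?R using segf_finiteD[OF xyz fin] by (intro bexI[of _ "wt x y z"]) auto
next
  assume ?R
  then obtain a where a: "a \<in> borel_measurable M" "AE \<omega> in M. 0 \<le> a \<omega>" "AE \<omega> in M. a \<omega> \<le> 1"
    "z = lc a x (\<lambda>\<omega>. 1 - a \<omega>) y" "AE \<omega> in M. a \<omega> * r \<omega> + (1 - a \<omega>) * s \<omega> \<le> t \<omega>" by blast
  show ?L
  proof (intro ballI impI)
    fix f assume f: "f \<in> convex_funs M E" and "fun_le M E f (pt x r) \<and> fun_le M E f (pt y s)"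
    then have "AE \<omega> in M. rep (f x) \<omega> \<le> ereal (r \<omega>)" "AE \<omega> in M. rep (f y) \<omega> \<le> ereal (s \<omega>)"
      by (simp_all add: le_pt_iff)
    then have "AE \<omega> in M. rep (f z) \<omega> \<le> ereal (t \<omega>)"
      using convex_funs_convex[OF f xyz(1,2) a(1-3)] a(2,3,5) unfolding a(4)[symmetric]
    proof eventually_elim
      case (elim \<omega>)
      have "ereal (a \<omega>) * rep (f x) \<omega> + ereal (1 - a \<omega>) * rep (f y) \<omega>
        \<le> ereal (a \<omega>) * ereal (r \<omega>) + ereal (1 - a \<omega>) * ereal (s \<omega>)"
        using elim by (intro add_mono ereal_mult_left_mono) auto
      also have "\<dots> \<le> ereal (t \<omega>)" using elim by simp
      finally show ?case using elim(3) by (rule order_trans[rotated])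
    qed
    then show "fun_le M E f (pt z t)" using f by (simp add: le_pt_iff)
  qed
qed

subsection \<open>Two finite convex functions\<close>

text \<open>Centred at \<open>c\<close>, because the norm of the linear part \<open>H x\<close> will
  be the distance of \<open>phi x\<close> to the image \<open>c\<close> of the origin.\<close>

lemma norm_convex_funs:
  assumes c [simp]: "c \<in> carrier E"
  shows "mkf (\<lambda>x \<omega>. ereal (D x c \<omega>)) \<in> convex_funs M E"
proof (rule mkf_convex_funs)
  show "local_fun (\<lambda>x \<omega>. ereal (D x c \<omega>))" unfolding local_fun_def
  proof (intro ballI)
    fix x y assume xy: "x \<in> carrier E" "y \<in> carrier E"
    show "AE \<omega> in M. D x y \<omega> = 0 \<longrightarrow> ereal (D x c \<omega>) = ereal (D y c \<omega>)"
      using D_triangle[OF xy c] D_triangle[OF xy(2,1) c] D_commute[OF xy] by eventually_elim auto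
  qed
  show "AE \<omega> in M. ereal (D (lc a x (\<lambda>\<omega>. 1 - a \<omega>) y) c \<omega>)
      \<le> ereal (a \<omega>) * ereal (D x c \<omega>) + ereal (1 - a \<omega>) * ereal (D y c \<omega>)"
    if xy: "x \<in> carrier E" "y \<in> carrier E" and a: "a \<in> borel_measurable M"
      "AE \<omega> in M. 0 \<le> a \<omega>" "AE \<omega> in M. a \<omega> \<le> 1" for x y a
  proof -
    have "AE \<omega> in M. D (lc a x (\<lambda>\<omega>. 1 - a \<omega>) y) (lc a c (\<lambda>\<omega>. 1 - a \<omega>) c) \<omega>
        \<le> \<bar>a \<omega>\<bar> * D x c \<omega> + \<bar>1 - a \<omega>\<bar> * D y c \<omega>"
      using xy a by (intro D_lc) auto
    then show ?thesis unfolding lc_same[OF a(1) c] using a(2,3) by eventually_elim simp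
  qed
  fix xs rs x r
  assume [simp]: "\<And>n. xs n \<in> carrier E" "x \<in> carrier E"
    and le: "\<And>n. AE \<omega> in M. ereal (D (xs n) c \<omega>) \<le> ereal (rs n \<omega>)"
    and lim: "AE \<omega> in M. (\<lambda>n. D (xs n) x \<omega>) \<longlonglongrightarrow> 0" "AE \<omega> in M. (\<lambda>n. rs n \<omega>) \<longlonglongrightarrow> r \<omega>"
  have "AE \<omega> in M. \<forall>n. D x c \<omega> \<le> D x (xs n) \<omega> + D (xs n) c \<omega> \<and> D x (xs n) \<omega> = D (xs n) x \<omega>
      \<and> ereal (D (xs n) c \<omega>) \<le> ereal (rs n \<omega>)"
    unfolding AE_all_countable AE_conj_iff by (intro allI conjI D_triangle D_commute le) auto
  then show "AE \<omega> in M. ereal (D x c \<omega>) \<le> ereal (r \<omega>)"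
    using lim
  proof eventually_elim
    case (elim \<omega>)
    have "D x c \<omega> \<le> 0 + r \<omega>"
    proof (rule LIMSEQ_le_const[OF tendsto_add[OF elim(2,3)]], intro exI allI impI)
      fix n show "D x c \<omega> \<le> D (xs n) x \<omega> + rs n \<omega>" using elim(1)[rule_format, of n] by simp
    qed
    then show ?case by simp
  qed
qed (use c in auto)

lemma zero_convex_funs: "mkf (\<lambda>x \<omega>. 0) \<in> convex_funs M E"
proof (rule mkf_convex_funs)
  show "\<zero>\<^bsub>E\<^esub> \<in> carrier E" by simp
  show "local_fun (\<lambda>x \<omega>. 0 :: ereal)" by (simp add: local_fun_def)
  fix rs r and xs :: "nat \<Rightarrow> 'e"
  assume le: "\<And>n. AE \<omega> in M. (0::ereal) \<le> ereal (rs n \<omega>)"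
    and lim: "AE \<omega> in M. (\<lambda>n. rs n \<omega>) \<longlonglongrightarrow> r \<omega>"
  have "AE \<omega> in M. \<forall>n. (0::ereal) \<le> ereal (rs n \<omega>)" unfolding AE_all_countable using le by blast
  then show "AE \<omega> in M. (0::ereal) \<le> ereal (r \<omega>)"
    using lim
  proof eventually_elim
    case (elim \<omega>)
    then have "0 \<le> r \<omega>" by (intro LIMSEQ_le_const[OF elim(2)]) auto
    then show ?case by simp
  qed
qed auto

subsection \<open>An element of full support\<close>

lemma N_local: "local_fun N"
  unfolding local_fun_def
proof (intro ballI)
  fix x y assume xy: "x \<in> carrier E" "y \<in> carrier E"
  show "AE \<omega> in M. D x y \<omega> = 0 \<longrightarrow> N x \<omega> = N y \<omega>"
    unfolding N_eq_D[OF xy(1)] N_eq_D[OF xy(2)]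
    using D_triangle[OF xy M.zero_closed] D_triangle[OF xy(2,1) M.zero_closed] D_commute[OF xy]
    by eventually_elim auto
qed

text \<open>Concatenation of a maximizing sequence for \<open>prob {\<omega>. 0 < N x \<omega>}\<close>.\<close>

lemma exists_dominating_support:
  assumes comp: "rn_complete M E"
  obtains e where "e \<in> carrier E" "\<And>x. x \<in> carrier E \<Longrightarrow> AE \<omega> in M. N e \<omega> = 0 \<longrightarrow> N x \<omega> = 0"
proof -
  define supp where "supp x = {\<omega> \<in> space M. 0 < N x \<omega>}" for x
  have supp [measurable]: "supp x \<in> sets M" if "x \<in> carrier E" for x
    unfolding supp_def using that by measurable
  define m where "m = (SUP x\<in>carrier E. prob (supp x))"
  have bdd: "bdd_above ((\<lambda>x. prob (supp x)) ` carrier E)" by (intro bdd_aboveI2[of _ _ 1]) simp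
  have "\<exists>x\<in>carrier E. m - 1 / real (Suc n) < prob (supp x)" for n
  proof -
    have "m - 1 / real (Suc n) < m" by simp
    then show ?thesis unfolding m_def by (subst (asm) less_cSUP_iff[OF _ bdd]) auto
  qed
  then obtain xs where xs [simp]: "\<And>n. xs n \<in> carrier E" and xm: "\<And>n. m - 1 / real (Suc n) < prob (supp (xs n))"
    by metis
  \<comment> \<open>Each step keeps \<open>s n\<close> where it is nonzero and takes
    \<open>xs n\<close> elsewhere, so the supports grow.\<close>
  define s where "s = rec_nat \<zero>\<^bsub>E\<^esub> (\<lambda>n y. gl (supp y) y (xs n))"
  have s_Suc: "s (Suc n) = gl (supp (s n)) (s n) (xs n)" for n by (simp add: s_def)
  have s [simp]: "s n \<in> carrier E" for n by (induction n) (auto simp: s_def)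
  have step: "AE \<omega> in M. \<forall>n. (0 < N (s n) \<omega> \<longrightarrow> D (s (Suc n)) (s n) \<omega> = 0 \<and> N (s (Suc n)) \<omega> = N (s n) \<omega>)
      \<and> (N (s n) \<omega> = 0 \<longrightarrow> N (s (Suc n)) \<omega> = N (xs n) \<omega>)
      \<and> D (s (Suc n)) (s n) \<omega> \<le> N (s (Suc n)) \<omega> + N (s n) \<omega>"
    unfolding AE_all_countable
  proof
    fix n
    have l: "AE \<omega> in M. \<omega> \<in> supp (s n) \<longrightarrow> D (s (Suc n)) (s n) \<omega> = 0"
      unfolding s_Suc by (rule gl_left) auto
    have r: "AE \<omega> in M. N (s (Suc n)) \<omega> = (if \<omega> \<in> supp (s n) then N (s n) \<omega> else N (xs n) \<omega>)"
      unfolding s_Suc by (rule local_fun_gl[OF N_local]) auto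
    have t: "AE \<omega> in M. D (s (Suc n)) (s n) \<omega> \<le> \<bar>1\<bar> * N (s (Suc n)) \<omega> + \<bar>- 1\<bar> * N (s n) \<omega>"
      unfolding D_def by (rule N_lc) auto
    show "AE \<omega> in M. (0 < N (s n) \<omega> \<longrightarrow> D (s (Suc n)) (s n) \<omega> = 0 \<and> N (s (Suc n)) \<omega> = N (s n) \<omega>)
      \<and> (N (s n) \<omega> = 0 \<longrightarrow> N (s (Suc n)) \<omega> = N (xs n) \<omega>)
      \<and> D (s (Suc n)) (s n) \<omega> \<le> N (s (Suc n)) \<omega> + N (s n) \<omega>"
      using l r t AE_space by eventually_elim (auto simp: supp_def)
  qed
  have stab: "AE \<omega> in M. \<forall>n k. 0 < N (s n) \<omega> \<longrightarrow> 0 < N (s (n + k)) \<omega> \<and> N (s (n + k)) \<omega> = N (s n) \<omega>"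
    using step
  proof eventually_elim
    case (elim \<omega>)
    have "0 < N (s n) \<omega> \<longrightarrow> 0 < N (s (n + k)) \<omega> \<and> N (s (n + k)) \<omega> = N (s n) \<omega>" for n k
      by (induction k) (use elim in auto)
    then show ?case by blast
  qed
  \<comment> \<open>At almost every \<open>\<omega>\<close> the sequence changes at most once,
    namely when it first becomes nonzero.\<close>
  have "AE \<omega> in M. summable (\<lambda>n. D (s (Suc n)) (s n) \<omega>)"
    using step stab
  proof eventually_elim
    case (elim \<omega>)
    show ?case
    proof (cases "\<exists>n. 0 < N (s n) \<omega>")
      case True
      then obtain n where n: "0 < N (s n) \<omega>" by blast
      have "D (s (Suc k)) (s k) \<omega> = 0" if "k \<notin> {..<n}" for k
      proof -
        have "0 < N (s k) \<omega>" using elim(2)[rule_format, OF n, of "k - n"] that by simp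
        then show ?thesis using elim(1) by blast
      qed
      then show ?thesis by (intro summable_finite[of "{..<n}"]) auto
    next
      case False
      then have "N (s n) \<omega> = 0" for n using N_nonneg[of "s n" \<omega>] by (metis less_eq_real_def)
      then have "D (s (Suc n)) (s n) \<omega> = 0" for n
        using elim(1)[rule_format, of n] D_nonneg[of "s (Suc n)" "s n" \<omega>] by auto
      then show ?thesis by simp
    qed
  qed
  then obtain e where e [simp]: "e \<in> carrier E" and lim: "AE \<omega> in M. (\<lambda>n. D (s n) e \<omega>) \<longlonglongrightarrow> 0"
    by (rule complete_AE[OF comp s])
  have tri: "AE \<omega> in M. \<forall>n. N (s n) \<omega> \<le> D (s n) e \<omega> + N e \<omega>"
    unfolding AE_all_countable using D_triangle[OF s e M.zero_closed] by (simp add: N_eq_D)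
  have pos: "AE \<omega> in M. \<forall>n. 0 < N (xs n) \<omega> \<longrightarrow> 0 < N e \<omega>"
    using tri lim stab step
  proof eventually_elim
    case (elim \<omega>)
    have "0 < N e \<omega>" if "0 < N (xs n) \<omega>" for n
    proof -
      have n: "0 < N (s (Suc n)) \<omega>"
      proof (cases "N (s n) \<omega> = 0")
        case True
        then show ?thesis using elim(4)[rule_format, of n] that by simp
      next
        case False
        then have "0 < N (s n) \<omega>" using N_nonneg[of "s n" \<omega>] by linarith
        then show ?thesis using elim(4)[rule_format, of n] by simp
      qed
      have c: "(\<lambda>k. D (s (Suc n + k)) e \<omega> + N e \<omega>) \<longlonglongrightarrow> 0 + N e \<omega>"
        using LIMSEQ_ignore_initial_segment[OF elim(2), of "Suc n"]
        by (intro tendsto_add tendsto_const) (simp add: add.commute)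
      have "N (s (Suc n)) \<omega> \<le> 0 + N e \<omega>"
      proof (rule LIMSEQ_le_const[OF c], intro exI allI impI)
        fix k show "N (s (Suc n)) \<omega> \<le> D (s (Suc n + k)) e \<omega> + N e \<omega>"
          using elim(1)[rule_format, of "Suc n + k"] elim(3)[rule_format, OF n, of k] by simp
      qed
      with n show ?thesis by simp
    qed
    then show ?case by blast
  qed
  \<comment> \<open>Up to null sets the support of \<open>e\<close> contains all supports of the
    maximizing sequence, so it attains the supremum \<open>m\<close>.\<close>
  have me: "m \<le> prob (supp e)"
  proof (rule field_le_epsilon)
    fix \<epsilon> :: real assume "\<epsilon> > 0"
    then obtain n where "1 / real (Suc n) < \<epsilon>" using nat_approx_posE by metis
    moreover have "prob (supp (xs n)) \<le> prob (supp e)"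
      using pos by (intro finite_measure_mono_AE) (auto simp: supp_def)
    ultimately show "m \<le> prob (supp e) + \<epsilon>" using xm[of n] by linarith
  qed
  have "AE \<omega> in M. N e \<omega> = 0 \<longrightarrow> N x \<omega> = 0" if x [simp]: "x \<in> carrier E" for x
  proof -
    \<comment> \<open>Inserting \<open>x\<close> where \<open>e\<close> vanishes cannot push the
      probability of the support beyond \<open>m\<close>, so the part gained is a null set.\<close>
    define y where "y = gl (supp e) e x"
    have y [simp]: "y \<in> carrier E" by (auto simp: y_def)
    have Ny: "AE \<omega> in M. N y \<omega> = (if \<omega> \<in> supp e then N e \<omega> else N x \<omega>)"
      unfolding y_def by (rule local_fun_gl[OF N_local]) auto
    have "prob (supp e) + prob (supp x - supp e) = prob (supp e \<union> (supp x - supp e))"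
      by (subst finite_measure_Union) auto
    also have "\<dots> \<le> prob (supp y)"
      using Ny by (intro finite_measure_mono_AE) (auto simp: supp_def)
    also have "\<dots> \<le> m" unfolding m_def by (rule cSUP_upper[OF y bdd])
    finally have "prob (supp x - supp e) = 0" using me measure_nonneg[of M "supp x - supp e"] by linarith
    then have "AE \<omega> in M. \<omega> \<notin> supp x - supp e" by (subst (asm) prob_eq_0) auto
    with AE_space show ?thesis
    proof eventually_elim
      case (elim \<omega>) then show ?case using N_nonneg[of x \<omega>] by (auto simp: supp_def)
    qed
  qed
  with e show ?thesis by (rule that)
qed

lemma exists_full_support:
  assumes comp: "rn_complete M E" and full: "full_support M E"
  obtains e where "e \<in> carrier E" "AE \<omega> in M. 0 < N e \<omega>"
proof -
  obtain e where e [simp]: "e \<in> carrier E" and dom: "\<And>x. x \<in> carrier E \<Longrightarrow> AE \<omega> in M. N e \<omega> = 0 \<longrightarrow> N x \<omega> = 0"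
    using exists_dominating_support[OF comp] by blast
  let ?A = "to_ext M ` rnorm E ` carrier E"
  \<comment> \<open>The supremum of all norms: by \<open>dom\<close> every norm vanishes where that
    of \<open>e\<close> does, and elsewhere the multiples of \<open>e\<close> have unbounded
    norm.\<close>
  let ?u = "\<lambda>\<omega>. if 0 < N e \<omega> then \<infinity> else (0::ereal)"
  define U where "U = ae_class M ?u"
  have um [measurable]: "?u \<in> borel_measurable M" by measurable
  have A: "?A = (\<lambda>x. ae_class M (\<lambda>\<omega>. ereal (N x \<omega>))) ` carrier E"
    by (auto simp: rnorm_eq image_iff)
  have upper: "U \<in> Upper (L0_bar M) ?A"
  proof -
    have "cls_le M (ae_class M (\<lambda>\<omega>. ereal (N x \<omega>))) U" if x: "x \<in> carrier E" for x
      unfolding U_def using dom[OF x] x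
      by (subst cls_le_ae_class) (auto elim!: eventually_mono simp: less_le)
    then show ?thesis unfolding Upper_def A by (auto simp: U_def)
  qed
  have "least (L0_bar M) U (Upper (L0_bar M) ?A)"
    unfolding least_def
  proof (intro conjI upper ballI)
    show "Upper (L0_bar M) ?A \<subseteq> carrier (L0_bar M)" by (auto simp: Upper_def)
    fix V assume V: "V \<in> Upper (L0_bar M) ?A"
    then obtain v where v [measurable]: "v \<in> borel_measurable M" and V_eq: "V = ae_class M v"
      by (auto simp: Upper_def elim!: ae_classesE)
    have le: "AE \<omega> in M. ereal (N x \<omega>) \<le> v \<omega>" if x: "x \<in> carrier E" for x
    proof -
      have "cls_le M (ae_class M (\<lambda>\<omega>. ereal (N x \<omega>))) V" using V x unfolding Upper_def A by auto
      then show ?thesis unfolding V_eq using x by (subst (asm) cls_le_ae_class) auto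
    qed
    have "AE \<omega> in M. \<forall>n. ereal (N (sc (\<lambda>_. real n) e) \<omega>) \<le> v \<omega> \<and> N (sc (\<lambda>_. real n) e) \<omega> = \<bar>real n\<bar> * N e \<omega>"
      unfolding AE_all_countable AE_conj_iff by (intro allI conjI le N_sc) auto
    then have "AE \<omega> in M. ?u \<omega> \<le> v \<omega>"
    proof eventually_elim
      case (elim \<omega>)
      show ?case
      proof (cases "0 < N e \<omega>")
        case True
        have "ereal B \<le> v \<omega>" for B
        proof -
          obtain n where "B / N e \<omega> < real n" using reals_Archimedean2 by blast
          then have "B \<le> real n * N e \<omega>" using True by (simp add: field_simps)
          then have "ereal B \<le> ereal (real n * N e \<omega>)" by simp
          also have "\<dots> \<le> v \<omega>" using elim[rule_format, of n] by (metis abs_of_nat)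
          finally show ?thesis .
        qed
        then have "v \<omega> = \<infinity>" by (rule ereal_top)
        then show ?thesis by simp
      next
        case False
        then show ?thesis using elim[rule_format, of 0] by (auto simp: zero_ereal_def)
      qed
    qed
    then show "U \<sqsubseteq>\<^bsub>L0_bar M\<^esub> V" by (simp add: U_def V_eq cls_le_ae_class)
  qed
  \<comment> \<open>The supremum is a Hilbert choice among the least upper bounds, so the existence
    of one suffices to place it below \<open>U\<close>. Its positivity then forces \<open>U\<close>,
    and hence the norm of \<open>e\<close>, to be positive.\<close>
  then have "least (L0_bar M) (\<Squnion>\<^bsub>L0_bar M\<^esub> ?A) (Upper (L0_bar M) ?A)"
    unfolding sup_def by (rule someI)
  then have le: "cls_le M (\<Squnion>\<^bsub>L0_bar M\<^esub> ?A) U"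
    using upper by (auto simp: least_def)
  have "AE \<omega> in M. 0 < rep (\<Squnion>\<^bsub>L0_bar M\<^esub> ?A) \<omega>"
    using full rep_ae_class[of "\<lambda>_. 0::ereal" M] unfolding full_support_def cls_less_def
    by (auto elim: eventually_elim2)
  with le[unfolded cls_le_def] rep_ae_class[OF um, folded U_def] have "AE \<omega> in M. 0 < N e \<omega>"
    by eventually_elim (auto split: if_splits)
  with e show ?thesis by (rule that)
qed

subsection \<open>Stable order automorphisms act on points\<close>

definition ord_auto where
  "ord_auto T \<longleftrightarrow> T \<in> convex_funs M E \<rightarrow> convex_funs M E \<and> stable_op M E T \<and> fully_order_preserving M E T"

lemma ord_auto_closed: "ord_auto T \<Longrightarrow> f \<in> convex_funs M E \<Longrightarrow> T f \<in> convex_funs M E"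
  by (auto simp: ord_auto_def)

lemma ord_auto_le_iff:
  "ord_auto T \<Longrightarrow> f \<in> convex_funs M E \<Longrightarrow> g \<in> convex_funs M E \<Longrightarrow> fun_le M E (T f) (T g) \<longleftrightarrow> fun_le M E f g"
  by (auto simp: ord_auto_def fully_order_preserving_def)

lemma ord_auto_glue:
  "ord_auto T \<Longrightarrow> A \<in> sets M \<Longrightarrow> f \<in> convex_funs M E \<Longrightarrow> g \<in> convex_funs M E \<Longrightarrow>
    T (glue M E A f g) = glue M E A (T f) (T g)"
  by (auto simp: ord_auto_def stable_op_def)

text \<open>Antisymmetry of the order gives injectivity, and stability passes to the inverse because
  \<open>T\<close> maps the gluing of two preimages to the gluing of their values.\<close>

lemma ord_auto_inverse:
  assumes T: "ord_auto T"
  obtains S where "ord_auto S" "\<And>f. f \<in> convex_funs M E \<Longrightarrow> S (T f) = f" "\<And>f. f \<in> convex_funs M E \<Longrightarrow> T (S f) = f"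
proof -
  have inj: "inj_on T (convex_funs M E)"
  proof (rule inj_onI)
    fix f g assume *: "f \<in> convex_funs M E" "g \<in> convex_funs M E" "T f = T g"
    then show "f = g"
      using ord_auto_le_iff[OF T *(1,2)] ord_auto_le_iff[OF T *(2,1)] fun_le_refl
      by (intro fun_le_antisym) auto
  qed
  have img: "T ` convex_funs M E = convex_funs M E"
    using T by (auto simp: ord_auto_def fully_order_preserving_def)
  define S where "S = inv_into (convex_funs M E) T"
  have ST: "S (T f) = f" if "f \<in> convex_funs M E" for f unfolding S_def by (rule inv_into_f_f[OF inj that])
  have TS: "T (S f) = f" if "f \<in> convex_funs M E" for f
    unfolding S_def by (rule f_inv_into_f[of f T]) (simp only: img that)
  have Sc: "S f \<in> convex_funs M E" if "f \<in> convex_funs M E" for f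
    unfolding S_def by (rule inv_into_into) (simp only: img that)
  have "ord_auto S"
    unfolding ord_auto_def
  proof (intro conjI)
    show "S \<in> convex_funs M E \<rightarrow> convex_funs M E" using Sc by blast
    show "fully_order_preserving M E S"
      unfolding fully_order_preserving_def
    proof (intro conjI ballI)
      show "S ` convex_funs M E = convex_funs M E"
        using Sc ST ord_auto_closed[OF T] by (metis equalityI image_subsetI rev_image_eqI subsetI)
      show "fun_le M E f g \<longleftrightarrow> fun_le M E (S f) (S g)"
        if "f \<in> convex_funs M E" "g \<in> convex_funs M E" for f g
        using ord_auto_le_iff[OF T Sc[OF that(1)] Sc[OF that(2)]] TS that by simp
    qed
    show "stable_op M E S"
      unfolding stable_op_def
    proof (intro ballI)
      fix A f g assume *: "A \<in> sets M" "f \<in> convex_funs M E" "g \<in> convex_funs M E"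
      have "T (glue M E A (S f) (S g)) = glue M E A f g"
        using ord_auto_glue[OF T *(1) Sc[OF *(2)] Sc[OF *(3)]] TS * by simp
      then show "S (glue M E A f g) = glue M E A (S f) (S g)"
        using ST[OF glue_convex_funs[OF Sc[OF *(2)] Sc[OF *(3)] *(1)]] by simp
    qed
  qed
  then show ?thesis using ST TS by (rule that)
qed

text \<open>Any two functions above a point function are comparable up to gluing, and this forces
  the effective domain to be a single element.\<close>

lemma ord_auto_pt:
  assumes T: "ord_auto T" and x: "x \<in> carrier E" and r [measurable]: "r \<in> borel_measurable M"
  shows "\<exists>y\<in>carrier E. \<exists>s\<in>borel_measurable M. T (pt x r) = pt y s"
proof -
  obtain S where S: "ord_auto S" and ST: "\<And>f. f \<in> convex_funs M E \<Longrightarrow> S (T f) = f"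
    and TS: "\<And>f. f \<in> convex_funs M E \<Longrightarrow> T (S f) = f" using ord_auto_inverse[OF T] by blast
  let ?F = "T (pt x r)"
  have F: "?F \<in> convex_funs M E" using x by (intro ord_auto_closed[OF T]) auto
  \<comment> \<open>Pulled back by \<open>S\<close>, a point function above \<open>?F\<close> lies
    above \<open>pt x r\<close>. Its effective domain is then \<open>x\<close> alone, so it is a
    point function at \<open>x\<close>.\<close>
  have above: "\<exists>t\<in>borel_measurable M. S (pt y s) = pt x t"
    if y: "y \<in> carrier E" and s [measurable]: "s \<in> borel_measurable M"
      and le: "AE \<omega> in M. rep (?F y) \<omega> \<le> ereal (s \<omega>)" for y s
  proof -
    let ?g = "S (pt y s)"
    have g: "?g \<in> convex_funs M E" using y by (intro ord_auto_closed[OF S]) auto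
    have "fun_le M E ?F (pt y s)" using le le_pt_iff[OF F s y] by simp
    then have "fun_le M E (S ?F) ?g" using ord_auto_le_iff[OF S F] y by simp
    then have xg: "fun_le M E (pt x r) ?g" using ST x by simp
    obtain d where d: "d \<in> carrier E" "AE \<omega> in M. rep (?g d) \<omega> < \<infinity>" using g by (rule convex_funs_dom)
    have fin: "z = x" if z: "z \<in> carrier E" and "AE \<omega> in M. rep (?g z) \<omega> < \<infinity>" for z
    proof (rule D_zeroD[OF z x])
      have "AE \<omega> in M. rep (pt x r z) \<omega> \<le> rep (?g z) \<omega>" using xg z by (auto simp: fun_le_iff)
      with that(2) rep_pt[OF r x z] show "AE \<omega> in M. D z x \<omega> = 0"
        by eventually_elim (auto split: if_splits)
    qed
    then have dx: "d = x" using d by blast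
    note gm [measurable] = convex_funs_measurable[OF g x]
    define t where "t \<omega> = real_of_ereal (rep (?g x) \<omega>)" for \<omega>
    have t [measurable]: "t \<in> borel_measurable M" unfolding t_def by measurable
    have gt: "AE \<omega> in M. rep (?g x) \<omega> = ereal (t \<omega>)"
      using d(2) convex_funs_proper[OF g x] unfolding dx by eventually_elim (auto simp: t_def ereal_real)
    have "?g = pt x t"
    proof (rule fun_le_antisym[OF g])
      show "fun_le M E ?g (pt x t)" unfolding le_pt_iff[OF g t x] using gt by eventually_elim simp
      show "fun_le M E (pt x t) ?g" unfolding fun_le_iff
      proof
        fix z assume z: "z \<in> carrier E"
        show "AE \<omega> in M. rep (pt x t z) \<omega> \<le> rep (?g z) \<omega>"
        proof (rule le_of_epi[where d = x])
          show "local_fun (\<lambda>z. rep (pt x t z))" using x by (intro convex_funs_local) auto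
          show "local_fun (\<lambda>z. rep (?g z))" by (rule convex_funs_local[OF g])
          show "AE \<omega> in M. rep (?g x) \<omega> < \<infinity>" using gt by eventually_elim simp
          fix u q assume u: "u \<in> carrier E" and q [measurable]: "q \<in> borel_measurable M"
            and le: "AE \<omega> in M. rep (?g u) \<omega> \<le> ereal (q \<omega>)"
          have "u = x" using le by (intro fin[OF u]) (auto elim!: eventually_mono simp: less_top[symmetric])
          then show "AE \<omega> in M. rep (pt x t u) \<omega> \<le> ereal (q \<omega>)"
            using le gt rep_pt_self[OF t x] by (auto elim: eventually_elim2)
        qed (use convex_funs_measurable[OF g] convex_funs_proper[OF g] x z in auto)
      qed
    qed (use x in auto)
    then show ?thesis using t by blast
  qed
  have unique: "y = z" if y: "y \<in> carrier E" and s [measurable]: "s \<in> borel_measurable M"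
      and z: "z \<in> carrier E" and q [measurable]: "q \<in> borel_measurable M"
      and le: "AE \<omega> in M. rep (?F y) \<omega> \<le> ereal (s \<omega>)" "AE \<omega> in M. rep (?F z) \<omega> \<le> ereal (q \<omega>)" for y s z q
  proof -
    obtain t where t [measurable]: "t \<in> borel_measurable M" and st: "S (pt y s) = pt x t"
      using above[OF y s le(1)] by blast
    obtain u where u [measurable]: "u \<in> borel_measurable M" and su: "S (pt z q) = pt x u"
      using above[OF z q le(2)] by blast
    \<comment> \<open>Two point functions at the same \<open>x\<close> become comparable once their
      heights are sorted into minimum and maximum along \<open>A\<close>. Stability carries the
      comparison to \<open>y\<close> and \<open>z\<close>, where it says
      \<open>gl A y z = gl A z y\<close>, that is, \<open>y = z\<close> on \<open>A\<close> and off
      \<open>A\<close>.\<close>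
    define A where "A = {\<omega> \<in> space M. t \<omega> \<le> u \<omega>}"
    have A [measurable]: "A \<in> sets M" unfolding A_def by measurable
    have xx: "gl A x x = x" unfolding gl_def using x by (intro lc_same) auto
    have "fun_le M E (pt x (\<lambda>\<omega>. if \<omega> \<in> A then t \<omega> else u \<omega>)) (pt x (\<lambda>\<omega>. if \<omega> \<in> A then u \<omega> else t \<omega>))"
      using x AE_space by (subst pt_le_pt_iff) (auto simp: A_def elim!: eventually_mono)
    then have "fun_le M E (glue M E A (S (pt y s)) (S (pt z q))) (glue M E A (S (pt z q)) (S (pt y s)))"
      unfolding st su glue_pt[OF t u x x A] glue_pt[OF u t x x A] xx .
    then have "fun_le M E (S (glue M E A (pt y s) (pt z q))) (S (glue M E A (pt z q) (pt y s)))"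
      using ord_auto_glue[OF S A] y z by simp
    then have "fun_le M E (glue M E A (pt y s) (pt z q)) (glue M E A (pt z q) (pt y s))"
      using y z by (subst (asm) ord_auto_le_iff[OF S]) (auto intro!: glue_convex_funs)
    then have "gl A y z = gl A z y"
      unfolding glue_pt[OF s q y z A] glue_pt[OF q s z y A] using y z
      by (subst (asm) pt_le_pt_iff) auto
    then show "y = z"
    proof (intro D_zeroD[OF y z])
      assume eq: "gl A y z = gl A z y"
      show "AE \<omega> in M. D y z \<omega> = 0"
        using gl_left[OF A y z] gl_right[OF A y z] gl_left[OF A z y] gl_right[OF A z y]
          D_triangle[OF y gl_closed[OF A y z] z] D_commute[OF y gl_closed[OF A y z]] unfolding eq
      proof eventually_elim
        case (elim \<omega>) then show ?case using D_nonneg[of y z \<omega>] by (cases "\<omega> \<in> A") auto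
      qed
    qed
  qed
  obtain d where d: "d \<in> carrier E" "AE \<omega> in M. rep (?F d) \<omega> < \<infinity>" using F by (rule convex_funs_dom)
  note Fm [measurable] = convex_funs_measurable[OF F d(1)]
  define t where "t \<omega> = real_of_ereal (rep (?F d) \<omega>)" for \<omega>
  have t [measurable]: "t \<in> borel_measurable M" unfolding t_def by measurable
  have Ft: "AE \<omega> in M. rep (?F d) \<omega> = ereal (t \<omega>)"
    using d(2) convex_funs_proper[OF F d(1)] by eventually_elim (auto simp: t_def ereal_real)
  have "?F = pt d t"
  proof (rule fun_le_antisym[OF F])
    show "fun_le M E ?F (pt d t)" unfolding le_pt_iff[OF F t d(1)] using Ft by eventually_elim simp
    show "fun_le M E (pt d t) ?F" unfolding fun_le_iff
    proof
      fix z assume z: "z \<in> carrier E"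
      show "AE \<omega> in M. rep (pt d t z) \<omega> \<le> rep (?F z) \<omega>"
      proof (rule le_of_epi[where d = d])
        show "local_fun (\<lambda>z. rep (pt d t z))" using d by (intro convex_funs_local) auto
        show "local_fun (\<lambda>z. rep (?F z))" by (rule convex_funs_local[OF F])
        fix u q assume u: "u \<in> carrier E" and q [measurable]: "q \<in> borel_measurable M"
          and le: "AE \<omega> in M. rep (?F u) \<omega> \<le> ereal (q \<omega>)"
        have "AE \<omega> in M. rep (?F d) \<omega> \<le> ereal (t \<omega>)" using Ft by eventually_elim simp
        then have "u = d" using unique[OF u q d(1) t le] by blast
        then show "AE \<omega> in M. rep (pt d t u) \<omega> \<le> ereal (q \<omega>)"
          using le Ft rep_pt_self[OF t d(1)] by (auto elim: eventually_elim2)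
      qed (use convex_funs_measurable[OF F] convex_funs_proper[OF F] d z in auto)
    qed
  qed (use d in auto)
  then show ?thesis using d t by blast
qed

end

section \<open>The point map of a stable order automorphism\<close>

text \<open>With both directions as parameters the setting is symmetric, and \<open>swap\<close>
  gives every result for the inverse too. Points are moved by \<open>S\<close>, because
  \<open>T f \<le> pt x r\<close> is equivalent to \<open>f \<le> S (pt x r)\<close>.\<close>

locale rn_iso = rn_module M E
  for M :: "'w measure" and E :: "(('w \<Rightarrow> real) set, 'e) normed_module" +
  fixes S T :: "('e \<Rightarrow> ('w \<Rightarrow> ereal) set) \<Rightarrow> 'e \<Rightarrow> ('w \<Rightarrow> ereal) set"
  assumes S: "ord_auto S" and T: "ord_auto T"
    and ST: "\<And>f. f \<in> convex_funs M E \<Longrightarrow> S (T f) = f"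
    and TS: "\<And>f. f \<in> convex_funs M E \<Longrightarrow> T (S f) = f"
begin

lemma swap: "rn_iso M E T S"
  using S T ST TS by unfold_locales

text \<open>Defined through the height 0; by \<open>S_pt_ex\<close> the image element is the same
  for every height.\<close>

definition phi :: "'e \<Rightarrow> 'e" where
  "phi x = (SOME y. y \<in> carrier E \<and> (\<exists>s\<in>borel_measurable M. S (pt x (\<lambda>_. 0)) = pt y s))"

definition psi :: "'e \<Rightarrow> ('w \<Rightarrow> real) \<Rightarrow> 'w \<Rightarrow> real" where
  "psi x r = (SOME s. s \<in> borel_measurable M \<and> S (pt x r) = pt (phi x) s)"

lemma S_pt_ex:
  assumes x: "x \<in> carrier E" and r [measurable]: "r \<in> borel_measurable M"
  shows "phi x \<in> carrier E \<and> (\<exists>s\<in>borel_measurable M. S (pt x r) = pt (phi x) s)"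
proof -
  have "phi x \<in> carrier E \<and> (\<exists>s\<in>borel_measurable M. S (pt x (\<lambda>_. 0)) = pt (phi x) s)"
    unfolding phi_def by (rule someI_ex) (use ord_auto_pt[OF S x, of "\<lambda>_. 0"] in auto)
  then obtain s where p: "phi x \<in> carrier E" and s [measurable]: "s \<in> borel_measurable M"
    and Ss: "S (pt x (\<lambda>_. 0)) = pt (phi x) s" by blast
  obtain y t where y: "y \<in> carrier E" and t [measurable]: "t \<in> borel_measurable M"
    and St: "S (pt x r) = pt y t" using ord_auto_pt[OF S x r] by blast
  \<comment> \<open>The point function of height \<open>min r 0\<close> lies below those of heights
    \<open>r\<close> and 0, and comparable point functions sit at the same element.\<close>
  let ?m = "\<lambda>\<omega>. min (r \<omega>) 0"
  have m [measurable]: "?m \<in> borel_measurable M" by measurable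
  obtain z u where z: "z \<in> carrier E" and u [measurable]: "u \<in> borel_measurable M"
    and Su: "S (pt x ?m) = pt z u" using ord_auto_pt[OF S x m] by blast
  have "fun_le M E (S (pt x ?m)) (S (pt x r))" "fun_le M E (S (pt x ?m)) (S (pt x (\<lambda>_. 0)))"
    using x by (simp_all add: ord_auto_le_iff[OF S] pt_le_pt_iff)
  then have "z = y" "z = phi x"
    unfolding Ss St Su using y z p by (simp_all add: pt_le_pt_iff)
  then show ?thesis using St p t by blast
qed

lemma phi_closed [simp, intro]: "x \<in> carrier E \<Longrightarrow> phi x \<in> carrier E"
  using S_pt_ex[of x "\<lambda>_. 0"] by simp

lemma psi_measurable [measurable]: "x \<in> carrier E \<Longrightarrow> r \<in> borel_measurable M \<Longrightarrow> psi x r \<in> borel_measurable M"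
  and S_pt: "x \<in> carrier E \<Longrightarrow> r \<in> borel_measurable M \<Longrightarrow> S (pt x r) = pt (phi x) (psi x r)"
proof -
  have "psi x r \<in> borel_measurable M \<and> S (pt x r) = pt (phi x) (psi x r)"
    if "x \<in> carrier E" "r \<in> borel_measurable M"
  proof -
    have "\<exists>s. s \<in> borel_measurable M \<and> S (pt x r) = pt (phi x) s" using S_pt_ex[OF that] by blast
    from someI_ex[OF this] show ?thesis unfolding psi_def .
  qed
  then show "x \<in> carrier E \<Longrightarrow> r \<in> borel_measurable M \<Longrightarrow> psi x r \<in> borel_measurable M"
    "x \<in> carrier E \<Longrightarrow> r \<in> borel_measurable M \<Longrightarrow> S (pt x r) = pt (phi x) (psi x r)" by blast+
qed

lemma phi_inverse:
  assumes x [simp]: "x \<in> carrier E"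
  shows "rn_iso.phi M E T (phi x) = x"
proof -
  interpret inv: rn_iso M E T S by (rule swap)
  have "T (S (pt x (\<lambda>_. 0))) = pt x (\<lambda>_. 0)" by (rule TS) simp
  then have "pt (inv.phi (phi x)) (inv.psi (phi x) (psi x (\<lambda>_. 0))) = pt x (\<lambda>_. 0)"
    by (simp add: S_pt inv.S_pt)
  then show ?thesis by (subst (asm) pt_eq_iff) auto
qed

lemma psi_inverse:
  assumes x [simp]: "x \<in> carrier E" and r [measurable]: "r \<in> borel_measurable M"
  shows "AE \<omega> in M. rn_iso.psi M E T (phi x) (psi x r) \<omega> = r \<omega>"
proof -
  interpret inv: rn_iso M E T S by (rule swap)
  have "T (S (pt x r)) = pt x r" by (rule TS) simp
  then have "pt (inv.phi (phi x)) (inv.psi (phi x) (psi x r)) = pt x r"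
    by (simp add: S_pt inv.S_pt)
  then show ?thesis by (subst (asm) pt_eq_iff) auto
qed

text \<open>Gluing \<open>r\<close> with \<open>s\<close> along the set where
  \<open>r \<le> s\<close> makes them comparable everywhere; stability lets \<open>psi\<close> act
  on each piece.\<close>

lemma psi_mono_local:
  assumes x [simp]: "x \<in> carrier E" and r [measurable]: "r \<in> borel_measurable M"
    and s [measurable]: "s \<in> borel_measurable M"
  shows "AE \<omega> in M. r \<omega> \<le> s \<omega> \<longrightarrow> psi x r \<omega> \<le> psi x s \<omega>"
proof -
  define A where "A = {\<omega> \<in> space M. r \<omega> \<le> s \<omega>}"
  have A [measurable]: "A \<in> sets M" unfolding A_def by measurable
  have xx: "gl A y y = y" if "y \<in> carrier E" for y
    unfolding gl_def using that by (intro lc_same) auto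
  let ?m = "\<lambda>\<omega>. if \<omega> \<in> A then r \<omega> else s \<omega>"
  have m [measurable]: "?m \<in> borel_measurable M" by measurable
  have "S (glue M E A (pt x r) (pt x s)) = glue M E A (S (pt x r)) (S (pt x s))"
    by (intro ord_auto_glue[OF S]) auto
  then have Sm: "S (pt x ?m) = pt (phi x) (\<lambda>\<omega>. if \<omega> \<in> A then psi x r \<omega> else psi x s \<omega>)"
    by (simp add: glue_pt S_pt xx)
  have "fun_le M E (S (pt x ?m)) (S (pt x s))"
    using AE_space by (subst ord_auto_le_iff[OF S]) (auto simp: pt_le_pt_iff A_def elim!: eventually_mono)
  then have "AE \<omega> in M. (if \<omega> \<in> A then psi x r \<omega> else psi x s \<omega>) \<le> psi x s \<omega>"
    unfolding Sm by (simp add: S_pt pt_le_pt_iff)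
  with AE_space show ?thesis by eventually_elim (auto simp: A_def split: if_splits)
qed

lemma psi_reflect_local:
  assumes x [simp]: "x \<in> carrier E" and r [measurable]: "r \<in> borel_measurable M"
    and s [measurable]: "s \<in> borel_measurable M"
  shows "AE \<omega> in M. psi x r \<omega> \<le> psi x s \<omega> \<longrightarrow> r \<omega> \<le> s \<omega>"
proof -
  interpret inv: rn_iso M E T S by (rule swap)
  have "AE \<omega> in M. psi x r \<omega> \<le> psi x s \<omega> \<longrightarrow> inv.psi (phi x) (psi x r) \<omega> \<le> inv.psi (phi x) (psi x s) \<omega>"
    by (rule inv.psi_mono_local) auto
  with psi_inverse[OF x r] psi_inverse[OF x s] show ?thesis by eventually_elim simp
qed

text \<open>Gluing \<open>pt x r\<close> into \<open>pt y r\<close> on the set where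
  \<open>x\<close> and \<open>y\<close> agree changes nothing, and by stability the same holds for
  the images.\<close>

lemma phi_psi_local:
  assumes xy [simp]: "x \<in> carrier E" "y \<in> carrier E" and r [measurable]: "r \<in> borel_measurable M"
  shows "AE \<omega> in M. D x y \<omega> = 0 \<longrightarrow> D (phi x) (phi y) \<omega> = 0 \<and> psi x r \<omega> = psi y r \<omega>"
proof -
  define A where "A = {\<omega> \<in> space M. D x y \<omega> = 0}"
  have A [measurable]: "A \<in> sets M" unfolding A_def by measurable
  have g: "gl A x y = y" by (rule eq_glI) (use D_self[of y] in \<open>auto simp: A_def\<close>)
  have "glue M E A (pt x r) (pt y r) = pt y r" using glue_pt[OF r r xy A] by (simp add: g)
  then have "S (pt y r) = glue M E A (S (pt x r)) (S (pt y r))"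
    using ord_auto_glue[OF S A, of "pt x r" "pt y r"] by simp
  then have "pt (phi y) (psi y r) = pt (gl A (phi x) (phi y)) (\<lambda>\<omega>. if \<omega> \<in> A then psi x r \<omega> else psi y r \<omega>)"
    by (simp add: S_pt glue_pt)
  then have eq: "phi y = gl A (phi x) (phi y)" and "AE \<omega> in M. psi y r \<omega> = (if \<omega> \<in> A then psi x r \<omega> else psi y r \<omega>)"
    by (subst (asm) pt_eq_iff; simp)+
  with gl_left[OF A phi_closed[OF xy(1)] phi_closed[OF xy(2)]] D_commute[OF phi_closed[OF xy(1)] phi_closed[OF xy(2)]] AE_space
  show ?thesis unfolding eq[symmetric] by (elim AE_mp) (auto simp: A_def intro!: AE_I2)
qed

lemma sep_phi:
  assumes "sep x y" and xy [simp]: "x \<in> carrier E" "y \<in> carrier E"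
  shows "sep (phi x) (phi y)"
proof -
  interpret inv: rn_iso M E T S by (rule swap)
  have "AE \<omega> in M. D (phi x) (phi y) \<omega> = 0 \<longrightarrow> D x y \<omega> = 0"
    using inv.phi_psi_local[of "phi x" "phi y" "\<lambda>_. 0"] by (auto simp: phi_inverse elim: eventually_mono)
  with assms(1)[unfolded sep_def] show ?thesis unfolding sep_def
  proof eventually_elim
    case (elim \<omega>)
    then show ?case using D_nonneg[of "phi x" "phi y" \<omega>] by linarith
  qed
qed

text \<open>The order condition of \<open>between_iff\<close> is transported by replacing a test
  function \<open>f\<close> below the images with \<open>T f\<close>. At this stage the weight
  \<open>b\<close> may still depend on the heights, and only an inequality comes out.\<close>

lemma S_between:
  assumes sep: "sep x y" and xy [simp]: "x \<in> carrier E" "y \<in> carrier E"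
    and a [measurable]: "a \<in> borel_measurable M" and a01: "AE \<omega> in M. 0 \<le> a \<omega>" "AE \<omega> in M. a \<omega> \<le> 1"
    and r [measurable]: "r \<in> borel_measurable M" and s [measurable]: "s \<in> borel_measurable M"
    and t [measurable]: "t \<in> borel_measurable M" and le: "AE \<omega> in M. a \<omega> * r \<omega> + (1 - a \<omega>) * s \<omega> \<le> t \<omega>"
  shows "\<exists>b\<in>borel_measurable M. (AE \<omega> in M. 0 \<le> b \<omega>) \<and> (AE \<omega> in M. b \<omega> \<le> 1) \<and>
    phi (lc a x (\<lambda>\<omega>. 1 - a \<omega>) y) = lc b (phi x) (\<lambda>\<omega>. 1 - b \<omega>) (phi y) \<and>
    (AE \<omega> in M. b \<omega> * psi x r \<omega> + (1 - b \<omega>) * psi y s \<omega> \<le> psi (lc a x (\<lambda>\<omega>. 1 - a \<omega>) y) t \<omega>)"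
proof -
  let ?z = "lc a x (\<lambda>\<omega>. 1 - a \<omega>) y"
  have z [simp]: "?z \<in> carrier E" by auto
  have "\<forall>f\<in>convex_funs M E. fun_le M E f (pt x r) \<and> fun_le M E f (pt y s) \<longrightarrow> fun_le M E f (pt ?z t)"
    by (subst between_iff[OF sep xy z r s t]) (use a a01 le in blast)
  then have *: "fun_le M E f (pt ?z t)" if "f \<in> convex_funs M E" "fun_le M E f (pt x r)" "fun_le M E f (pt y s)" for f
    using that by blast
  have "\<forall>f\<in>convex_funs M E. fun_le M E f (pt (phi x) (psi x r)) \<and> fun_le M E f (pt (phi y) (psi y s))
      \<longrightarrow> fun_le M E f (pt (phi ?z) (psi ?z t))"
  proof (intro ballI impI)
    fix f assume f: "f \<in> convex_funs M E"
      and le: "fun_le M E f (pt (phi x) (psi x r)) \<and> fun_le M E f (pt (phi y) (psi y s))"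
    have Tf: "T f \<in> convex_funs M E" using f by (rule ord_auto_closed[OF T])
    have iff: "fun_le M E f (S g) \<longleftrightarrow> fun_le M E (T f) g" if "g \<in> convex_funs M E" for g
      using ord_auto_le_iff[OF S Tf that] ST[OF f] by simp
    have "fun_le M E (T f) (pt x r)" "fun_le M E (T f) (pt y s)"
      using le by (simp_all add: S_pt[symmetric] iff)
    then have "fun_le M E (T f) (pt ?z t)" by (rule *[OF Tf])
    then show "fun_le M E f (pt (phi ?z) (psi ?z t))" by (simp add: S_pt[symmetric] iff)
  qed
  then show ?thesis
    by (subst (asm) between_iff[OF sep_phi[OF sep xy]]) auto
qed

lemma between_eq:
  assumes sep: "sep x y" and xy [simp]: "x \<in> carrier E" "y \<in> carrier E"
    and a [measurable]: "a \<in> borel_measurable M" and a01: "AE \<omega> in M. 0 \<le> a \<omega>" "AE \<omega> in M. a \<omega> \<le> 1"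
    and zz: "lc a x (\<lambda>\<omega>. 1 - a \<omega>) y = z"
  obtains b where "b \<in> borel_measurable M" "AE \<omega> in M. 0 \<le> b \<omega>" "AE \<omega> in M. b \<omega> \<le> 1"
    "phi z = lc b (phi x) (\<lambda>\<omega>. 1 - b \<omega>) (phi y)"
    "\<And>r s. r \<in> borel_measurable M \<Longrightarrow> s \<in> borel_measurable M \<Longrightarrow>
      AE \<omega> in M. psi z (\<lambda>\<omega>. a \<omega> * r \<omega> + (1 - a \<omega>) * s \<omega>) \<omega>
        = b \<omega> * psi x r \<omega> + (1 - b \<omega>) * psi y s \<omega>"
proof -
  interpret inv: rn_iso M E T S by (rule swap)
  let ?z = "lc a x (\<lambda>\<omega>. 1 - a \<omega>) y"
  have z [simp]: "?z \<in> carrier E" by auto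
  note that = that[unfolded zz[symmetric]]
  have one: "\<exists>b\<in>borel_measurable M. (AE \<omega> in M. 0 \<le> b \<omega>) \<and> (AE \<omega> in M. b \<omega> \<le> 1) \<and>
    phi ?z = lc b (phi x) (\<lambda>\<omega>. 1 - b \<omega>) (phi y) \<and>
    (AE \<omega> in M. psi ?z (\<lambda>\<omega>. a \<omega> * r \<omega> + (1 - a \<omega>) * s \<omega>) \<omega> = b \<omega> * psi x r \<omega> + (1 - b \<omega>) * psi y s \<omega>)"
    if r [measurable]: "r \<in> borel_measurable M" and s [measurable]: "s \<in> borel_measurable M" for r s
  proof -
    let ?t = "\<lambda>\<omega>. a \<omega> * r \<omega> + (1 - a \<omega>) * s \<omega>"
    have t [measurable]: "?t \<in> borel_measurable M" by measurable
    obtain b where b [measurable]: "b \<in> borel_measurable M" and b01: "AE \<omega> in M. 0 \<le> b \<omega>" "AE \<omega> in M. b \<omega> \<le> 1"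
      and pz: "phi ?z = lc b (phi x) (\<lambda>\<omega>. 1 - b \<omega>) (phi y)"
      and le: "AE \<omega> in M. b \<omega> * psi x r \<omega> + (1 - b \<omega>) * psi y s \<omega> \<le> psi ?z ?t \<omega>"
      using S_between[OF sep xy a a01 r s t] by auto
    let ?v = "\<lambda>\<omega>. b \<omega> * psi x r \<omega> + (1 - b \<omega>) * psi y s \<omega>"
    have pm [measurable]: "psi x r \<in> borel_measurable M" "psi y s \<in> borel_measurable M" by auto
    have v [measurable]: "?v \<in> borel_measurable M" by measurable
    \<comment> \<open>The inverse map, applied to the image point at height \<open>?v\<close>,
      returns a weight \<open>c\<close> for the original point. By uniqueness \<open>c = a\<close>,
      which yields the reverse inequality.\<close>
    obtain c where c [measurable]: "c \<in> borel_measurable M" and c01: "AE \<omega> in M. 0 \<le> c \<omega>" "AE \<omega> in M. c \<omega> \<le> 1"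
      and "inv.phi (lc b (phi x) (\<lambda>\<omega>. 1 - b \<omega>) (phi y)) = lc c (inv.phi (phi x)) (\<lambda>\<omega>. 1 - c \<omega>) (inv.phi (phi y))"
      and "AE \<omega> in M. c \<omega> * inv.psi (phi x) (psi x r) \<omega> + (1 - c \<omega>) * inv.psi (phi y) (psi y s) \<omega>
        \<le> inv.psi (lc b (phi x) (\<lambda>\<omega>. 1 - b \<omega>) (phi y)) ?v \<omega>"
      using inv.S_between[OF sep_phi[OF sep xy] phi_closed[OF xy(1)] phi_closed[OF xy(2)] b b01 pm v] by auto
    then have zc: "?z = lc c x (\<lambda>\<omega>. 1 - c \<omega>) y"
      and le2: "AE \<omega> in M. c \<omega> * inv.psi (phi x) (psi x r) \<omega> + (1 - c \<omega>) * inv.psi (phi y) (psi y s) \<omega>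
        \<le> inv.psi (phi ?z) ?v \<omega>"
      unfolding pz[symmetric] by (simp_all add: phi_inverse)
    have "AE \<omega> in M. a \<omega> = c \<omega>" by (rule lc_weight_unique[OF sep xy a a01(1) c c01(1) zc])
    with le2 psi_inverse[OF xy(1) r] psi_inverse[OF xy(2) s]
    have "AE \<omega> in M. ?t \<omega> \<le> inv.psi (phi ?z) ?v \<omega>" by eventually_elim simp
    moreover have im: "inv.psi (phi ?z) ?v \<in> borel_measurable M" by (rule inv.psi_measurable) auto
    ultimately have "AE \<omega> in M. psi ?z ?t \<omega> \<le> psi ?z (inv.psi (phi ?z) ?v) \<omega>"
      using psi_mono_local[OF z t im] by (elim AE_mp) auto
    moreover have "AE \<omega> in M. psi (inv.phi (phi ?z)) (inv.psi (phi ?z) ?v) \<omega> = ?v \<omega>"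
      using inv.psi_inverse[of "phi ?z" ?v] v by simp
    ultimately have "AE \<omega> in M. psi ?z ?t \<omega> = ?v \<omega>"
      using le unfolding phi_inverse[OF z] by eventually_elim simp
    then show ?thesis using b b01 pz by blast
  qed
  obtain b where b: "b \<in> borel_measurable M" "AE \<omega> in M. 0 \<le> b \<omega>" "AE \<omega> in M. b \<omega> \<le> 1"
      "phi ?z = lc b (phi x) (\<lambda>\<omega>. 1 - b \<omega>) (phi y)"
    using one[of "\<lambda>_. 0" "\<lambda>_. 0"] by auto
  show ?thesis
  proof (rule that[OF b])
    fix r s :: "'w \<Rightarrow> real" assume rs: "r \<in> borel_measurable M" "s \<in> borel_measurable M"
    obtain c where c: "c \<in> borel_measurable M" "AE \<omega> in M. 0 \<le> c \<omega>" "phi ?z = lc c (phi x) (\<lambda>\<omega>. 1 - c \<omega>) (phi y)"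
      and eq: "AE \<omega> in M. psi ?z (\<lambda>\<omega>. a \<omega> * r \<omega> + (1 - a \<omega>) * s \<omega>) \<omega> = c \<omega> * psi x r \<omega> + (1 - c \<omega>) * psi y s \<omega>"
      using one[OF rs] by blast
    \<comment> \<open>The element \<open>phi ?z\<close> does not involve the heights and determines
      the weight, so one \<open>b\<close> serves all heights.\<close>
    have "AE \<omega> in M. b \<omega> = c \<omega>"
      using b c by (intro lc_weight_unique[OF sep_phi[OF sep xy]]) auto
    with eq show "AE \<omega> in M. psi ?z (\<lambda>\<omega>. a \<omega> * r \<omega> + (1 - a \<omega>) * s \<omega>) \<omega> = b \<omega> * psi x r \<omega> + (1 - b \<omega>) * psi y s \<omega>"
      by eventually_elim simp
  qed
qed

end

subsection \<open>Additive monotone local maps\<close>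

text \<open>Cauchy's equation at each \<open>\<omega>\<close>: additivity gives homogeneity over the
  rationals, and monotonicity squeezes \<open>u \<omega>\<close> between rationals. Only rational
  constants occur, so the exceptional null sets can be united.\<close>

lemma additive_mono_local_linear:
  fixes G :: "('w \<Rightarrow> real) \<Rightarrow> 'w \<Rightarrow> real"
  assumes mono: "\<And>u v. u \<in> borel_measurable M \<Longrightarrow> v \<in> borel_measurable M \<Longrightarrow> AE \<omega> in M. u \<omega> \<le> v \<omega> \<longrightarrow> G u \<omega> \<le> G v \<omega>"
    and add: "\<And>u v. u \<in> borel_measurable M \<Longrightarrow> v \<in> borel_measurable M \<Longrightarrow> AE \<omega> in M. G (\<lambda>\<omega>. u \<omega> + v \<omega>) \<omega> = G u \<omega> + G v \<omega>"
    and u: "u \<in> borel_measurable M"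
  shows "AE \<omega> in M. G u \<omega> = u \<omega> * G (\<lambda>_. 1) \<omega>"
proof -
  let ?G = "\<lambda>c. G (\<lambda>_. c)"
  have add': "AE \<omega> in M. \<forall>c d :: rat. ?G (of_rat c + of_rat d) \<omega> = ?G (of_rat c) \<omega> + ?G (of_rat d) \<omega>"
    unfolding AE_all_countable by (intro allI add) auto
  have const: "AE \<omega> in M. \<forall>q::rat. ?G (of_rat q) \<omega> = of_rat q * ?G 1 \<omega>"
    using add'
  proof eventually_elim
    case (elim \<omega>)
    define g where "g c = ?G (of_rat c) \<omega>" for c :: rat
    have ga: "g (c + d) = g c + g d" for c d using elim by (simp add: g_def of_rat_add)
    have g0: "g 0 = 0" using ga[of 0 0] by simp
    have gn: "g (of_nat n * c) = of_nat n * g c" for n c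
      by (induction n) (simp_all add: g0 ga algebra_simps)
    have gm: "g (- c) = - g c" for c using ga[of c "- c"] g0 by simp
    have gi: "g (of_int i * c) = of_int i * g c" for i c
    proof (cases i)
      case (nonneg n) then show ?thesis using gn[of n c] by simp
    next
      case (neg n) 
      then have "of_int i * c = - (of_nat (Suc n) * c)" and i: "real_of_int i = - of_nat (Suc n)"
        unfolding neg by (simp_all add: algebra_simps)
      then have "g (of_int i * c) = - g (of_nat (Suc n) * c)" by (simp only: gm)
      also have "\<dots> = - (of_nat (Suc n) * g c)" by (simp only: gn)
      finally show ?thesis by (simp only: i minus_mult_left)
    qed
    have "g q = of_rat q * g 1" for q
    proof -
      obtain a b where q: "quotient_of q = (a, b)" by (cases "quotient_of q")
      have b: "b > 0" and qe: "q = of_int a / of_int b"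
        using quotient_of_denom_pos[OF q] quotient_of_div[OF q] by auto
      have "of_int b * g q = g (of_int b * q)" by (simp add: gi)
      also have "of_int b * q = of_int a * 1" using b by (simp add: qe)
      also have "g \<dots> = of_int a * g 1" by (rule gi)
      finally show ?thesis using b by (simp add: qe of_rat_divide field_simps)
    qed
    then show ?case by (simp add: g_def)
  qed
  have up: "AE \<omega> in M. \<forall>q::rat. (of_rat q \<le> u \<omega> \<longrightarrow> ?G (of_rat q) \<omega> \<le> G u \<omega>) \<and> (u \<omega> \<le> of_rat q \<longrightarrow> G u \<omega> \<le> ?G (of_rat q) \<omega>)"
    unfolding AE_all_countable AE_conj_iff using mono u by auto
  have "AE \<omega> in M. 0 \<le> (1::real) \<longrightarrow> ?G 0 \<omega> \<le> ?G 1 \<omega>" using mono[of "\<lambda>_. 0" "\<lambda>_. 1"] by simp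
  then show ?thesis using const up
  proof eventually_elim
    case (elim \<omega>)
    define g where "g = ?G 1 \<omega>"
    have g: "0 \<le> g" using elim(1) elim(2)[rule_format, of 0] by (simp add: g_def)
    have lo: "of_rat q * g \<le> G u \<omega>" if "of_rat q \<le> u \<omega>" for q
      using elim(2,3) that by (simp add: g_def)
    have hi: "G u \<omega> \<le> of_rat q * g" if "u \<omega> \<le> of_rat q" for q
      using elim(2,3) that by (simp add: g_def)
    have "G u \<omega> = u \<omega> * g"
    \<comment> \<open>The squeeze divides by \<open>g\<close>; for \<open>g = 0\<close> the rational
      bounds on either side are both 0.\<close>
    proof (cases "g = 0")
      case True
      obtain q q' where "of_rat q < u \<omega>" "u \<omega> < of_rat q'"
        using of_rat_dense[of "u \<omega> - 1" "u \<omega>"] of_rat_dense[of "u \<omega>" "u \<omega> + 1"] by auto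
      then show ?thesis using lo[of q] hi[of q'] True by simp
    next
      case False
      then have g: "0 < g" using g by simp
      show ?thesis
      proof (rule ccontr)
        assume "G u \<omega> \<noteq> u \<omega> * g"
        then consider "G u \<omega> / g < u \<omega>" | "u \<omega> < G u \<omega> / g"
          using g by (auto simp: field_simps neq_iff)
        then show False
        proof cases
          case 1
          then obtain q where q: "G u \<omega> / g < of_rat q" "of_rat q < u \<omega>" using of_rat_dense by blast
          then have "of_rat q * g \<le> G u \<omega>" by (intro lo) simp
          with q g show False by (simp add: field_simps)
        next
          case 2
          then obtain q where q: "u \<omega> < of_rat q" "of_rat q < G u \<omega> / g" using of_rat_dense by blast
          then have "G u \<omega> \<le> of_rat q * g" by (intro hi) simp
          with q g show False by (simp add: field_simps)
        qed
      qed
    qed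
    then show ?case by (simp add: g_def)
  qed
qed

section \<open>From affine to linear maps\<close>

context rn_module
begin

lemma sc_null [simp]:
  assumes "a \<in> borel_measurable M" shows "sc a \<zero>\<^bsub>E\<^esub> = \<zero>\<^bsub>E\<^esub>"
  using sc_sc[OF assms borel_measurable_const[where c = 0] M.zero_closed] by simp

text \<open>Affinity is assumed for weights with values in the unit interval. Combinations with the
  origin give homogeneity for such scalars, midpoints give additivity, and the rest is algebra with
  random scalars.\<close>

lemma affine_imp_linear:
  assumes F: "rn_module M F" and g: "\<And>x. x \<in> carrier E \<Longrightarrow> g x \<in> carrier F"
    and aff: "\<And>x y a. \<lbrakk>x \<in> carrier E; y \<in> carrier E; a \<in> borel_measurable M; \<And>\<omega>. 0 \<le> a \<omega>; \<And>\<omega>. a \<omega> \<le> 1\<rbrakk> \<Longrightarrow>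
      g (lc a x (\<lambda>\<omega>. 1 - a \<omega>) y) = rn_module.lc M F a (g x) (\<lambda>\<omega>. 1 - a \<omega>) (g y)"
  defines "h \<equiv> \<lambda>x. g x \<ominus>\<^bsub>F\<^esub> g \<zero>\<^bsub>E\<^esub>"
  shows "x \<in> carrier E \<Longrightarrow> y \<in> carrier E \<Longrightarrow> h (x \<oplus>\<^bsub>E\<^esub> y) = h x \<oplus>\<^bsub>F\<^esub> h y"
    and "\<xi> \<in> ae_classes M \<Longrightarrow> x \<in> carrier E \<Longrightarrow> h (\<xi> \<odot>\<^bsub>E\<^esub> x) = \<xi> \<odot>\<^bsub>F\<^esub> h x"
proof -
  interpret F: rn_module M F by fact
  note [simp] = g
  have h [simp]: "h x \<in> carrier F" if "x \<in> carrier E" for x using that by (simp add: h_def)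
  have h0: "h \<zero>\<^bsub>E\<^esub> = \<zero>\<^bsub>F\<^esub>" using F.M.r_neg[OF g[OF M.zero_closed]] by (simp add: h_def F.M.minus_eq)
  have haff: "h (lc a x (\<lambda>\<omega>. 1 - a \<omega>) y) = F.lc a (h x) (\<lambda>\<omega>. 1 - a \<omega>) (h y)"
    if [simp]: "x \<in> carrier E" "y \<in> carrier E" and a: "a \<in> borel_measurable M" "\<And>\<omega>. 0 \<le> a \<omega>" "\<And>\<omega>. a \<omega> \<le> 1" for x y a
  proof -
    have m: "(\<lambda>\<omega>. 1 - a \<omega>) \<in> borel_measurable M" using a(1) by measurable
    have "h (lc a x (\<lambda>\<omega>. 1 - a \<omega>) y)
      = F.lc (\<lambda>_. 1) (F.lc a (g x) (\<lambda>\<omega>. 1 - a \<omega>) (g y)) (\<lambda>_. - 1) (g \<zero>\<^bsub>E\<^esub>)"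
      using a m by (simp add: h_def aff F.minus_eq_lc)
    also have "\<dots> = F.lc (\<lambda>_. 1) (F.lc a (g x) (\<lambda>\<omega>. 1 - a \<omega>) (g y)) (\<lambda>_. - 1)
        (F.lc a (g \<zero>\<^bsub>E\<^esub>) (\<lambda>\<omega>. 1 - a \<omega>) (g \<zero>\<^bsub>E\<^esub>))"
      using a by (simp add: F.lc_same)
    also have "\<dots> = F.lc a (h x) (\<lambda>\<omega>. 1 - a \<omega>) (h y)"
      using a m by (subst F.lc_diff) (simp_all add: h_def F.minus_eq_lc)
    finally show ?thesis .
  qed
  have hsc: "h (sc a x) = F.sc a (h x)"
    if [simp]: "x \<in> carrier E" and a: "a \<in> borel_measurable M" "\<And>\<omega>. 0 \<le> a \<omega>" "\<And>\<omega>. a \<omega> \<le> 1" for x a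
    using haff[OF that(1) M.zero_closed a] a by (simp add: lc_def F.lc_def h0)
  have two: "F.sc (\<lambda>_. 2) (F.sc (\<lambda>_. 1/2) y) = y" if "y \<in> carrier F" for y
    using that by (simp add: F.sc_sc)
  have add: "h (x \<oplus>\<^bsub>E\<^esub> y) = h x \<oplus>\<^bsub>F\<^esub> h y" if [simp]: "x \<in> carrier E" "y \<in> carrier E" for x y
  proof -
    have "F.sc (\<lambda>_. 1/2) (h (x \<oplus>\<^bsub>E\<^esub> y)) = h (sc (\<lambda>_. 1/2) (x \<oplus>\<^bsub>E\<^esub> y))" by (rule hsc[symmetric]) auto
    also have "sc (\<lambda>_. 1/2) (x \<oplus>\<^bsub>E\<^esub> y) = lc (\<lambda>_. 1/2) x (\<lambda>\<omega>. 1 - 1/2) y" by (simp add: lc_def sc_r_distr)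
    also have "h \<dots> = F.lc (\<lambda>_. 1/2) (h x) (\<lambda>\<omega>. 1 - 1/2) (h y)" by (rule haff) auto
    also have "\<dots> = F.sc (\<lambda>_. 1/2) (h x \<oplus>\<^bsub>F\<^esub> h y)" by (simp add: F.lc_def F.sc_r_distr)
    finally have "F.sc (\<lambda>_. 2) (F.sc (\<lambda>_. 1/2) (h (x \<oplus>\<^bsub>E\<^esub> y))) = F.sc (\<lambda>_. 2) (F.sc (\<lambda>_. 1/2) (h x \<oplus>\<^bsub>F\<^esub> h y))"
      by simp
    then show ?thesis using two by simp
  qed
  have hpos: "h (sc a x) = F.sc a (h x)"
    if [simp]: "x \<in> carrier E" and a [measurable]: "a \<in> borel_measurable M" and a0: "\<And>\<omega>. 0 \<le> a \<omega>" for x a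
  proof -
    \<comment> \<open>Both \<open>1 / (1 + a)\<close> and \<open>a / (1 + a)\<close> take values in
      the unit interval even if \<open>a\<close> is unbounded: the first recovers \<open>x\<close>
      from \<open>(1 + a) x\<close>, the second yields \<open>a x\<close>.\<close>
    let ?k = "\<lambda>\<omega>. 1 / (1 + a \<omega>)" and ?l = "\<lambda>\<omega>. a \<omega> / (1 + a \<omega>)" and ?b = "\<lambda>\<omega>. 1 + a \<omega>"
    have pos: "0 < 1 + a \<omega>" for \<omega> using a0[of \<omega>] by simp
    have [measurable]: "?k \<in> borel_measurable M" "?l \<in> borel_measurable M" "?b \<in> borel_measurable M" by measurable
    have x: "sc ?k (sc ?b x) = x" 
    proof -
      have "(\<lambda>\<omega>. ?k \<omega> * ?b \<omega>) = (\<lambda>_. 1)" using pos by (auto simp: fun_eq_iff less_imp_neq[symmetric])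
      then show ?thesis by (simp add: sc_sc)
    qed
    have "h (sc ?k (sc ?b x)) = F.sc ?k (h (sc ?b x))"
      using pos a0 by (intro hsc) (auto simp: divide_simps)
    then have "F.sc ?b (h x) = F.sc ?b (F.sc ?k (h (sc ?b x)))" by (simp add: x)
    also have "\<dots> = h (sc ?b x)"
    proof -
      have "(\<lambda>\<omega>. ?b \<omega> * ?k \<omega>) = (\<lambda>_. 1)" using pos by (auto simp: fun_eq_iff less_imp_neq[symmetric])
      then show ?thesis by (simp add: F.sc_sc)
    qed
    finally have b: "F.sc ?b (h x) = h (sc ?b x)" .
    have lb: "(\<lambda>\<omega>. ?l \<omega> * ?b \<omega>) = a" using pos by (auto simp: fun_eq_iff less_imp_neq[symmetric])
    have "sc ?l (sc ?b x) = sc a x" using lb by (simp add: sc_sc)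
    moreover have "h (sc ?l (sc ?b x)) = F.sc ?l (h (sc ?b x))"
      using pos a0 by (intro hsc) (auto simp: divide_simps)
    moreover have "F.sc ?l (F.sc ?b (h x)) = F.sc a (h x)" using lb by (simp add: F.sc_sc)
    ultimately show ?thesis using b by simp
  qed
  have neg: "h (\<ominus>\<^bsub>E\<^esub> x) = \<ominus>\<^bsub>F\<^esub> h x" if [simp]: "x \<in> carrier E" for x
  proof -
    have "h (\<ominus>\<^bsub>E\<^esub> x) \<oplus>\<^bsub>F\<^esub> h x = h (\<ominus>\<^bsub>E\<^esub> x \<oplus>\<^bsub>E\<^esub> x)" by (simp only: add M.a_inv_closed that)
    also have "\<dots> = \<zero>\<^bsub>F\<^esub>" by (simp add: M.l_neg h0)
    finally show ?thesis by (intro F.M.minus_equality[symmetric]) auto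
  qed
  have "h (sc a x) = F.sc a (h x)" if [simp]: "x \<in> carrier E" and a [measurable]: "a \<in> borel_measurable M" for x a
  proof -
    let ?p = "\<lambda>\<omega>. max (a \<omega>) 0" and ?n = "\<lambda>\<omega>. max (- a \<omega>) 0"
    have [measurable]: "?p \<in> borel_measurable M" "?n \<in> borel_measurable M" by measurable
    have d: "(\<lambda>\<omega>. ?p \<omega> + - 1 * ?n \<omega>) = a" by (auto simp: fun_eq_iff max_def)
    have "sc a x = sc ?p x \<oplus>\<^bsub>E\<^esub> \<ominus>\<^bsub>E\<^esub> (sc ?n x)"
      using sc_sc[of "\<lambda>_. - 1" ?n x] sc_add[of ?p "\<lambda>\<omega>. - 1 * ?n \<omega>" x] unfolding d by simp
    then have "h (sc a x) = F.sc ?p (h x) \<oplus>\<^bsub>F\<^esub> \<ominus>\<^bsub>F\<^esub> (F.sc ?n (h x))"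
      by (simp add: add neg hpos)
    also have "\<dots> = F.sc a (h x)"
      using F.sc_sc[of "\<lambda>_. - 1" ?n "h x"] F.sc_add[of ?p "\<lambda>\<omega>. - 1 * ?n \<omega>" "h x"] unfolding d by simp
    finally show ?thesis .
  qed
  then show "\<xi> \<in> ae_classes M \<Longrightarrow> x \<in> carrier E \<Longrightarrow> h (\<xi> \<odot>\<^bsub>E\<^esub> x) = \<xi> \<odot>\<^bsub>F\<^esub> h x"
    by (simp add: smult_eq_sc F.smult_eq_sc)
  show "x \<in> carrier E \<Longrightarrow> y \<in> carrier E \<Longrightarrow> h (x \<oplus>\<^bsub>E\<^esub> y) = h x \<oplus>\<^bsub>F\<^esub> h y" by (rule add)
qed

end

context rn_iso
begin

subsection \<open>The point map is affine\<close>

definition tau :: "'e \<Rightarrow> 'w \<Rightarrow> real" where "tau x \<omega> = psi x (\<lambda>_. 1) \<omega> - psi x (\<lambda>_. 0) \<omega>"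

lemma tau_measurable [measurable]: "x \<in> carrier E \<Longrightarrow> tau x \<in> borel_measurable M"
  unfolding tau_def by measurable

lemma tau_pos: "x \<in> carrier E \<Longrightarrow> AE \<omega> in M. 0 < tau x \<omega>"
  using psi_reflect_local[of x "\<lambda>_. 1" "\<lambda>_. 0"] by (auto elim!: eventually_mono simp: tau_def)

lemma psi_eq:
  assumes e [simp]: "e \<in> carrier E" "AE \<omega> in M. 0 < N e \<omega>" and z [simp]: "z \<in> carrier E"
    and u [measurable]: "u \<in> borel_measurable M"
  shows "AE \<omega> in M. psi z u \<omega> = tau z \<omega> * u \<omega> + psi z (\<lambda>_. 0) \<omega>"
proof -
  \<comment> \<open>\<open>z\<close> is the midpoint of \<open>z + e\<close> and
    \<open>z - e\<close>, whose distance \<open>2 * N e\<close> is positive almost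
    everywhere.\<close>
  let ?x = "lc (\<lambda>_. 1) z (\<lambda>_. 1) e" and ?y = "lc (\<lambda>_. 1) z (\<lambda>_. - 1) e"
  have "lc (\<lambda>_. 1) ?x (\<lambda>_. - 1) ?y = sc (\<lambda>_. 2) e" by (subst lc_lc) (simp_all add: lc_def)
  then have D: "AE \<omega> in M. D ?x ?y \<omega> = \<bar>2\<bar> * N e \<omega>" unfolding D_def using N_sc[of "\<lambda>_. 2" e] by simp
  have sep: "sep ?x ?y" unfolding sep_def using D e(2) by eventually_elim simp
  have zz: "lc (\<lambda>_. 1/2) ?x (\<lambda>\<omega>. 1 - 1/2) ?y = z" by (subst lc_lc) (simp_all add: left_eq_lc[symmetric])
  obtain b where b: "b \<in> borel_measurable M"
    and eq: "\<And>r s. r \<in> borel_measurable M \<Longrightarrow> s \<in> borel_measurable M \<Longrightarrow>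
      AE \<omega> in M. psi z (\<lambda>\<omega>. 1/2 * r \<omega> + (1 - 1/2) * s \<omega>) \<omega> = b \<omega> * psi ?x r \<omega> + (1 - b \<omega>) * psi ?y s \<omega>"
    by (rule between_eq[OF sep _ _ _ _ _ zz]) auto
  define G :: "('w \<Rightarrow> real) \<Rightarrow> 'w \<Rightarrow> real" where "G u \<omega> = psi z u \<omega> - psi z (\<lambda>_. 0) \<omega>" for u \<omega>
  have "AE \<omega> in M. G u \<omega> = u \<omega> * G (\<lambda>_. 1) \<omega>"
  proof (rule additive_mono_local_linear[OF _ _ u])
    fix u v :: "'w \<Rightarrow> real"
    assume uv [measurable]: "u \<in> borel_measurable M" "v \<in> borel_measurable M"
    show "AE \<omega> in M. u \<omega> \<le> v \<omega> \<longrightarrow> G u \<omega> \<le> G v \<omega>"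
      using psi_mono_local[OF z uv] by eventually_elim (simp add: G_def)
    \<comment> \<open>Doubled heights cancel the factor 1/2. The four pairs with first height
      \<open>2 * u\<close> or 0 and second height \<open>2 * v\<close> or 0 show that
      \<open>G\<close> is additive, whatever the weight \<open>b\<close> is.\<close>
    have m: "(\<lambda>\<omega>. 2 * u \<omega>) \<in> borel_measurable M" "(\<lambda>\<omega>. 2 * v \<omega>) \<in> borel_measurable M" by measurable
    show "AE \<omega> in M. G (\<lambda>\<omega>. u \<omega> + v \<omega>) \<omega> = G u \<omega> + G v \<omega>"
      using eq[OF m] eq[OF m(1) borel_measurable_const[where c = 0]] eq[OF borel_measurable_const[where c = 0] m(2)]
        eq[OF borel_measurable_const[where c = 0] borel_measurable_const[where c = 0]]
      by eventually_elim (simp add: G_def)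
  qed
  then show ?thesis by eventually_elim (simp add: G_def tau_def algebra_simps)
qed

lemma sep_commute: "x \<in> carrier E \<Longrightarrow> y \<in> carrier E \<Longrightarrow> sep x y \<Longrightarrow> sep y x"
  unfolding sep_def using D_commute[of x y] by (auto elim: eventually_elim2)

text \<open>Extending the segment beyond \<open>y\<close> to length \<open>n\<close> bounds the slope at \<open>y\<close> by
  \<open>n / (n - 1)\<close> times the slope at \<open>x\<close>.\<close>

lemma tau_le:
  assumes sep: "sep x y" and xy [simp]: "x \<in> carrier E" "y \<in> carrier E"
    and e: "e \<in> carrier E" "AE \<omega> in M. 0 < N e \<omega>"
  shows "AE \<omega> in M. tau y \<omega> \<le> tau x \<omega>"
proof -
  have "AE \<omega> in M. (1 - 1 / real (Suc n)) * tau y \<omega> \<le> tau x \<omega>" for n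
  proof -
    let ?c = "real (Suc n)"
    \<comment> \<open>The point beyond \<open>y\<close> on the ray from \<open>x\<close> for which
      \<open>y = (1 / ?c) ?p + (1 - 1 / ?c) x\<close>. For \<open>n = 0\<close> it is
      \<open>y\<close> itself and the claim reads \<open>0 \<le> tau x\<close>.\<close>
    let ?p = "lc (\<lambda>_. ?c) y (\<lambda>\<omega>. 1 - ?c) x"
    have p [simp]: "?p \<in> carrier E" by auto
    have "AE \<omega> in M. D ?p x \<omega> = \<bar>?c\<bar> * D y x \<omega>" by (rule D_lc_right) auto
    then have sp: "sep ?p x" unfolding sep_def using sep_commute[OF xy sep, unfolded sep_def]
      by eventually_elim simp
    have "lc (\<lambda>_. 1 / ?c) ?p (\<lambda>\<omega>. 1 - 1 / ?c) x
      = lc (\<lambda>_. 1 / ?c) ?p (\<lambda>\<omega>. 1 - 1 / ?c) (lc (\<lambda>_. 0) y (\<lambda>_. 1) x)"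
      using right_eq_lc[of y x] by simp
    also have "\<dots> = lc (\<lambda>\<omega>. 1 / ?c * ?c + (1 - 1 / ?c) * 0) y (\<lambda>\<omega>. 1 / ?c * (1 - ?c) + (1 - 1 / ?c) * 1) x"
      by (rule lc_lc) auto
    also have "\<dots> = lc (\<lambda>_. 1) y (\<lambda>_. 0) x" by (rule lc_cong) (simp_all add: field_simps)
    finally have yy: "lc (\<lambda>_. 1 / ?c) ?p (\<lambda>\<omega>. 1 - 1 / ?c) x = y" using left_eq_lc[of y x] by simp
    obtain b where b: "b \<in> borel_measurable M" "AE \<omega> in M. 0 \<le> b \<omega>"
      and eq: "\<And>r s. r \<in> borel_measurable M \<Longrightarrow> s \<in> borel_measurable M \<Longrightarrow>
        AE \<omega> in M. psi y (\<lambda>\<omega>. 1 / ?c * r \<omega> + (1 - 1 / ?c) * s \<omega>) \<omega> = b \<omega> * psi ?p r \<omega> + (1 - b \<omega>) * psi x s \<omega>"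
      by (rule between_eq[OF sp p xy(1) _ _ _ yy]) auto
    have m: "(\<lambda>\<omega>. 1 / ?c * 0 + (1 - 1 / ?c) * 1) \<in> borel_measurable M" by simp
    show ?thesis
      using eq[OF borel_measurable_const[where c = 0] borel_measurable_const[where c = 1]]
        eq[OF borel_measurable_const[where c = 0] borel_measurable_const[where c = 0]]
        psi_eq[OF e xy(2) m] b(2) tau_pos[OF xy(1)]
    proof eventually_elim
      case (elim \<omega>)
      \<comment> \<open>Raising the height at \<open>x\<close> from 0 to 1, with height 0 kept at
        \<open>?p\<close>, raises the height at \<open>y\<close> by \<open>1 - 1 / ?c\<close>. The
        unknown weight enters only through \<open>1 - b \<le> 1\<close>.\<close>
      have "(1 - 1 / ?c) * tau y \<omega> = (1 - b \<omega>) * tau x \<omega>"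
        using elim(1,2,3) by (simp add: tau_def algebra_simps)
      also have "\<dots> \<le> tau x \<omega>" using elim(4,5) by (simp add: algebra_simps)
      finally show ?case .
    qed
  qed
  then have "AE \<omega> in M. \<forall>n. (1 - 1 / real (Suc n)) * tau y \<omega> \<le> tau x \<omega>" by (simp add: AE_all_countable)
  then show ?thesis
  proof eventually_elim
    case (elim \<omega>)
    have "(\<lambda>n. (1 - 1 / real (Suc n)) * tau y \<omega>) \<longlonglongrightarrow> (1 - 0) * tau y \<omega>"
      using LIMSEQ_inverse_real_of_nat by (intro tendsto_intros) (simp add: inverse_eq_divide)
    then have "(1 - 0) * tau y \<omega> \<le> tau x \<omega>"
      by (rule LIMSEQ_le_const2) (use elim in auto)
    then show ?case by simp
  qed
qed

lemma tau_eq_of_sep: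
  assumes "sep x y" "x \<in> carrier E" "y \<in> carrier E" "e \<in> carrier E" "AE \<omega> in M. 0 < N e \<omega>"
  shows "AE \<omega> in M. tau x \<omega> = tau y \<omega>"
  using tau_le[OF assms] tau_le[OF sep_commute[OF assms(2,3,1)] assms(3,2,4,5)] by eventually_elim simp

lemma D_add_right:
  assumes [simp]: "x \<in> carrier E" "v \<in> carrier E"
  shows "D (x \<oplus>\<^bsub>E\<^esub> v) x = N v"
proof -
  have "(x \<oplus>\<^bsub>E\<^esub> v) \<ominus>\<^bsub>E\<^esub> x = v"
    unfolding M.minus_eq by (metis M.a_comm M.a_assoc M.r_neg M.r_zero M.a_inv_closed assms)
  then show ?thesis by (simp add: D_eq_N)
qed

lemma tau_eq:
  assumes xy [simp]: "x \<in> carrier E" "y \<in> carrier E" and e [simp]: "e \<in> carrier E" "AE \<omega> in M. 0 < N e \<omega>"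
  shows "AE \<omega> in M. tau x \<omega> = tau y \<omega>"
proof -
  \<comment> \<open>Chosen so that \<open>?z\<close> has distance \<open>1 + D x y\<close> from
    \<open>x\<close>. By the triangle inequality its distance from \<open>y\<close> is at least 1,
    so it is separated from both.\<close>
  let ?a = "\<lambda>\<omega>. (1 + D x y \<omega>) / N e \<omega>"
  have a [measurable]: "?a \<in> borel_measurable M" by measurable
  let ?z = "x \<oplus>\<^bsub>E\<^esub> sc ?a e"
  have z [simp]: "?z \<in> carrier E" by simp
  have Dx: "AE \<omega> in M. D ?z x \<omega> = 1 + D x y \<omega>"
    using N_sc[OF a e(1)] e(2) unfolding D_add_right[OF xy(1) sc_closed[OF a e(1)]]
  proof eventually_elim
    case (elim \<omega>)
    then show ?case using D_nonneg[of x y \<omega>] by simp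
  qed
  have "sep ?z x" unfolding sep_def using Dx
  proof eventually_elim
    case (elim \<omega>) then show ?case using D_nonneg[of x y \<omega>] by linarith
  qed
  moreover have "sep ?z y" unfolding sep_def using Dx D_triangle[OF z xy(2,1)] D_commute[OF xy]
    by eventually_elim linarith
  ultimately have "AE \<omega> in M. tau ?z \<omega> = tau x \<omega>" "AE \<omega> in M. tau ?z \<omega> = tau y \<omega>"
    by (auto intro!: tau_eq_of_sep[OF _ _ _ e])
  then show ?thesis by eventually_elim simp
qed

lemma affine_of_sep:
  assumes sep: "sep x y" and xy [simp]: "x \<in> carrier E" "y \<in> carrier E"
    and a [measurable]: "a \<in> borel_measurable M" and a01: "AE \<omega> in M. 0 \<le> a \<omega>" "AE \<omega> in M. a \<omega> \<le> 1"
    and e: "e \<in> carrier E" "AE \<omega> in M. 0 < N e \<omega>"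
  shows "phi (lc a x (\<lambda>\<omega>. 1 - a \<omega>) y) = lc a (phi x) (\<lambda>\<omega>. 1 - a \<omega>) (phi y)"
    and "AE \<omega> in M. psi (lc a x (\<lambda>\<omega>. 1 - a \<omega>) y) (\<lambda>_. 0) \<omega> = a \<omega> * psi x (\<lambda>_. 0) \<omega> + (1 - a \<omega>) * psi y (\<lambda>_. 0) \<omega>"
proof -
  let ?z = "lc a x (\<lambda>\<omega>. 1 - a \<omega>) y"
  have z [simp]: "?z \<in> carrier E" by auto
  obtain b where b: "b \<in> borel_measurable M" "AE \<omega> in M. 0 \<le> b \<omega>" "AE \<omega> in M. b \<omega> \<le> 1"
    and pz: "phi ?z = lc b (phi x) (\<lambda>\<omega>. 1 - b \<omega>) (phi y)"
    and eq: "\<And>r s. r \<in> borel_measurable M \<Longrightarrow> s \<in> borel_measurable M \<Longrightarrow>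
      AE \<omega> in M. psi ?z (\<lambda>\<omega>. a \<omega> * r \<omega> + (1 - a \<omega>) * s \<omega>) \<omega> = b \<omega> * psi x r \<omega> + (1 - b \<omega>) * psi y s \<omega>"
    by (rule between_eq[OF sep xy a a01 refl]) (rule that)
  have eq0: "AE \<omega> in M. psi ?z (\<lambda>_. 0) \<omega> = b \<omega> * psi x (\<lambda>_. 0) \<omega> + (1 - b \<omega>) * psi y (\<lambda>_. 0) \<omega>"
    using eq[of "\<lambda>_. 0" "\<lambda>_. 0"] by simp
  \<comment> \<open>Height 1 at \<open>x\<close> and 0 at \<open>y\<close> means height
    \<open>a\<close> at \<open>?z\<close>: the increment is \<open>a\<close> times the slope at
    \<open>?z\<close> and also \<open>b\<close> times the slope at \<open>x\<close>. The slopes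
    agree, so \<open>b = a\<close>.\<close>
  have eq1: "AE \<omega> in M. psi ?z a \<omega> = b \<omega> * psi x (\<lambda>_. 1) \<omega> + (1 - b \<omega>) * psi y (\<lambda>_. 0) \<omega>"
    using eq[of "\<lambda>_. 1" "\<lambda>_. 0"] by simp
  have ab: "AE \<omega> in M. b \<omega> = a \<omega>"
    using eq0 eq1 psi_eq[OF e z a] tau_eq[OF z xy(1) e] tau_pos[OF xy(1)]
  proof eventually_elim
    case (elim \<omega>)
    then have "tau x \<omega> * a \<omega> = b \<omega> * tau x \<omega>" by (simp add: tau_def[of x] algebra_simps)
    then show ?case using elim(5) by simp
  qed
  then show "phi ?z = lc a (phi x) (\<lambda>\<omega>. 1 - a \<omega>) (phi y)"
    unfolding pz by (intro lc_cong) (auto elim: eventually_mono)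
  show "AE \<omega> in M. psi ?z (\<lambda>_. 0) \<omega> = a \<omega> * psi x (\<lambda>_. 0) \<omega> + (1 - a \<omega>) * psi y (\<lambda>_. 0) \<omega>"
    using eq0 ab by eventually_elim simp
qed

lemma affine:
  assumes xy [simp]: "x \<in> carrier E" "y \<in> carrier E"
    and a [measurable]: "a \<in> borel_measurable M" and a01: "AE \<omega> in M. 0 \<le> a \<omega>" "AE \<omega> in M. a \<omega> \<le> 1"
    and e [simp]: "e \<in> carrier E" "AE \<omega> in M. 0 < N e \<omega>"
  shows "phi (lc a x (\<lambda>\<omega>. 1 - a \<omega>) y) = lc a (phi x) (\<lambda>\<omega>. 1 - a \<omega>) (phi y)"
    and "AE \<omega> in M. psi (lc a x (\<lambda>\<omega>. 1 - a \<omega>) y) (\<lambda>_. 0) \<omega> = a \<omega> * psi x (\<lambda>_. 0) \<omega> + (1 - a \<omega>) * psi y (\<lambda>_. 0) \<omega>"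
proof -
  define A where "A = {\<omega> \<in> space M. 0 < D x y \<omega>}"
  have A [measurable]: "A \<in> sets M" unfolding A_def by measurable
  \<comment> \<open>Where \<open>x\<close> and \<open>y\<close> coincide, \<open>y\<close> is
    replaced by \<open>x + e\<close>, which separates the endpoints. On \<open>A\<close> nothing has
    changed; off \<open>A\<close> the original combinations reduce to \<open>x\<close> and
    \<open>phi x\<close>.\<close>
  let ?y = "gl A y (x \<oplus>\<^bsub>E\<^esub> e)"
  have xe [simp]: "x \<oplus>\<^bsub>E\<^esub> e \<in> carrier E" by simp
  have y' [simp]: "?y \<in> carrier E" by auto
  let ?z = "lc a x (\<lambda>\<omega>. 1 - a \<omega>) y" and ?z' = "lc a x (\<lambda>\<omega>. 1 - a \<omega>) ?y"
  have z [simp]: "?z \<in> carrier E" "?z' \<in> carrier E" by auto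
  have ey: "AE \<omega> in M. \<omega> \<in> A \<longrightarrow> D ?y y \<omega> = 0" by (rule gl_left) auto
  have exe: "AE \<omega> in M. \<omega> \<notin> A \<longrightarrow> D ?y (x \<oplus>\<^bsub>E\<^esub> e) \<omega> = 0" by (rule gl_right) auto
  have sep: "sep x ?y" unfolding sep_def
    using ey exe e(2) D_triangle[OF xy(1) y' xy(2)] D_triangle[OF xe y' xy(1)]
      D_commute[OF y' xe] D_commute[OF xy(1) y'] AE_space
  proof eventually_elim
    case (elim \<omega>)
    then show ?case
    proof (cases "\<omega> \<in> A")
      case True then show ?thesis using elim by (simp add: A_def)
    next
      case False
      then have "N e \<omega> \<le> D x ?y \<omega>" using elim unfolding D_add_right[OF xy(1) e(1)] by auto
      then show ?thesis using elim(3) by simp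
    qed
  qed
  note aff = affine_of_sep[OF sep xy(1) y' a a01 e]
  have Dz: "AE \<omega> in M. D ?z ?z' \<omega> \<le> \<bar>a \<omega>\<bar> * D x x \<omega> + \<bar>1 - a \<omega>\<bar> * D y ?y \<omega>" by (rule D_lc) auto
  have zA: "AE \<omega> in M. \<omega> \<in> A \<longrightarrow> D ?z ?z' \<omega> = 0"
    using ey Dz D_self[OF xy(1)] D_commute[OF xy(2) y']
    by eventually_elim (auto intro: antisym)
  have Dz2: "AE \<omega> in M. D ?z (lc a x (\<lambda>\<omega>. 1 - a \<omega>) x) \<omega> \<le> \<bar>a \<omega>\<bar> * D x x \<omega> + \<bar>1 - a \<omega>\<bar> * D y x \<omega>"
    by (rule D_lc) auto
  have nA: "AE \<omega> in M. \<omega> \<notin> A \<longrightarrow> D ?z x \<omega> = 0 \<and> D x y \<omega> = 0"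
    using Dz2 D_self[OF xy(1)] D_commute[OF xy] AE_space unfolding lc_same[OF a xy(1)]
  proof eventually_elim
    case (elim \<omega>)
    show ?case
    proof
      assume "\<omega> \<notin> A"
      then have "D x y \<omega> = 0" using elim(4) D_nonneg[of x y \<omega>] by (simp add: A_def)
      then show "D ?z x \<omega> = 0 \<and> D x y \<omega> = 0" using elim D_nonneg[of ?z x \<omega>] by simp
    qed
  qed
  note loc = phi_psi_local[OF _ _ borel_measurable_const[where c = 0]]
  have p [simp]: "phi x \<in> carrier E" "phi y \<in> carrier E" "phi ?y \<in> carrier E" "phi ?z \<in> carrier E" "phi ?z' \<in> carrier E"
    by auto
  let ?l = "lc a (phi x) (\<lambda>\<omega>. 1 - a \<omega>) (phi y)" and ?l' = "lc a (phi x) (\<lambda>\<omega>. 1 - a \<omega>) (phi ?y)"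
  have l [simp]: "?l \<in> carrier E" "?l' \<in> carrier E" by auto
  have Dl: "AE \<omega> in M. D ?l' ?l \<omega> \<le> \<bar>a \<omega>\<bar> * D (phi x) (phi x) \<omega> + \<bar>1 - a \<omega>\<bar> * D (phi ?y) (phi y) \<omega>"
    by (rule D_lc) auto
  have Dl2: "AE \<omega> in M. D (lc a (phi x) (\<lambda>\<omega>. 1 - a \<omega>) (phi x)) ?l \<omega>
      \<le> \<bar>a \<omega>\<bar> * D (phi x) (phi x) \<omega> + \<bar>1 - a \<omega>\<bar> * D (phi x) (phi y) \<omega>"
    by (rule D_lc) auto
  show "phi ?z = ?l"
  proof (rule D_zeroD)
    show "AE \<omega> in M. D (phi ?z) ?l \<omega> = 0"
      using zA nA ey loc[OF z] loc[OF y' xy(2)] loc[OF z(1) xy(1)] loc[OF xy] Dl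
        Dl2[unfolded lc_same[OF a p(1)]] D_self[OF p(1)]
        D_triangle[OF p(4,5) l(1)] D_triangle[OF p(4,1) l(1)]
    proof eventually_elim
      case (elim \<omega>)
      show ?case
      proof (cases "\<omega> \<in> A")
        case True
        then have "D (phi ?z) (phi ?z') \<omega> = 0" "D (phi ?y) (phi y) \<omega> = 0" using elim by auto
        then have "D (phi ?z) ?l \<omega> \<le> 0" using elim(8,10,11) by (simp add: aff(1))
        then show ?thesis using D_nonneg[of "phi ?z" ?l \<omega>] by simp
      next
        case False
        then have "D (phi ?z) (phi x) \<omega> = 0" "D (phi x) (phi y) \<omega> = 0" using elim by auto
        then have "D (phi ?z) ?l \<omega> \<le> 0" using elim(9,10,12) by simp
        then show ?thesis using D_nonneg[of "phi ?z" ?l \<omega>] by simp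
      qed
    qed
  qed auto
  show "AE \<omega> in M. psi ?z (\<lambda>_. 0) \<omega> = a \<omega> * psi x (\<lambda>_. 0) \<omega> + (1 - a \<omega>) * psi y (\<lambda>_. 0) \<omega>"
    using zA nA ey loc[OF z] loc[OF y' xy(2)] loc[OF z(1) xy(1)] loc[OF xy] aff(2)
  proof eventually_elim
    case (elim \<omega>)
    show ?case
    proof (cases "\<omega> \<in> A")
      case True then show ?thesis using elim by simp
    next
      case False
      then have "psi ?z (\<lambda>_. 0) \<omega> = psi x (\<lambda>_. 0) \<omega>" "psi y (\<lambda>_. 0) \<omega> = psi x (\<lambda>_. 0) \<omega>" using elim by auto
      then show ?thesis by (simp add: algebra_simps)
    qed
  qed
qed

lemma T_eq:
  assumes e: "e \<in> carrier E" "AE \<omega> in M. 0 < N e \<omega>"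
    and f: "f \<in> convex_funs M E" and x: "x \<in> carrier E"
  shows "AE \<omega> in M. rep (T f x) \<omega> = ereal (1 / tau \<zero>\<^bsub>E\<^esub> \<omega>) * rep (f (phi x)) \<omega>
    + ereal (- psi x (\<lambda>_. 0) \<omega> / tau \<zero>\<^bsub>E\<^esub> \<omega>)"
proof -
  interpret inv: rn_iso M E T S by (rule swap)
  let ?G = "\<lambda>x \<omega>. ereal (1 / tau \<zero>\<^bsub>E\<^esub> \<omega>) * rep (f (phi x)) \<omega> + ereal (- psi x (\<lambda>_. 0) \<omega> / tau \<zero>\<^bsub>E\<^esub> \<omega>)"
  have Tf: "T f \<in> convex_funs M E" by (rule ord_auto_closed[OF T f])
  note [measurable] = convex_funs_measurable[OF f] convex_funs_measurable[OF Tf]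
  have Gm: "?G x \<in> borel_measurable M" if [measurable]: "x \<in> carrier E" for x
  proof -
    have [measurable]: "rep (f (phi x)) \<in> borel_measurable M" by (intro convex_funs_measurable f phi_closed that)
    show ?thesis by measurable
  qed
  have t0: "AE \<omega> in M. 0 < tau \<zero>\<^bsub>E\<^esub> \<omega>" by (rule tau_pos) simp
  have arith: "ereal (1 / t) * F + ereal (- p / t) \<le> ereal r \<longleftrightarrow> F \<le> ereal (t * r + p)"
    if "0 < t" "- \<infinity> < F" for t p r and F :: ereal
    using that by (cases F) (auto simp: field_simps)
  \<comment> \<open>By the order, \<open>(x, r)\<close> lies in the epigraph of \<open>T f\<close>
    iff \<open>(phi x, psi x r)\<close> lies in that of \<open>f\<close>. Inserting the affine form
    of \<open>psi\<close> and solving for \<open>r\<close> gives \<open>?G\<close>.\<close>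
  have iff: "(AE \<omega> in M. rep (T f x) \<omega> \<le> ereal (r \<omega>)) \<longleftrightarrow> (AE \<omega> in M. ?G x \<omega> \<le> ereal (r \<omega>))"
    if x [simp]: "x \<in> carrier E" and r [measurable]: "r \<in> borel_measurable M" for x r
  proof -
    have "(AE \<omega> in M. rep (T f x) \<omega> \<le> ereal (r \<omega>)) \<longleftrightarrow> fun_le M E (T f) (pt x r)"
      by (simp add: le_pt_iff[OF Tf])
    also have "\<dots> \<longleftrightarrow> fun_le M E (S (T f)) (S (pt x r))" using ord_auto_le_iff[OF S Tf] by simp
    also have "\<dots> \<longleftrightarrow> (AE \<omega> in M. rep (f (phi x)) \<omega> \<le> ereal (psi x r \<omega>))"
      by (simp add: ST[OF f] S_pt le_pt_iff[OF f])
    also have "\<dots> \<longleftrightarrow> (AE \<omega> in M. ?G x \<omega> \<le> ereal (r \<omega>))"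
    proof (rule eventually_subst)
      show "AE \<omega> in M. rep (f (phi x)) \<omega> \<le> ereal (psi x r \<omega>) \<longleftrightarrow> ?G x \<omega> \<le> ereal (r \<omega>)"
        using psi_eq[OF e x r] tau_eq[OF x M.zero_closed e] t0 convex_funs_proper[OF f phi_closed[OF x]]
      proof eventually_elim
        case (elim \<omega>)
        then show ?case
          using arith[of "tau \<zero>\<^bsub>E\<^esub> \<omega>" "rep (f (phi x)) \<omega>" "psi x (\<lambda>_. 0) \<omega>" "r \<omega>"] by simp
      qed
    qed
    finally show ?thesis .
  qed
  have locT: "local_fun (\<lambda>x. rep (T f x))" by (rule convex_funs_local[OF Tf])
  have locG: "local_fun ?G" unfolding local_fun_def
  proof (intro ballI)
    fix x y assume xy: "x \<in> carrier E" "y \<in> carrier E"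
    show "AE \<omega> in M. D x y \<omega> = 0 \<longrightarrow> ?G x \<omega> = ?G y \<omega>"
      using phi_psi_local[OF xy borel_measurable_const[where c = 0]]
        local_funD[OF convex_funs_local[OF f] phi_closed[OF xy(1)] phi_closed[OF xy(2)]]
      by eventually_elim auto
  qed
  have properG: "AE \<omega> in M. - \<infinity> < ?G x \<omega>" if x: "x \<in> carrier E" for x
    using t0 convex_funs_proper[OF f phi_closed[OF x]]
  proof eventually_elim
    case (elim \<omega>) then show ?case by (cases "rep (f (phi x)) \<omega>") auto
  qed
  obtain d where d: "d \<in> carrier E" "AE \<omega> in M. rep (f d) \<omega> < \<infinity>" using f by (rule convex_funs_dom)
  have pd: "phi (inv.phi d) = d" using inv.phi_inverse[OF d(1)] .
  have "AE \<omega> in M. ?G (inv.phi d) \<omega> < \<infinity>"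
    using t0 d(2) convex_funs_proper[OF f d(1)] unfolding pd
  proof eventually_elim
    case (elim \<omega>) then show ?case by (cases "rep (f d) \<omega>") auto
  qed
  then have le1: "AE \<omega> in M. rep (T f x) \<omega> \<le> ?G x \<omega>"
    using iff d x by (intro le_of_epi[OF locT locG Gm properG, of "inv.phi d"]) auto
  obtain d' where d': "d' \<in> carrier E" "AE \<omega> in M. rep (T f d') \<omega> < \<infinity>" using Tf by (rule convex_funs_dom)
  have le2: "AE \<omega> in M. ?G x \<omega> \<le> rep (T f x) \<omega>"
    using iff d' x convex_funs_proper[OF Tf] by (intro le_of_epi[OF locG locT, of d']) auto
  from le1 le2 show ?thesis by eventually_elim simp
qed

end

section \<open>Continuity\<close>

context rn_module
begin

section \<open>Translations\<close>

lemma lc_add_lc: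
  assumes [measurable]: "a \<in> borel_measurable M" "b \<in> borel_measurable M"
    and [simp]: "x \<in> carrier E" "y \<in> carrier E" "x' \<in> carrier E" "y' \<in> carrier E"
  shows "lc a x b y \<oplus>\<^bsub>E\<^esub> lc a x' b y' = lc a (x \<oplus>\<^bsub>E\<^esub> x') b (y \<oplus>\<^bsub>E\<^esub> y')"
  by (simp add: lc_def sc_r_distr M.a_ac)

lemma lc_shift:
  assumes [measurable]: "a \<in> borel_measurable M"
    and [simp]: "x \<in> carrier E" "y \<in> carrier E" "c \<in> carrier E"
  shows "lc a x (\<lambda>\<omega>. 1 - a \<omega>) y \<oplus>\<^bsub>E\<^esub> c = lc a (x \<oplus>\<^bsub>E\<^esub> c) (\<lambda>\<omega>. 1 - a \<omega>) (y \<oplus>\<^bsub>E\<^esub> c)"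
proof -
  have "lc a x (\<lambda>\<omega>. 1 - a \<omega>) y \<oplus>\<^bsub>E\<^esub> lc a c (\<lambda>\<omega>. 1 - a \<omega>) c = lc a (x \<oplus>\<^bsub>E\<^esub> c) (\<lambda>\<omega>. 1 - a \<omega>) (y \<oplus>\<^bsub>E\<^esub> c)"
    by (rule lc_add_lc) auto
  then show ?thesis by (simp add: lc_same)
qed

lemma D_shift:
  assumes "x \<in> carrier E" "y \<in> carrier E" "c \<in> carrier E"
  shows "D (x \<oplus>\<^bsub>E\<^esub> c) (y \<oplus>\<^bsub>E\<^esub> c) = D x y"
proof -
  have "(x \<oplus>\<^bsub>E\<^esub> c) \<ominus>\<^bsub>E\<^esub> (y \<oplus>\<^bsub>E\<^esub> c) = x \<ominus>\<^bsub>E\<^esub> y"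
  proof -
    have "(x \<oplus>\<^bsub>E\<^esub> c) \<ominus>\<^bsub>E\<^esub> (y \<oplus>\<^bsub>E\<^esub> c) = (x \<oplus>\<^bsub>E\<^esub> \<ominus>\<^bsub>E\<^esub> y) \<oplus>\<^bsub>E\<^esub> (c \<oplus>\<^bsub>E\<^esub> \<ominus>\<^bsub>E\<^esub> c)"
      using assms by (simp only: M.minus_eq M.minus_add M.a_inv_closed M.a_closed M.a_ac)
    then show ?thesis using assms by (simp add: M.r_neg M.minus_eq)
  qed
  then show ?thesis using assms by (simp add: D_eq_N)
qed

section \<open>Module homomorphisms before continuity is known\<close>

definition lin :: "(('w \<Rightarrow> real) set, 'd) normed_module \<Rightarrow> ('e \<Rightarrow> 'd) \<Rightarrow> bool" where
  "lin F h \<longleftrightarrow> h \<in> carrier E \<rightarrow> carrier F \<and>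
    (\<forall>x\<in>carrier E. \<forall>y\<in>carrier E. h (x \<oplus>\<^bsub>E\<^esub> y) = h x \<oplus>\<^bsub>F\<^esub> h y) \<and>
    (\<forall>\<xi>\<in>ae_classes M. \<forall>x\<in>carrier E. h (\<xi> \<odot>\<^bsub>E\<^esub> x) = \<xi> \<odot>\<^bsub>F\<^esub> h x)"

lemma cont_homs_lin: "h \<in> cont_homs M E F \<Longrightarrow> lin F h"
  by (simp add: cont_homs_def lin_def)

lemma lin_closed: "lin F h \<Longrightarrow> x \<in> carrier E \<Longrightarrow> h x \<in> carrier F"
  by (auto simp: lin_def)

lemma lin_sc:
  assumes "lin F h" "rn_module M F" "a \<in> borel_measurable M" "x \<in> carrier E"
  shows "h (sc a x) = rn_module.sc M F a (h x)"
  using assms by (simp add: lin_def sc_def rn_module.sc_def)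

lemma lin_lc:
  assumes "lin F h" "rn_module M F" "a \<in> borel_measurable M" "b \<in> borel_measurable M"
    "x \<in> carrier E" "y \<in> carrier E"
  shows "h (lc a x b y) = rn_module.lc M F a (h x) b (h y)"
proof -
  interpret F: rn_module M F by fact
  show ?thesis using assms lin_sc[OF assms(1,2)] by (simp add: lin_def lc_def F.lc_def)
qed

lemma lin_zero:
  assumes h: "lin F h" and F: "rn_module M F"
  shows "h \<zero>\<^bsub>E\<^esub> = \<zero>\<^bsub>F\<^esub>"
proof -
  interpret F: rn_module M F by fact
  show ?thesis
    using lin_sc[OF h F borel_measurable_const[where c = 0] M.zero_closed] lin_closed[OF h M.zero_closed] by simp
qed

lemma lin_minus:
  assumes h: "lin F h" and F: "rn_module M F" and xy: "x \<in> carrier E" "y \<in> carrier E"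
  shows "h (x \<ominus>\<^bsub>E\<^esub> y) = h x \<ominus>\<^bsub>F\<^esub> h y"
proof -
  interpret F: rn_module M F by fact
  show ?thesis
    using xy lin_closed[OF h] lin_lc[OF h F _ _ xy] by (simp add: minus_eq_lc F.minus_eq_lc)
qed

text \<open>The indicator of the set where \<open>x\<close> and \<open>y\<close> agree annihilates
  \<open>x - y\<close>, and by homogeneity it annihilates the image as well.\<close>

lemma lin_local:
  assumes h: "lin F h" and F: "rn_module M F" and xy [simp]: "x \<in> carrier E" "y \<in> carrier E"
  shows "AE \<omega> in M. D x y \<omega> = 0 \<longrightarrow> rn_module.D M F (h x) (h y) \<omega> = 0"
proof -
  interpret F: rn_module M F by fact
  define A where "A = {\<omega> \<in> space M. D x y \<omega> = 0}"
  have A [measurable]: "A \<in> sets M" unfolding A_def by measurable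
  let ?z = "x \<ominus>\<^bsub>E\<^esub> y"
  have im: "indicator A \<in> borel_measurable M" by measurable
  have "AE \<omega> in M. N (sc (indicator A) ?z) \<omega> = \<bar>indicator A \<omega>\<bar> * N ?z \<omega>"
    by (rule N_sc[OF im]) simp
  then have "AE \<omega> in M. N (sc (indicator A) ?z) \<omega> = 0"
    by eventually_elim (auto simp: indicator_def A_def D_eq_N)
  then have "sc (indicator A) ?z = \<zero>\<^bsub>E\<^esub>" by (intro N_zeroD sc_closed im) auto
  then have "F.sc (indicator A) (h ?z) = \<zero>\<^bsub>F\<^esub>"
    using lin_sc[OF h F im, of ?z] lin_zero[OF h F] by simp
  then have "AE \<omega> in M. \<bar>indicator A \<omega>\<bar> * F.N (h ?z) \<omega> = 0"
    using F.N_sc[OF im lin_closed[OF h], of ?z] F.N_zero by (auto elim: eventually_elim2)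
  moreover have "F.N (h ?z) = F.D (h x) (h y)"
    using lin_closed[OF h] by (simp add: lin_minus[OF h F] F.D_eq_N)
  ultimately have "AE \<omega> in M. \<bar>indicator A \<omega>\<bar> * F.D (h x) (h y) \<omega> = 0" by simp
  with AE_space show ?thesis by eventually_elim (auto simp: A_def)
qed

lemma lin_telescope:
  assumes h: "lin F h" and F: "rn_module M F" and s: "\<And>n. s n \<in> carrier E" and s0: "s 0 = \<zero>\<^bsub>E\<^esub>"
  shows "AE \<omega> in M. \<forall>n. rn_module.N F (h (s n)) \<omega> \<le> (\<Sum>k<n. rn_module.N F (h (s (Suc k) \<ominus>\<^bsub>E\<^esub> s k)) \<omega>)"
proof -
  interpret F: rn_module M F by fact
  note hc [simp] = lin_closed[OF h]
  have "AE \<omega> in M. \<forall>n. F.N (h (s (Suc n))) \<omega> \<le> F.N (h (s (Suc n) \<ominus>\<^bsub>E\<^esub> s n)) \<omega> + F.N (h (s n)) \<omega>"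
    unfolding AE_all_countable
  proof
    fix n
    have "h (s (Suc n)) = h (s (Suc n) \<ominus>\<^bsub>E\<^esub> s n) \<oplus>\<^bsub>F\<^esub> h (s n)"
      using s by (simp add: lin_minus[OF h F] F.M.minus_eq F.M.a_assoc F.M.l_neg)
    then show "AE \<omega> in M. F.N (h (s (Suc n))) \<omega> \<le> F.N (h (s (Suc n) \<ominus>\<^bsub>E\<^esub> s n)) \<omega> + F.N (h (s n)) \<omega>"
      using F.N_add[of "h (s (Suc n) \<ominus>\<^bsub>E\<^esub> s n)" "h (s n)"] s by simp
  qed
  moreover have "AE \<omega> in M. F.N (h (s 0)) \<omega> = 0" using F.N_zero lin_zero[OF h F] s0 by simp
  ultimately show ?thesis
  proof eventually_elim
    case (elim \<omega>)
    show ?case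
    proof
      fix n show "F.N (h (s n)) \<omega> \<le> (\<Sum>k<n. F.N (h (s (Suc k) \<ominus>\<^bsub>E\<^esub> s k)) \<omega>)"
      proof (induction n)
        case (Suc n) then show ?case using elim(1)[rule_format, of n] by simp
      qed (simp add: elim(2))
    qed
  qed
qed

text \<open>Zabreiko's lemma for the seminorm \<open>N (h x)\<close>; for a concrete map only
  countable subadditivity remains to be shown.\<close>

lemma lin_continuousI:
  assumes comp: "rn_complete M E" and h: "lin F h" and F: "rn_module M F"
    and csa: "\<And>s x. (\<And>n. s n \<in> carrier E) \<Longrightarrow> x \<in> carrier E \<Longrightarrow> s 0 = \<zero>\<^bsub>E\<^esub> \<Longrightarrow>
      AE \<omega> in M. (\<lambda>n. D (s n) x \<omega>) \<longlonglongrightarrow> 0 \<Longrightarrow>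
      AE \<omega> in M. summable (\<lambda>n. rn_module.N F (h (s (Suc n) \<ominus>\<^bsub>E\<^esub> s n)) \<omega>) \<Longrightarrow>
      AE \<omega> in M. rn_module.N F (h x) \<omega> \<le> (\<Sum>n. rn_module.N F (h (s (Suc n) \<ominus>\<^bsub>E\<^esub> s n)) \<omega>)"
  shows "h \<in> cont_homs M E F"
proof -
  interpret F: rn_module M F by fact
  note hc [simp] = lin_closed[OF h]
  show ?thesis
  proof (rule cont_homI[OF F])
    fix \<epsilon> :: real assume "\<epsilon> > 0"
    show "\<exists>r>0. \<forall>x\<in>carrier E. dst x \<zero>\<^bsub>E\<^esub> < r \<longrightarrow> (LINT \<omega>|M. min 1 (F.N (h x) \<omega>)) < \<epsilon>"
    proof (rule zabreiko[OF comp _ _ _ _ _ \<open>\<epsilon> > 0\<close>])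
      show "AE \<omega> in M. F.N (h (x \<oplus>\<^bsub>E\<^esub> y)) \<omega> \<le> F.N (h x) \<omega> + F.N (h y) \<omega>"
        if "x \<in> carrier E" "y \<in> carrier E" for x y
        using F.N_add[of "h x" "h y"] that h by (simp add: lin_def)
      show "AE \<omega> in M. F.N (h (sc (\<lambda>_. c) x)) \<omega> = \<bar>c\<bar> * F.N (h x) \<omega>" if "x \<in> carrier E" for x c
        using F.N_sc[of "\<lambda>_. c" "h x"] that by (simp add: lin_sc[OF h F])
      show "AE \<omega> in M. F.N (h x) \<omega> \<le> (\<Sum>n. F.N (h (s (Suc n) \<ominus>\<^bsub>E\<^esub> s n)) \<omega>)"
        if "\<And>n. s n \<in> carrier E" "x \<in> carrier E" "s 0 = \<zero>\<^bsub>E\<^esub>" "AE \<omega> in M. (\<lambda>n. D (s n) x \<omega>) \<longlonglongrightarrow> 0"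
          "AE \<omega> in M. summable (\<lambda>n. F.N (h (s (Suc n) \<ominus>\<^bsub>E\<^esub> s n)) \<omega>)" for s x
        by (rule csa[OF that])
    qed auto
  qed (use h in \<open>auto simp: lin_def\<close>)
qed

lemma rep_L0_lc:
  assumes "a \<in> borel_measurable M" "b \<in> borel_measurable M" and X: "X \<in> ae_classes M" and Y: "Y \<in> ae_classes M"
  shows "AE \<omega> in M. rep (rn_module.lc M (L0 M) a X b Y) \<omega> = a \<omega> * rep X \<omega> + b \<omega> * rep Y \<omega>"
proof -
  have m: "(\<lambda>\<omega>. a \<omega> * rep X \<omega> + b \<omega> * rep Y \<omega>) \<in> borel_measurable M" using assms by measurable
  have "rn_module.lc M (L0 M) a (ae_class M (rep X)) b (ae_class M (rep Y))
      = ae_class M (\<lambda>\<omega>. a \<omega> * rep X \<omega> + b \<omega> * rep Y \<omega>)"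
    by (rule lc_L0) (use assms in auto)
  then show ?thesis using rep_ae_class[OF m] X Y by simp
qed

text \<open>Lower semicontinuity at \<open>x\<close> and at \<open>- x\<close> makes a linear functional countably additive.\<close>

lemma lsc_lin_continuous:
  assumes comp: "rn_complete M E" and v: "lin (L0 M) v"
    and g: "g \<in> convex_funs M E" and b [measurable]: "b \<in> borel_measurable M"
    and gv: "\<And>x. x \<in> carrier E \<Longrightarrow> AE \<omega> in M. rep (g x) \<omega> = ereal (rep (v x) \<omega> + b \<omega>)"
  shows "v \<in> cont_homs M E (L0 M)"
proof (rule lin_continuousI[OF comp v L0_rn_module])
  interpret L: rn_module M "L0 M" by (rule L0_rn_module)
  fix s x assume s: "\<And>n. s n \<in> carrier E" and x: "x \<in> carrier E" and s0: "s 0 = \<zero>\<^bsub>E\<^esub>"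
    and lim: "AE \<omega> in M. (\<lambda>n. D (s n) x \<omega>) \<longlonglongrightarrow> 0"
    and sum: "AE \<omega> in M. summable (\<lambda>n. L.N (v (s (Suc n) \<ominus>\<^bsub>E\<^esub> s n)) \<omega>)"
  have vc [simp]: "v z \<in> ae_classes M" if "z \<in> carrier E" for z using lin_closed[OF v that] by simp
  define d where "d n = rep (v (s (Suc n) \<ominus>\<^bsub>E\<^esub> s n))" for n
  have [measurable]: "d n \<in> borel_measurable M" for n unfolding d_def using s by auto
  have Nd: "AE \<omega> in M. \<forall>n. L.N (v (s (Suc n) \<ominus>\<^bsub>E\<^esub> s n)) \<omega> = \<bar>d n \<omega>\<bar>"
    unfolding AE_all_countable d_def using N_L0[OF measurable_rep[OF vc]] s by simp
  have Nx: "AE \<omega> in M. L.N (v x) \<omega> = \<bar>rep (v x) \<omega>\<bar>" using N_L0[OF measurable_rep[OF vc]] x by simp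
  have step: "AE \<omega> in M. \<forall>n. rep (v (s (Suc n))) \<omega> = d n \<omega> + rep (v (s n)) \<omega>"
    unfolding AE_all_countable
  proof
    fix n
    have "v (s (Suc n) \<ominus>\<^bsub>E\<^esub> s n) = L.lc (\<lambda>_. 1) (v (s (Suc n))) (\<lambda>_. - 1) (v (s n))"
      using s by (simp add: minus_eq_lc lin_lc[OF v L0_rn_module])
    then have "AE \<omega> in M. d n \<omega> = 1 * rep (v (s (Suc n))) \<omega> + - 1 * rep (v (s n)) \<omega>"
      unfolding d_def using rep_L0_lc[of "\<lambda>_. 1" "\<lambda>_. - 1" "v (s (Suc n))" "v (s n)"] s by simp
    then show "AE \<omega> in M. rep (v (s (Suc n))) \<omega> = d n \<omega> + rep (v (s n)) \<omega>" by eventually_elim simp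
  qed
  have "v (s 0) = ae_class M (\<lambda>_. 0)" using lin_zero[OF v L0_rn_module] s0 by simp
  then have zero: "AE \<omega> in M. rep (v (s 0)) \<omega> = 0" using rep_ae_class[of "\<lambda>_. 0::real" M] by simp
  \<comment> \<open>The limit of \<open>v (s n)\<close>, which is the sum of the increments because
    \<open>v (s 0) = 0\<close>. The goal follows once this limit is identified with
    \<open>v x\<close>.\<close>
  define t where "t \<omega> = (\<Sum>n. d n \<omega>)" for \<omega>
  have t [measurable]: "t \<in> borel_measurable M" unfolding t_def by measurable
  have vt: "AE \<omega> in M. (\<lambda>n. rep (v (s n)) \<omega>) \<longlonglongrightarrow> t \<omega> \<and> \<bar>t \<omega>\<bar> \<le> (\<Sum>n. \<bar>d n \<omega>\<bar>)"
    using sum Nd step zero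
  proof eventually_elim
    case (elim \<omega>)
    have "rep (v (s n)) \<omega> = (\<Sum>k<n. d k \<omega>)" for n
      by (induction n) (use elim in auto)
    then have eq: "(\<lambda>n. rep (v (s n)) \<omega>) = (\<lambda>n. \<Sum>k<n. d k \<omega>)" by blast
    have sa: "summable (\<lambda>n. \<bar>d n \<omega>\<bar>)" using elim(1,2) by simp
    have "(\<lambda>n. rep (v (s n)) \<omega>) \<longlonglongrightarrow> t \<omega>"
      unfolding eq t_def by (rule summable_LIMSEQ[OF summable_rabs_cancel[OF sa]])
    moreover have "\<bar>t \<omega>\<bar> \<le> (\<Sum>n. \<bar>d n \<omega>\<bar>)" unfolding t_def by (rule summable_rabs[OF sa])
    ultimately show ?case by (rule conjI)
  qed
  have upper: "AE \<omega> in M. rep (v x) \<omega> \<le> t \<omega>"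
  proof -
    have "AE \<omega> in M. rep (g x) \<omega> \<le> ereal (t \<omega> + b \<omega>)"
    proof (rule convex_funs_lsc[OF g, of s "\<lambda>n \<omega>. rep (v (s n)) \<omega> + b \<omega>"])
      show "AE \<omega> in M. rep (g (s n)) \<omega> \<le> ereal (rep (v (s n)) \<omega> + b \<omega>)" for n
        using gv[OF s, of n] by eventually_elim simp
      show "AE \<omega> in M. (\<lambda>n. rep (v (s n)) \<omega> + b \<omega>) \<longlonglongrightarrow> t \<omega> + b \<omega>"
        using vt by eventually_elim (auto intro: tendsto_add)
    qed (use s x lim in auto)
    with gv[OF x] show ?thesis by eventually_elim simp
  qed
  have neg: "AE \<omega> in M. rep (v (sc (\<lambda>_. - 1) z)) \<omega> = - rep (v z) \<omega>" if z [simp]: "z \<in> carrier E" for z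
  proof -
    have "v (sc (\<lambda>_. - 1) z) = L.sc (\<lambda>_. - 1) (ae_class M (rep (v z)))"
      using z by (simp add: lin_sc[OF v L0_rn_module] del: sc_minus L.sc_minus)
    also have "\<dots> = ae_class M (\<lambda>\<omega>. - 1 * rep (v z) \<omega>)" by (rule sc_L0) auto
    finally have eq: "v (sc (\<lambda>_. - 1) z) = ae_class M (\<lambda>\<omega>. - 1 * rep (v z) \<omega>)" .
    have "(\<lambda>\<omega>. - 1 * rep (v z) \<omega>) \<in> borel_measurable M" using vc[OF z] by measurable
    from rep_ae_class[OF this] show ?thesis unfolding eq by simp
  qed
  have lower: "AE \<omega> in M. t \<omega> \<le> rep (v x) \<omega>"
  proof -
    have negs: "AE \<omega> in M. \<forall>n. rep (v (sc (\<lambda>_. - 1) (s n))) \<omega> = - rep (v (s n)) \<omega>"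
      unfolding AE_all_countable using neg[OF s] by blast
    have sx: "AE \<omega> in M. \<forall>n. D (sc (\<lambda>_. - 1) (s n)) (sc (\<lambda>_. - 1) x) \<omega> \<le> D (s n) x \<omega>"
      unfolding AE_all_countable
    proof
      fix n
      have "AE \<omega> in M. D (lc (\<lambda>_. - 1) (s n) (\<lambda>_. 0) (s n)) (lc (\<lambda>_. - 1) x (\<lambda>_. 0) x) \<omega>
        \<le> \<bar>- 1\<bar> * D (s n) x \<omega> + \<bar>0\<bar> * D (s n) x \<omega>" by (rule D_lc) (use s x in auto)
      moreover have "lc (\<lambda>_. - 1) z (\<lambda>_. 0) z = sc (\<lambda>_. - 1) z" if "z \<in> carrier E" for z
        using that by (simp add: lc_def)
      ultimately show "AE \<omega> in M. D (sc (\<lambda>_. - 1) (s n)) (sc (\<lambda>_. - 1) x) \<omega> \<le> D (s n) x \<omega>"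
        using s x by simp
    qed
    have "AE \<omega> in M. rep (g (sc (\<lambda>_. - 1) x)) \<omega> \<le> ereal (- t \<omega> + b \<omega>)"
    proof (rule convex_funs_lsc[OF g, of "\<lambda>n. sc (\<lambda>_. - 1) (s n)" "\<lambda>n \<omega>. - rep (v (s n)) \<omega> + b \<omega>"])
      show "AE \<omega> in M. rep (g (sc (\<lambda>_. - 1) (s n))) \<omega> \<le> ereal (- rep (v (s n)) \<omega> + b \<omega>)" for n
        using gv[OF sc_closed[OF borel_measurable_const s], of "- 1" n] neg[OF s, of n] by eventually_elim simp
      show "AE \<omega> in M. (\<lambda>n. - rep (v (s n)) \<omega> + b \<omega>) \<longlonglongrightarrow> - t \<omega> + b \<omega>"
        using vt by eventually_elim (auto intro!: tendsto_intros)
      show "AE \<omega> in M. (\<lambda>n. D (sc (\<lambda>_. - 1) (s n)) (sc (\<lambda>_. - 1) x) \<omega>) \<longlonglongrightarrow> 0"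
        using sx lim
      proof eventually_elim
        case (elim \<omega>)
        then show ?case by (intro tendsto_sandwich[OF _ _ tendsto_const elim(2)]) auto
      qed
      show "(\<lambda>\<omega>. - rep (v (s n)) \<omega> + b \<omega>) \<in> borel_measurable M" for n
        using vc[OF s] by measurable
    qed (use s x in \<open>auto simp del: sc_minus\<close>)
    with gv[OF sc_closed[OF borel_measurable_const x], of "- 1"] neg[OF x] show ?thesis
      by eventually_elim simp
  qed
  show "AE \<omega> in M. L.N (v x) \<omega> \<le> (\<Sum>n. L.N (v (s (Suc n) \<ominus>\<^bsub>E\<^esub> s n)) \<omega>)"
    using Nx Nd vt upper lower by eventually_elim simp
qed

lemma cont_functional_subseq:
  assumes v: "v \<in> cont_homs M E (L0 M)" and s: "\<And>n. s n \<in> carrier E" and x: "x \<in> carrier E"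
    and lim: "(\<lambda>n. dst (s n) x) \<longlonglongrightarrow> 0"
  obtains r :: "nat \<Rightarrow> nat" where "strict_mono r" "AE \<omega> in M. (\<lambda>n. rep (v (s (r n))) \<omega>) \<longlonglongrightarrow> rep (v x) \<omega>"
proof -
  interpret L: rn_module M "L0 M" by (rule L0_rn_module)
  have vc [simp]: "v z \<in> ae_classes M" if "z \<in> carrier E" for z
    using lin_closed[OF cont_homs_lin[OF v] that] by simp
  have "(\<lambda>n. L.dst (v (s n)) (v x)) \<longlonglongrightarrow> 0" by (rule cont_hom_tendsto[OF v L0_rn_module s x lim])
  then obtain r :: "nat \<Rightarrow> nat" where r: "strict_mono r" "AE \<omega> in M. (\<lambda>n. L.D (v (s (r n))) (v x) \<omega>) \<longlonglongrightarrow> 0"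
    using L.dst_AE_subseq[of "\<lambda>n. v (s n)" "v x"] s x by auto
  have "AE \<omega> in M. \<forall>n. L.D (v (s (r n))) (v x) \<omega> = \<bar>rep (v (s (r n))) \<omega> - rep (v x) \<omega>\<bar>"
    unfolding AE_all_countable using D_L0[OF measurable_rep[OF vc] measurable_rep[OF vc]] s x by simp
  with r(2) have "AE \<omega> in M. (\<lambda>n. rep (v (s (r n))) \<omega>) \<longlonglongrightarrow> rep (v x) \<omega>"
  proof eventually_elim
    case (elim \<omega>)
    then have "(\<lambda>n. \<bar>rep (v (s (r n))) \<omega> - rep (v x) \<omega>\<bar>) \<longlonglongrightarrow> 0" by simp
    then show ?case by (rule LIM_zero_cancel[OF tendsto_rabs_zero_cancel])
  qed
  with r(1) show ?thesis by (rule that)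
qed

text \<open>Continuity of \<open>v\<close> lets its term in \<open>g\<close> converge along a
  subsequence. Lower semicontinuity of \<open>g\<close> then bounds the norm of \<open>h x\<close>
  by the sum of the norms of the increments.\<close>

lemma lsc_norm_lin_continuous:
  assumes comp: "rn_complete M E" and h: "lin E h" and v: "v \<in> cont_homs M E (L0 M)"
    and g: "g \<in> convex_funs M E" and t [measurable]: "t \<in> borel_measurable M" and t0: "AE \<omega> in M. 0 < t \<omega>"
    and b [measurable]: "b \<in> borel_measurable M"
    and gh: "\<And>x. x \<in> carrier E \<Longrightarrow> AE \<omega> in M. rep (g x) \<omega> = ereal (t \<omega> * N (h x) \<omega> + rep (v x) \<omega> + b \<omega>)"
  shows "h \<in> cont_homs M E E"
proof (rule lin_continuousI[OF comp h rn_module_axioms])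
  fix s x assume s: "\<And>n. s n \<in> carrier E" and x: "x \<in> carrier E" and s0: "s 0 = \<zero>\<^bsub>E\<^esub>"
    and lim: "AE \<omega> in M. (\<lambda>n. D (s n) x \<omega>) \<longlonglongrightarrow> 0"
    and sum: "AE \<omega> in M. summable (\<lambda>n. N (h (s (Suc n) \<ominus>\<^bsub>E\<^esub> s n)) \<omega>)"
  have vc [simp]: "v z \<in> ae_classes M" if "z \<in> carrier E" for z
    using lin_closed[OF cont_homs_lin[OF v] that] by simp
  note hc [simp] = lin_closed[OF h]
  define R where "R \<omega> = (\<Sum>n. N (h (s (Suc n) \<ominus>\<^bsub>E\<^esub> s n)) \<omega>)" for \<omega>
  have dm: "N (h (s (Suc n) \<ominus>\<^bsub>E\<^esub> s n)) \<in> borel_measurable M" for n using s by (intro N_measurable hc) auto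
  have R [measurable]: "R \<in> borel_measurable M" unfolding R_def using dm by measurable
  have le: "AE \<omega> in M. \<forall>n. N (h (s n)) \<omega> \<le> R \<omega>"
    using lin_telescope[where s = s, OF h rn_module_axioms s s0] sum
  proof eventually_elim
    case (elim \<omega>)
    show ?case
    proof
      fix n
      have "N (h (s n)) \<omega> \<le> (\<Sum>k<n. N (h (s (Suc k) \<ominus>\<^bsub>E\<^esub> s k)) \<omega>)" using elim(1) by blast
      also have "\<dots> \<le> R \<omega>" unfolding R_def by (rule sum_le_suminf[OF elim(2)]) auto
      finally show "N (h (s n)) \<omega> \<le> R \<omega>" .
    qed
  qed
  obtain r :: "nat \<Rightarrow> nat" where r: "strict_mono r"
    and vr: "AE \<omega> in M. (\<lambda>n. rep (v (s (r n))) \<omega>) \<longlonglongrightarrow> rep (v x) \<omega>"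
    using cont_functional_subseq[OF v s x dst_tendsto_AE[OF s x lim]] by blast
  have vm: "rep (v z) \<in> borel_measurable M" if "z \<in> carrier E" for z using vc[OF that] by simp
  have "AE \<omega> in M. rep (g x) \<omega> \<le> ereal (t \<omega> * R \<omega> + rep (v x) \<omega> + b \<omega>)"
  proof (rule convex_funs_lsc[OF g, of "\<lambda>n. s (r n)" "\<lambda>n \<omega>. t \<omega> * R \<omega> + rep (v (s (r n))) \<omega> + b \<omega>"])
    show "AE \<omega> in M. rep (g (s (r n))) \<omega> \<le> ereal (t \<omega> * R \<omega> + rep (v (s (r n))) \<omega> + b \<omega>)" for n
      using gh[OF s, of "r n"] le t0 by eventually_elim (simp add: mult_left_mono)
    show "AE \<omega> in M. (\<lambda>n. D (s (r n)) x \<omega>) \<longlonglongrightarrow> 0"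
      using lim
    proof eventually_elim
      case (elim \<omega>)
      from LIMSEQ_subseq_LIMSEQ[OF elim r] show ?case by (simp add: o_def)
    qed
    show "AE \<omega> in M. (\<lambda>n. t \<omega> * R \<omega> + rep (v (s (r n))) \<omega> + b \<omega>) \<longlonglongrightarrow> t \<omega> * R \<omega> + rep (v x) \<omega> + b \<omega>"
      using vr by eventually_elim (intro tendsto_intros)
    show "(\<lambda>\<omega>. t \<omega> * R \<omega> + rep (v (s (r n))) \<omega> + b \<omega>) \<in> borel_measurable M" for n
      using vm[OF s] by measurable
    show "(\<lambda>\<omega>. t \<omega> * R \<omega> + rep (v x) \<omega> + b \<omega>) \<in> borel_measurable M"
      using vm[OF x] by measurable
  qed (use s x in auto)
  with gh[OF x] t0 show "AE \<omega> in M. N (h x) \<omega> \<le> (\<Sum>n. N (h (s (Suc n) \<ominus>\<^bsub>E\<^esub> s n)) \<omega>)"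
    by eventually_elim (simp add: R_def)
qed

text \<open>Banach's inverse theorem by way of Zabreiko's lemma: if the images of the increments are
  summable, the images themselves converge by completeness, and continuity of \<open>H\<close>
  identifies their limit as the image of \<open>x\<close>.\<close>

lemma cont_automorphism_inverse:
  assumes comp: "rn_complete M E" and H: "H \<in> cont_automorphisms M E"
  shows "inv_into (carrier E) H \<in> cont_homs M E E"
proof -
  let ?K = "inv_into (carrier E) H"
  have Hc: "H \<in> cont_homs M E E" and bij: "bij_betw H (carrier E) (carrier E)"
    using H by (auto simp: cont_automorphisms_def)
  have lH: "lin E H" by (rule cont_homs_lin[OF Hc])
  have Kc [simp]: "?K y \<in> carrier E" if "y \<in> carrier E" for y
    using bij that by (metis bij_betw_def inv_into_into)
  have HK: "H (?K y) = y" if "y \<in> carrier E" for y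
    using bij that by (simp add: bij_betw_inv_into_right)
  have KH: "?K (H x) = x" if "x \<in> carrier E" for x
    using bij that by (simp add: bij_betw_inv_into_left)
  have lK: "lin E ?K"
    unfolding lin_def
  proof (intro conjI ballI)
    show "?K (x \<oplus>\<^bsub>E\<^esub> y) = ?K x \<oplus>\<^bsub>E\<^esub> ?K y" if "x \<in> carrier E" "y \<in> carrier E" for x y
    proof -
      have "H (?K x \<oplus>\<^bsub>E\<^esub> ?K y) = x \<oplus>\<^bsub>E\<^esub> y" using lH that by (simp add: lin_def HK)
      then show ?thesis using KH[of "?K x \<oplus>\<^bsub>E\<^esub> ?K y"] that by simp
    qed
    show "?K (\<xi> \<odot>\<^bsub>E\<^esub> x) = \<xi> \<odot>\<^bsub>E\<^esub> ?K x" if "\<xi> \<in> ae_classes M" "x \<in> carrier E" for \<xi> x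
    proof -
      have "H (\<xi> \<odot>\<^bsub>E\<^esub> ?K x) = \<xi> \<odot>\<^bsub>E\<^esub> x" using lH that by (simp add: lin_def HK)
      then show ?thesis using KH[of "\<xi> \<odot>\<^bsub>E\<^esub> ?K x"] that by simp
    qed
  qed auto
  show ?thesis
  proof (rule lin_continuousI[OF comp lK rn_module_axioms])
    fix s x assume s: "\<And>n. s n \<in> carrier E" and x: "x \<in> carrier E" and s0: "s 0 = \<zero>\<^bsub>E\<^esub>"
      and lim: "AE \<omega> in M. (\<lambda>n. D (s n) x \<omega>) \<longlonglongrightarrow> 0"
      and sum: "AE \<omega> in M. summable (\<lambda>n. N (?K (s (Suc n) \<ominus>\<^bsub>E\<^esub> s n)) \<omega>)"
    have Ks: "?K (s n) \<in> carrier E" for n using s by simp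
    have "AE \<omega> in M. summable (\<lambda>n. D (?K (s (Suc n))) (?K (s n)) \<omega>)"
      using sum s by (simp add: lin_minus[OF lK rn_module_axioms] D_eq_N)
    then obtain u where u: "u \<in> carrier E" and ulim: "AE \<omega> in M. (\<lambda>n. D (?K (s n)) u \<omega>) \<longlonglongrightarrow> 0"
      by (rule complete_AE[OF comp Ks])
    have "(\<lambda>n. dst (H (?K (s n))) (H u)) \<longlonglongrightarrow> 0"
      by (rule cont_hom_tendsto[OF Hc rn_module_axioms Ks u dst_tendsto_AE[OF Ks u ulim]])
    then have l1: "(\<lambda>n. dst (s n) (H u)) \<longlonglongrightarrow> 0" using HK s by simp
    have Hu: "H u \<in> carrier E" using lin_closed[OF lH u] .
    have "limitin dm.mtopology s (H u) sequentially" "limitin dm.mtopology s x sequentially"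
      unfolding dm.limitin_metric_dist_null using l1 dst_tendsto_AE[OF s x lim] s Hu x
      by (auto intro: always_eventually)
    then have "x = H u" using dm.limitin_metric_unique by (metis trivial_limit_sequentially)
    then have Kx: "?K x = u" using KH u by simp
    have tri: "AE \<omega> in M. \<forall>n. N u \<omega> \<le> D (?K (s n)) u \<omega> + N (?K (s n)) \<omega>"
      unfolding AE_all_countable
    proof
      fix n show "AE \<omega> in M. N u \<omega> \<le> D (?K (s n)) u \<omega> + N (?K (s n)) \<omega>"
        using D_triangle[OF u Ks[of n] M.zero_closed] D_commute[OF u Ks[of n]]
        unfolding N_eq_D[OF u] N_eq_D[OF Ks[of n]] by eventually_elim simp
    qed
    show "AE \<omega> in M. N (?K x) \<omega> \<le> (\<Sum>n. N (?K (s (Suc n) \<ominus>\<^bsub>E\<^esub> s n)) \<omega>)"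
      using tri ulim sum lin_telescope[where s = s, OF lK rn_module_axioms s s0] unfolding Kx
    proof eventually_elim
      case (elim \<omega>)
      let ?R = "\<Sum>n. N (?K (s (Suc n) \<ominus>\<^bsub>E\<^esub> s n)) \<omega>"
      have "N u \<omega> \<le> D (?K (s n)) u \<omega> + ?R" for n
      proof -
        have "N (?K (s n)) \<omega> \<le> (\<Sum>k<n. N (?K (s (Suc k) \<ominus>\<^bsub>E\<^esub> s k)) \<omega>)" using elim(4) by blast
        also have "\<dots> \<le> ?R" by (rule sum_le_suminf[OF elim(3)]) auto
        finally show ?thesis using elim(1)[rule_format, of n] by linarith
      qed
      then have "N u \<omega> \<le> 0 + ?R"
        by (intro LIMSEQ_le_const[OF tendsto_add[OF elim(2) tendsto_const]]) auto
      then show ?case by simp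
    qed
  qed
qed

section \<open>Affine transformations of convex functions\<close>

text \<open>Continuity of \<open>P\<close> and \<open>V\<close> is asked along a subsequence only:
  continuous homomorphisms preserve convergence in probability, and almost everywhere convergence of
  the images is obtained after thinning out.\<close>

lemma affine_transform_convex_funs:
  assumes g: "g \<in> convex_funs M E" and t [measurable]: "t \<in> borel_measurable M" and t0: "AE \<omega> in M. 0 < t \<omega>"
    and P: "\<And>x. x \<in> carrier E \<Longrightarrow> P x \<in> carrier E" and V: "\<And>x. x \<in> carrier E \<Longrightarrow> V x \<in> borel_measurable M"
    and surj: "\<And>y. y \<in> carrier E \<Longrightarrow> \<exists>x\<in>carrier E. P x = y"
    and affP: "\<And>x y a. \<lbrakk>x \<in> carrier E; y \<in> carrier E; a \<in> borel_measurable M\<rbrakk> \<Longrightarrow>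
      P (lc a x (\<lambda>\<omega>. 1 - a \<omega>) y) = lc a (P x) (\<lambda>\<omega>. 1 - a \<omega>) (P y)"
    and affV: "\<And>x y a. \<lbrakk>x \<in> carrier E; y \<in> carrier E; a \<in> borel_measurable M\<rbrakk> \<Longrightarrow>
      AE \<omega> in M. V (lc a x (\<lambda>\<omega>. 1 - a \<omega>) y) \<omega> = a \<omega> * V x \<omega> + (1 - a \<omega>) * V y \<omega>"
    and loc: "\<And>x y. x \<in> carrier E \<Longrightarrow> y \<in> carrier E \<Longrightarrow>
      AE \<omega> in M. D x y \<omega> = 0 \<longrightarrow> D (P x) (P y) \<omega> = 0 \<and> V x \<omega> = V y \<omega>"
    and cont: "\<And>xs x. (\<And>n. xs n \<in> carrier E) \<Longrightarrow> x \<in> carrier E \<Longrightarrow> AE \<omega> in M. (\<lambda>n. D (xs n) x \<omega>) \<longlonglongrightarrow> 0 \<Longrightarrow>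
      \<exists>r::nat \<Rightarrow> nat. strict_mono r \<and> (AE \<omega> in M. (\<lambda>n. D (P (xs (r n))) (P x) \<omega>) \<longlonglongrightarrow> 0) \<and>
        (AE \<omega> in M. (\<lambda>n. V (xs (r n)) \<omega>) \<longlonglongrightarrow> V x \<omega>)"
  shows "mkf (\<lambda>x \<omega>. ereal (t \<omega>) * rep (g (P x)) \<omega> + ereal (V x \<omega>)) \<in> convex_funs M E"
proof -
  obtain d where d: "d \<in> carrier E" "AE \<omega> in M. rep (g d) \<omega> < \<infinity>" using g by (rule convex_funs_dom)
  obtain x0 where x0: "x0 \<in> carrier E" "P x0 = d" using surj[OF d(1)] by blast
  show ?thesis
  proof (rule mkf_convex_funs)
    show "x0 \<in> carrier E" by (rule x0(1))
    let ?G = "\<lambda>x \<omega>. ereal (t \<omega>) * rep (g (P x)) \<omega> + ereal (V x \<omega>)"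
    have gm: "rep (g (P x)) \<in> borel_measurable M" if "x \<in> carrier E" for x
      by (intro convex_funs_measurable g P that)
    note proper = convex_funs_proper[OF g P]
    show "?G x \<in> borel_measurable M" if "x \<in> carrier E" for x
      using gm[OF that] V[OF that] by measurable
    show "AE \<omega> in M. - \<infinity> < ?G x \<omega>" if x: "x \<in> carrier E" for x
      using t0 proper[OF x]
    proof eventually_elim
      case (elim \<omega>) then show ?case by (cases "rep (g (P x)) \<omega>") auto
    qed
    show "local_fun ?G" unfolding local_fun_def
    proof (intro ballI)
      fix x y assume xy: "x \<in> carrier E" "y \<in> carrier E"
      show "AE \<omega> in M. D x y \<omega> = 0 \<longrightarrow> ?G x \<omega> = ?G y \<omega>"
        using loc[OF xy] local_funD[OF convex_funs_local[OF g] P[OF xy(1)] P[OF xy(2)]]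
        by eventually_elim auto
    qed
    show "AE \<omega> in M. ?G x0 \<omega> < \<infinity>"
      unfolding x0(2) using d(2) convex_funs_proper[OF g d(1)] t0
    proof eventually_elim
      case (elim \<omega>) then show ?case by (cases "rep (g d) \<omega>") auto
    qed
    show "AE \<omega> in M. ?G (lc a x (\<lambda>\<omega>. 1 - a \<omega>) y) \<omega> \<le> ereal (a \<omega>) * ?G x \<omega> + ereal (1 - a \<omega>) * ?G y \<omega>"
      if xy: "x \<in> carrier E" "y \<in> carrier E" and a: "a \<in> borel_measurable M" "AE \<omega> in M. 0 \<le> a \<omega>" "AE \<omega> in M. a \<omega> \<le> 1"
        and fin: "AE \<omega> in M. ?G x \<omega> < \<infinity>" "AE \<omega> in M. ?G y \<omega> < \<infinity>" for x y a
      using convex_funs_convex[OF g P[OF xy(1)] P[OF xy(2)] a] affV[OF xy a(1)] proper[OF xy(1)] proper[OF xy(2)] fin t0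
        convex_funs_proper[OF g lc_closed[OF a(1) P[OF xy(1)] borel_measurable_diff[OF borel_measurable_const[where c = 1] a(1)] P[OF xy(2)]]]
      unfolding affP[OF xy a(1)]
    proof eventually_elim
      case (elim \<omega>)
      \<comment> \<open>On the effective domain all values are real, so the inequality for
        \<open>g\<close> can be scaled by \<open>t\<close> and combined with the affine
        \<open>V\<close> in ordinary arithmetic.\<close>
      obtain p where p: "rep (g (P x)) \<omega> = ereal p" using elim by (cases "rep (g (P x)) \<omega>") auto
      obtain q where q: "rep (g (P y)) \<omega> = ereal q" using elim by (cases "rep (g (P y)) \<omega>") auto
      obtain z where z: "rep (g (lc a (P x) (\<lambda>\<omega>. 1 - a \<omega>) (P y))) \<omega> = ereal z"
        using elim(1,8) unfolding p q by (cases "rep (g (lc a (P x) (\<lambda>\<omega>. 1 - a \<omega>) (P y))) \<omega>") auto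
      have "z \<le> a \<omega> * p + (1 - a \<omega>) * q" using elim(1) unfolding p q z by simp
      then have "t \<omega> * z \<le> t \<omega> * (a \<omega> * p + (1 - a \<omega>) * q)" using elim(7) by (intro mult_left_mono) auto
      then show ?case unfolding p q z elim(2) by (simp add: algebra_simps)
    qed
    fix xs rs x r
    assume xs: "\<And>n. xs n \<in> carrier E" and rs: "\<And>n. rs n \<in> borel_measurable M"
      and x: "x \<in> carrier E" and r [measurable]: "r \<in> borel_measurable M"
      and le: "\<And>n. AE \<omega> in M. ?G (xs n) \<omega> \<le> ereal (rs n \<omega>)"
      and lim: "AE \<omega> in M. (\<lambda>n. D (xs n) x \<omega>) \<longlonglongrightarrow> 0" and rlim: "AE \<omega> in M. (\<lambda>n. rs n \<omega>) \<longlonglongrightarrow> r \<omega>"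
    obtain k :: "nat \<Rightarrow> nat" where k: "strict_mono k" and Pk: "AE \<omega> in M. (\<lambda>n. D (P (xs (k n))) (P x) \<omega>) \<longlonglongrightarrow> 0"
      and Vk: "AE \<omega> in M. (\<lambda>n. V (xs (k n)) \<omega>) \<longlonglongrightarrow> V x \<omega>"
      using cont[OF xs x lim] by blast
    have arith: "ereal c * F + ereal p \<le> ereal q \<longleftrightarrow> F \<le> ereal ((q - p) / c)"
      if "0 < c" "- \<infinity> < F" for c p q and F :: ereal
      using that by (cases F) (auto simp: field_simps)
    have "AE \<omega> in M. rep (g (P x)) \<omega> \<le> ereal ((r \<omega> - V x \<omega>) / t \<omega>)"
    proof (rule convex_funs_lsc[OF g, of "\<lambda>n. P (xs (k n))" "\<lambda>n \<omega>. (rs (k n) \<omega> - V (xs (k n)) \<omega>) / t \<omega>"])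
      show "AE \<omega> in M. rep (g (P (xs (k n)))) \<omega> \<le> ereal ((rs (k n) \<omega> - V (xs (k n)) \<omega>) / t \<omega>)" for n
        using le[of "k n"] t0 proper[OF xs, of "k n"] by eventually_elim (simp only: arith)
      show "AE \<omega> in M. (\<lambda>n. (rs (k n) \<omega> - V (xs (k n)) \<omega>) / t \<omega>) \<longlonglongrightarrow> (r \<omega> - V x \<omega>) / t \<omega>"
        using rlim Vk t0
      proof eventually_elim
        case (elim \<omega>)
        have "(\<lambda>n. rs (k n) \<omega>) \<longlonglongrightarrow> r \<omega>" using LIMSEQ_subseq_LIMSEQ[OF elim(1) k] by (simp add: o_def)
        then show ?case using elim by (intro tendsto_intros) auto
      qed
      show "(\<lambda>\<omega>. (rs (k n) \<omega> - V (xs (k n)) \<omega>) / t \<omega>) \<in> borel_measurable M" for n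
        using rs[of "k n"] V[OF xs, of "k n"] by measurable
      show "(\<lambda>\<omega>. (r \<omega> - V x \<omega>) / t \<omega>) \<in> borel_measurable M" using V[OF x] by measurable
    qed (use xs x P Pk in auto)
    then show "AE \<omega> in M. ?G x \<omega> \<le> ereal (r \<omega>)"
      using t0 proper[OF x] by eventually_elim (simp only: arith)
  qed
qed

section \<open>The characterization\<close>

lemma formula_eq:
  assumes f: "f \<in> convex_funs M E" and y: "y \<in> carrier E" and t: "t \<in> borel_measurable M"
    and v: "v \<in> ae_classes M" and b: "b \<in> ae_classes M"
  shows "cls_add M (cls_add M (scale_ext M (ae_class M t) (f y)) (to_ext M v)) (to_ext M b)
    = ae_class M (\<lambda>\<omega>. ereal (t \<omega>) * rep (f y) \<omega> + ereal (rep v \<omega> + rep b \<omega>))"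
proof -
  have [measurable]: "t \<in> borel_measurable M" "rep (f y) \<in> borel_measurable M"
    "rep v \<in> borel_measurable M" "rep b \<in> borel_measurable M"
    using assms by auto
  have ve: "to_ext M v = ae_class M (\<lambda>\<omega>. ereal (rep v \<omega>))" "to_ext M b = ae_class M (\<lambda>\<omega>. ereal (rep b \<omega>))"
    using to_ext_ae_class[of "rep v" M] to_ext_ae_class[of "rep b" M] v b by simp_all
  have "cls_add M (cls_add M (scale_ext M (ae_class M t) (f y)) (to_ext M v)) (to_ext M b)
    = ae_class M (\<lambda>\<omega>. ereal (t \<omega>) * rep (f y) \<omega> + ereal (rep v \<omega>) + ereal (rep b \<omega>))"
    unfolding ve using f y t by (simp add: scale_ext_eq del: to_ext_ae_class)
  also have "\<dots> = ae_class M (\<lambda>\<omega>. ereal (t \<omega>) * rep (f y) \<omega> + ereal (rep v \<omega> + rep b \<omega>))"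
    by (rule ae_class_cong) (simp add: add.assoc)
  finally show ?thesis .
qed

lemma L0_plus_plus_iff: "a \<in> borel_measurable M \<Longrightarrow> ae_class M a \<in> L0_plus_plus M \<longleftrightarrow> (AE \<omega> in M. 0 < a \<omega>)"
  by (simp add: L0_plus_plus_def cls_less_ae_class)

lemma ord_auto_imp_formula:
  assumes comp: "rn_complete M E" and full: "full_support M E" and T: "ord_auto T"
  shows "\<exists>c\<in>carrier E. \<exists>w\<in>rn_dual M E. \<exists>\<beta>\<in>carrier (L0 M). \<exists>\<tau>\<in>L0_plus_plus M.
      \<exists>H\<in>cont_automorphisms M E.
        \<forall>f\<in>convex_funs M E. \<forall>x\<in>carrier E.
          T f x = cls_add M (cls_add M (scale_ext M \<tau> (f (H x \<oplus>\<^bsub>E\<^esub> c))) (to_ext M (w x)))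
                            (to_ext M \<beta>)"
proof -
  interpret L: rn_module M "L0 M" by (rule L0_rn_module)
  obtain e where e: "e \<in> carrier E" "AE \<omega> in M. 0 < N e \<omega>" using exists_full_support[OF comp full] by blast
  obtain S where S: "ord_auto S" "\<And>f. f \<in> convex_funs M E \<Longrightarrow> S (T f) = f"
    "\<And>f. f \<in> convex_funs M E \<Longrightarrow> T (S f) = f" using ord_auto_inverse[OF T] by blast
  interpret rn_iso M E S T using S T by unfold_locales
  interpret inv: rn_iso M E T S by (rule swap)
  let ?z = "\<zero>\<^bsub>E\<^esub>"
  define c where "c = phi ?z"
  have c [simp]: "c \<in> carrier E" by (simp add: c_def)
  define H where "H x = phi x \<ominus>\<^bsub>E\<^esub> c" for x
  \<comment> \<open>Inverting the height map \<open>r \<mapsto> tau * r + psi x 0\<close> gives the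
    factor \<open>1 / tau\<close> and the summand \<open>- psi x 0 / tau\<close>. The slope is the
    same at all points, so it is taken at the origin.\<close>
  define t where "t \<omega> = 1 / tau ?z \<omega>" for \<omega>
  have tau [measurable]: "tau ?z \<in> borel_measurable M" by simp
  have t [measurable]: "t \<in> borel_measurable M" unfolding t_def by measurable
  have t0: "AE \<omega> in M. 0 < t \<omega>" using tau_pos[OF M.zero_closed] by eventually_elim (simp add: t_def)
  have pm [measurable]: "psi x (\<lambda>_. 0) \<in> borel_measurable M" if "x \<in> carrier E" for x using that by simp
  define p where "p x = ae_class M (\<lambda>\<omega>. - psi x (\<lambda>_. 0) \<omega> / tau ?z \<omega>)" for x
  have pM: "(\<lambda>\<omega>. - psi x (\<lambda>_. 0) \<omega> / tau ?z \<omega>) \<in> borel_measurable M" if "x \<in> carrier E" for x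
    using pm[OF that] by measurable
  have pc [simp]: "p x \<in> ae_classes M" if "x \<in> carrier E" for x
    unfolding p_def using pM[OF that] by auto
  define w where "w x = p x \<ominus>\<^bsub>L0 M\<^esub> p ?z" for x
  have phiH: "H x \<oplus>\<^bsub>E\<^esub> c = phi x" if "x \<in> carrier E" for x
    using that by (simp add: H_def M.minus_eq M.a_assoc M.l_neg)
  have linH: "lin E H"
  proof -
    have aff: "phi (lc a x (\<lambda>\<omega>. 1 - a \<omega>) y) = lc a (phi x) (\<lambda>\<omega>. 1 - a \<omega>) (phi y)"
      if "x \<in> carrier E" "y \<in> carrier E" "a \<in> borel_measurable M" "\<And>\<omega>. 0 \<le> a \<omega>" "\<And>\<omega>. a \<omega> \<le> 1" for x y a
      using that by (intro affine(1)[OF _ _ _ _ _ e]) auto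
    show ?thesis
      unfolding lin_def H_def c_def
    proof (intro conjI ballI)
      show "phi (x \<oplus>\<^bsub>E\<^esub> y) \<ominus>\<^bsub>E\<^esub> phi ?z = (phi x \<ominus>\<^bsub>E\<^esub> phi ?z) \<oplus>\<^bsub>E\<^esub> (phi y \<ominus>\<^bsub>E\<^esub> phi ?z)"
        if "x \<in> carrier E" "y \<in> carrier E" for x y
        by (rule affine_imp_linear(1)[OF rn_module_axioms phi_closed aff that])
      show "phi (\<xi> \<odot>\<^bsub>E\<^esub> x) \<ominus>\<^bsub>E\<^esub> phi ?z = \<xi> \<odot>\<^bsub>E\<^esub> (phi x \<ominus>\<^bsub>E\<^esub> phi ?z)"
        if "\<xi> \<in> ae_classes M" "x \<in> carrier E" for \<xi> x
        by (rule affine_imp_linear(2)[OF rn_module_axioms phi_closed aff that])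
    qed auto
  qed
  have linw: "lin (L0 M) w"
  proof -
    have aff: "p (lc a x (\<lambda>\<omega>. 1 - a \<omega>) y) = L.lc a (p x) (\<lambda>\<omega>. 1 - a \<omega>) (p y)"
      if xy: "x \<in> carrier E" "y \<in> carrier E" and a: "a \<in> borel_measurable M" "\<And>\<omega>. 0 \<le> a \<omega>" "\<And>\<omega>. a \<omega> \<le> 1" for x y a
    proof -
      have m: "(\<lambda>\<omega>. 1 - a \<omega>) \<in> borel_measurable M" using a(1) by measurable
      have "L.lc a (p x) (\<lambda>\<omega>. 1 - a \<omega>) (p y) = ae_class M (\<lambda>\<omega>. a \<omega> * (- psi x (\<lambda>_. 0) \<omega> / tau ?z \<omega>)
          + (1 - a \<omega>) * (- psi y (\<lambda>_. 0) \<omega> / tau ?z \<omega>))"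
        unfolding p_def by (rule lc_L0[OF a(1) pM[OF xy(1)] m pM[OF xy(2)]])
      also have "\<dots> = p (lc a x (\<lambda>\<omega>. 1 - a \<omega>) y)"
        unfolding p_def
      proof (rule ae_class_cong)
        have "AE \<omega> in M. psi (lc a x (\<lambda>\<omega>. 1 - a \<omega>) y) (\<lambda>_. 0) \<omega> = a \<omega> * psi x (\<lambda>_. 0) \<omega> + (1 - a \<omega>) * psi y (\<lambda>_. 0) \<omega>"
          using xy a by (intro affine(2)[OF _ _ _ _ _ e]) auto
        then show "AE \<omega> in M. a \<omega> * (- psi x (\<lambda>_. 0) \<omega> / tau ?z \<omega>) + (1 - a \<omega>) * (- psi y (\<lambda>_. 0) \<omega> / tau ?z \<omega>)
            = - psi (lc a x (\<lambda>\<omega>. 1 - a \<omega>) y) (\<lambda>_. 0) \<omega> / tau ?z \<omega>"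
        proof eventually_elim
          case (elim \<omega>)
          show ?case unfolding elim by (simp add: add_divide_distrib diff_divide_distrib algebra_simps)
        qed
      qed
      finally show ?thesis by simp
    qed
    have pc': "p x \<in> carrier (L0 M)" if "x \<in> carrier E" for x using pc[OF that] by simp
    show ?thesis
      unfolding lin_def w_def
    proof (intro conjI ballI funcsetI)
      show "p x \<ominus>\<^bsub>L0 M\<^esub> p ?z \<in> carrier (L0 M)" if "x \<in> carrier E" for x
        by (rule R.minus_closed[OF pc'[OF that] pc'[OF M.zero_closed]])
      show "p (x \<oplus>\<^bsub>E\<^esub> y) \<ominus>\<^bsub>L0 M\<^esub> p ?z = (p x \<ominus>\<^bsub>L0 M\<^esub> p ?z) \<oplus>\<^bsub>L0 M\<^esub> (p y \<ominus>\<^bsub>L0 M\<^esub> p ?z)"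
        if "x \<in> carrier E" "y \<in> carrier E" for x y
        by (rule affine_imp_linear(1)[OF L0_rn_module pc' aff that])
      show "p (\<xi> \<odot>\<^bsub>E\<^esub> x) \<ominus>\<^bsub>L0 M\<^esub> p ?z = \<xi> \<odot>\<^bsub>L0 M\<^esub> (p x \<ominus>\<^bsub>L0 M\<^esub> p ?z)"
        if "\<xi> \<in> ae_classes M" "x \<in> carrier E" for \<xi> x
        by (rule affine_imp_linear(2)[OF L0_rn_module pc' aff that])
    qed
  qed
  have wc [simp]: "w x \<in> ae_classes M" if "x \<in> carrier E" for x using lin_closed[OF linw that] by simp
  have rep_w: "AE \<omega> in M. - psi x (\<lambda>_. 0) \<omega> / tau ?z \<omega> = rep (w x) \<omega> + rep (p ?z) \<omega>" if x: "x \<in> carrier E" for x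
  proof -
    have "w x \<oplus>\<^bsub>L0 M\<^esub> p ?z = p x"
      unfolding w_def using pc[OF x] pc[OF M.zero_closed] R.a_assoc[of "p x" "\<ominus>\<^bsub>L0 M\<^esub> p ?z" "p ?z"]
        R.l_neg[of "p ?z"] R.r_zero[of "p x"] R.a_inv_closed[of "p ?z"]
      by (simp add: R.minus_eq del: L0_simps(3,4)) 
    then have "ae_class M (\<lambda>\<omega>. rep (w x) \<omega> + rep (p ?z) \<omega>) = ae_class M (\<lambda>\<omega>. - psi x (\<lambda>_. 0) \<omega> / tau ?z \<omega>)"
      using cls_add_ae_class[OF measurable_rep[OF wc[OF x]] measurable_rep[OF pc[OF M.zero_closed]]] wc[OF x] pc[OF M.zero_closed]
      by (simp add: p_def[of x])
    moreover have "(\<lambda>\<omega>. rep (w x) \<omega> + rep (p ?z) \<omega>) \<in> borel_measurable M"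
      using wc[OF x] pc[OF M.zero_closed] by measurable
    ultimately have "AE \<omega> in M. rep (w x) \<omega> + rep (p ?z) \<omega> = - psi x (\<lambda>_. 0) \<omega> / tau ?z \<omega>"
      using pM[OF x] by (subst (asm) ae_class_eq_iff)
    then show ?thesis by eventually_elim simp
  qed
  have Tf: "AE \<omega> in M. rep (T f x) \<omega> = ereal (t \<omega>) * rep (f (phi x)) \<omega> + ereal (rep (w x) \<omega> + rep (p ?z) \<omega>)"
    if "f \<in> convex_funs M E" "x \<in> carrier E" for f x
    using T_eq[OF e that] rep_w[OF that(2)] by eventually_elim (simp add: t_def)
  have bm: "rep (p ?z) \<in> borel_measurable M" by simp
  \<comment> \<open>The image of the zero function is \<open>w\<close> plus a constant, so its lower
    semicontinuity makes \<open>w\<close> continuous. This precedes \<open>H\<close>, whose argument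
    uses the continuity of \<open>w\<close>.\<close>
  have cw: "w \<in> cont_homs M E (L0 M)"
  proof (rule lsc_lin_continuous[OF comp linw ord_auto_closed[OF T zero_convex_funs] bm])
    fix x assume x: "x \<in> carrier E"
    have "AE \<omega> in M. rep (mkf (\<lambda>x \<omega>. 0) (phi x)) \<omega> = 0" using x by (intro rep_mkf) auto
    with Tf[OF zero_convex_funs x]
    show "AE \<omega> in M. rep (T (mkf (\<lambda>x \<omega>. 0)) x) \<omega> = ereal (rep (w x) \<omega> + rep (p ?z) \<omega>)"
      by eventually_elim simp
  qed
  have cH: "H \<in> cont_homs M E E"
  proof (rule lsc_norm_lin_continuous[OF comp linH cw ord_auto_closed[OF T norm_convex_funs[OF c]] t t0 bm])
    fix x assume x: "x \<in> carrier E"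
    have "AE \<omega> in M. rep (mkf (\<lambda>x \<omega>. ereal (D x c \<omega>)) (phi x)) \<omega> = ereal (D (phi x) c \<omega>)"
      using x by (intro rep_mkf) auto
    moreover have "D (phi x) c = N (H x)" using x by (simp add: H_def D_eq_N)
    ultimately show "AE \<omega> in M. rep (T (mkf (\<lambda>x \<omega>. ereal (D x c \<omega>))) x) \<omega>
        = ereal (t \<omega> * N (H x) \<omega> + rep (w x) \<omega> + rep (p ?z) \<omega>)"
      using Tf[OF norm_convex_funs[OF c] x] by (auto elim: eventually_elim2)
  qed
  \<comment> \<open>The inverse is explicit: translate by \<open>c\<close> and apply the point map
    of the inverse automorphism.\<close>
  have "bij_betw H (carrier E) (carrier E)"
  proof (rule bij_betwI[where g = "\<lambda>y. inv.phi (y \<oplus>\<^bsub>E\<^esub> c)"])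
    show "H \<in> carrier E \<rightarrow> carrier E" by (auto simp: H_def)
    show "inv.phi (H x \<oplus>\<^bsub>E\<^esub> c) = x" if "x \<in> carrier E" for x using that by (simp add: phiH phi_inverse)
    show "H (inv.phi (y \<oplus>\<^bsub>E\<^esub> c)) = y" if "y \<in> carrier E" for y
      using that inv.phi_inverse[of "y \<oplus>\<^bsub>E\<^esub> c"] by (simp add: H_def M.minus_eq M.a_assoc M.r_neg)
  qed auto
  then have H: "H \<in> cont_automorphisms M E" using cH by (simp add: cont_automorphisms_def)
  have tau_pp: "ae_class M t \<in> L0_plus_plus M" using t t0 by (simp add: L0_plus_plus_iff)
  have form: "T f x = cls_add M (cls_add M (scale_ext M (ae_class M t) (f (H x \<oplus>\<^bsub>E\<^esub> c))) (to_ext M (w x))) (to_ext M (p ?z))"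
    if f: "f \<in> convex_funs M E" and x: "x \<in> carrier E" for f x
  proof -
    have "T f x = ae_class M (rep (T f x))" using ord_auto_closed[OF T f] x by simp
    also have "\<dots> = ae_class M (\<lambda>\<omega>. ereal (t \<omega>) * rep (f (phi x)) \<omega> + ereal (rep (w x) \<omega> + rep (p ?z) \<omega>))"
      by (rule ae_class_cong[OF Tf[OF f x]])
    also have "\<dots> = cls_add M (cls_add M (scale_ext M (ae_class M t) (f (phi x))) (to_ext M (w x))) (to_ext M (p ?z))"
      by (rule formula_eq[symmetric, OF f phi_closed[OF x] t wc[OF x] pc[OF M.zero_closed]])
    finally show ?thesis unfolding phiH[OF x] .
  qed
  show ?thesis
  proof (rule bexI[of _ c], rule bexI[of _ w], rule bexI[of _ "p ?z"], rule bexI[of _ "ae_class M t"], rule bexI[of _ H])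
    show "\<forall>f\<in>convex_funs M E. \<forall>x\<in>carrier E. T f x = cls_add M (cls_add M (scale_ext M (ae_class M t)
        (f (H x \<oplus>\<^bsub>E\<^esub> c))) (to_ext M (w x))) (to_ext M (p ?z))"
      using form by blast
    show "w \<in> rn_dual M E" using cw by (simp add: rn_dual_def)
  qed (use H tau_pp in auto)
qed

lemma formula_imp_ord_auto:
  assumes comp: "rn_complete M E" and T: "T \<in> convex_funs M E \<rightarrow> convex_funs M E"
    and c [simp]: "c \<in> carrier E" and w: "w \<in> rn_dual M E" and \<beta>: "\<beta> \<in> carrier (L0 M)"
    and \<tau>: "\<tau> \<in> L0_plus_plus M" and H: "H \<in> cont_automorphisms M E"
    and form: "\<And>f x. f \<in> convex_funs M E \<Longrightarrow> x \<in> carrier E \<Longrightarrow>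
      T f x = cls_add M (cls_add M (scale_ext M \<tau> (f (H x \<oplus>\<^bsub>E\<^esub> c))) (to_ext M (w x))) (to_ext M \<beta>)"
  shows "stable_op M E T \<and> fully_order_preserving M E T"
proof -
  interpret L: rn_module M "L0 M" by (rule L0_rn_module)
  obtain t where t [measurable]: "t \<in> borel_measurable M" and \<tau>_eq: "\<tau> = ae_class M t" and t0: "AE \<omega> in M. 0 < t \<omega>"
    using \<tau> by (auto simp: L0_plus_plus_def cls_less_ae_class elim!: ae_classesE)
  have cw: "w \<in> cont_homs M E (L0 M)" using w by (simp add: rn_dual_def)
  note lw = cont_homs_lin[OF cw]
  have wc [simp]: "w x \<in> ae_classes M" if "x \<in> carrier E" for x using lin_closed[OF lw that] by simp
  have bc [simp]: "\<beta> \<in> ae_classes M" using \<beta> by simp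
  have bm [measurable]: "rep \<beta> \<in> borel_measurable M" by simp
  have cH: "H \<in> cont_homs M E E" and bij: "bij_betw H (carrier E) (carrier E)"
    using H by (auto simp: cont_automorphisms_def)
  have Hc [simp]: "H x \<in> carrier E" if "x \<in> carrier E" for x using lin_closed[OF cont_homs_lin[OF cH] that] .
  let ?q = "\<lambda>x. H x \<oplus>\<^bsub>E\<^esub> c"
  let ?b = "\<lambda>x \<omega>. rep (w x) \<omega> + rep \<beta> \<omega>"
  have Tc: "T f \<in> convex_funs M E" if "f \<in> convex_funs M E" for f using T that by blast
  have bxm: "?b x \<in> borel_measurable M" if "x \<in> carrier E" for x using wc[OF that] by measurable
  have Tf: "AE \<omega> in M. rep (T f x) \<omega> = ereal (t \<omega>) * rep (f (?q x)) \<omega> + ereal (?b x \<omega>)"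
    if f: "f \<in> convex_funs M E" and x: "x \<in> carrier E" for f x
  proof -
    have q: "?q x \<in> carrier E" using x by simp
    have "rep (f (?q x)) \<in> borel_measurable M" by (rule convex_funs_measurable[OF f q])
    then have m: "(\<lambda>\<omega>. ereal (t \<omega>) * rep (f (?q x)) \<omega> + ereal (?b x \<omega>)) \<in> borel_measurable M"
      using bxm[OF x] by measurable
    have "T f x = ae_class M (\<lambda>\<omega>. ereal (t \<omega>) * rep (f (?q x)) \<omega> + ereal (?b x \<omega>))"
      unfolding form[OF f x] \<tau>_eq by (rule formula_eq[OF f q t wc[OF x] bc])
    then show ?thesis using rep_ae_class[OF m] by simp
  qed
  let ?K = "inv_into (carrier E) H"
  have cK: "?K \<in> cont_homs M E E" by (rule cont_automorphism_inverse[OF comp H])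
  note lK = cont_homs_lin[OF cK]
  note Kc [simp] = lin_closed[OF lK]
  have HK: "H (?K y) = y" if "y \<in> carrier E" for y using bij that by (simp add: bij_betw_inv_into_right)
  have KH: "?K (H x) = x" if "x \<in> carrier E" for x using bij that by (simp add: bij_betw_inv_into_left)
  \<comment> \<open>The inverse of the substitution \<open>?q\<close>. Its continuity, which keeps
    the composition with \<open>g\<close> lower semicontinuous, comes from the inverse theorem for
    \<open>H\<close>.\<close>
  define P where "P y = ?K (y \<ominus>\<^bsub>E\<^esub> c)" for y
  have Pc [simp]: "P y \<in> carrier E" if "y \<in> carrier E" for y using that by (simp add: P_def)
  have qP: "?q (P y) = y" if "y \<in> carrier E" for y
    using that by (simp add: P_def HK M.minus_eq M.a_assoc M.l_neg)
  have Pq: "P (?q x) = x" if "x \<in> carrier E" for x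
    using that by (simp add: P_def KH M.minus_eq M.a_assoc M.r_neg)
  have stable: "stable_op M E T"
    unfolding stable_op_def
  proof (intro ballI)
    fix A f g assume A: "A \<in> sets M" and f: "f \<in> convex_funs M E" and g: "g \<in> convex_funs M E"
    note gl = glue_convex_funs[OF f g A]
    show "T (glue M E A f g) = glue M E A (T f) (T g)"
    proof (rule convex_funs_eqI[OF Tc[OF gl] glue_convex_funs[OF Tc[OF f] Tc[OF g] A]])
      fix x assume x: "x \<in> carrier E"
      then have q: "?q x \<in> carrier E" by simp
      show "AE \<omega> in M. rep (T (glue M E A f g) x) \<omega> = rep (glue M E A (T f) (T g) x) \<omega>"
        using Tf[OF gl x] Tf[OF f x] Tf[OF g x] rep_glue[OF f g A q] rep_glue[OF Tc[OF f] Tc[OF g] A x]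
        by eventually_elim simp
    qed
  qed
  have arith: "ereal c * F + ereal p \<le> ereal c * G + ereal p \<longleftrightarrow> F \<le> G"
    if "0 < c" "- \<infinity> < F" "- \<infinity> < G" for c p and F G :: ereal
    using that by (cases F; cases G) auto
  have order: "fun_le M E f g \<longleftrightarrow> fun_le M E (T f) (T g)"
    if f: "f \<in> convex_funs M E" and g: "g \<in> convex_funs M E" for f g
  proof -
    have *: "(AE \<omega> in M. rep (T f x) \<omega> \<le> rep (T g x) \<omega>) \<longleftrightarrow> (AE \<omega> in M. rep (f (?q x)) \<omega> \<le> rep (g (?q x)) \<omega>)"
      if x: "x \<in> carrier E" for x
    proof (rule eventually_subst)
      have q: "?q x \<in> carrier E" using x by simp
      show "AE \<omega> in M. rep (T f x) \<omega> \<le> rep (T g x) \<omega> \<longleftrightarrow> rep (f (?q x)) \<omega> \<le> rep (g (?q x)) \<omega>"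
        using Tf[OF f x] Tf[OF g x] t0 convex_funs_proper[OF f q] convex_funs_proper[OF g q]
        by eventually_elim (simp only: arith)
    qed
    show ?thesis
      unfolding fun_le_iff
    proof (intro iffI ballI)
      fix x assume "\<forall>x\<in>carrier E. AE \<omega> in M. rep (f x) \<omega> \<le> rep (g x) \<omega>" "x \<in> carrier E"
      then show "AE \<omega> in M. rep (T f x) \<omega> \<le> rep (T g x) \<omega>" using * by simp
    next
      fix y assume "\<forall>x\<in>carrier E. AE \<omega> in M. rep (T f x) \<omega> \<le> rep (T g x) \<omega>" and y: "y \<in> carrier E"
      then have "AE \<omega> in M. rep (T f (P y)) \<omega> \<le> rep (T g (P y)) \<omega>" by simp
      then show "AE \<omega> in M. rep (f y) \<omega> \<le> rep (g y) \<omega>" using *[of "P y"] qP[OF y] y by simp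
    qed
  qed
  have "\<exists>f\<in>convex_funs M E. T f = g" if g: "g \<in> convex_funs M E" for g
  proof -
    \<comment> \<open>Obtained by solving \<open>T f = g\<close> for \<open>f\<close> at
      \<open>y = ?q x\<close>, that is, \<open>f y = (g (P y) - ?b (P y)) / t\<close>.\<close>
    let ?V = "\<lambda>y \<omega>. - ?b (P y) \<omega> / t \<omega>"
    let ?F = "\<lambda>y \<omega>. ereal (1 / t \<omega>) * rep (g (P y)) \<omega> + ereal (?V y \<omega>)"
    have affP: "P (lc a x (\<lambda>\<omega>. 1 - a \<omega>) y) = lc a (P x) (\<lambda>\<omega>. 1 - a \<omega>) (P y)"
      if xy: "x \<in> carrier E" "y \<in> carrier E" and a: "a \<in> borel_measurable M" for x y a
    proof -
      have m: "(\<lambda>\<omega>. 1 - a \<omega>) \<in> borel_measurable M" using a by measurable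
      show ?thesis
        unfolding P_def M.minus_eq lc_shift[OF a xy M.a_inv_closed[OF c]]
        using xy by (intro lin_lc[OF lK rn_module_axioms a m]) auto
    qed
    have f: "mkf ?F \<in> convex_funs M E"
    proof (rule affine_transform_convex_funs[OF g])
      show "(\<lambda>\<omega>. 1 / t \<omega>) \<in> borel_measurable M" by measurable
      show "AE \<omega> in M. 0 < 1 / t \<omega>" using t0 by eventually_elim simp
      show "?V y \<in> borel_measurable M" if "y \<in> carrier E" for y
        using bxm[OF Pc[OF that]] by measurable
      show "\<exists>x\<in>carrier E. P x = y" if "y \<in> carrier E" for y
        using Pq[OF that] that by (intro bexI[of _ "?q y"]) auto
      show "AE \<omega> in M. ?V (lc a x (\<lambda>\<omega>. 1 - a \<omega>) y) \<omega> = a \<omega> * ?V x \<omega> + (1 - a \<omega>) * ?V y \<omega>"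
        if xy: "x \<in> carrier E" "y \<in> carrier E" and a: "a \<in> borel_measurable M" for x y a
      proof -
        have m: "(\<lambda>\<omega>. 1 - a \<omega>) \<in> borel_measurable M" using a by measurable
        have "w (P (lc a x (\<lambda>\<omega>. 1 - a \<omega>) y)) = L.lc a (w (P x)) (\<lambda>\<omega>. 1 - a \<omega>) (w (P y))"
          unfolding affP[OF xy a] by (rule lin_lc[OF lw L0_rn_module a m Pc[OF xy(1)] Pc[OF xy(2)]])
        then have "AE \<omega> in M. rep (w (P (lc a x (\<lambda>\<omega>. 1 - a \<omega>) y))) \<omega>
            = a \<omega> * rep (w (P x)) \<omega> + (1 - a \<omega>) * rep (w (P y)) \<omega>"
          using rep_L0_lc[OF a m wc[OF Pc[OF xy(1)]] wc[OF Pc[OF xy(2)]]] by simp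
        then show ?thesis
        proof eventually_elim
          case (elim \<omega>)
          show ?case unfolding elim by (simp add: add_divide_distrib diff_divide_distrib algebra_simps)
        qed
      qed
      show "AE \<omega> in M. D x y \<omega> = 0 \<longrightarrow> D (P x) (P y) \<omega> = 0 \<and> ?V x \<omega> = ?V y \<omega>"
        if xy: "x \<in> carrier E" "y \<in> carrier E" for x y
      proof -
        have "AE \<omega> in M. D (x \<ominus>\<^bsub>E\<^esub> c) (y \<ominus>\<^bsub>E\<^esub> c) \<omega> = 0 \<longrightarrow> D (P x) (P y) \<omega> = 0"
          unfolding P_def using xy by (intro lin_local[OF lK rn_module_axioms]) auto
        moreover have "D (x \<ominus>\<^bsub>E\<^esub> c) (y \<ominus>\<^bsub>E\<^esub> c) = D x y"
          using xy by (simp add: M.minus_eq D_shift)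
        moreover have "AE \<omega> in M. D (P x) (P y) \<omega> = 0 \<longrightarrow> L.D (w (P x)) (w (P y)) \<omega> = 0"
          using xy by (intro lin_local[OF lw L0_rn_module]) auto
        moreover have "AE \<omega> in M. L.D (w (P x)) (w (P y)) \<omega> = \<bar>rep (w (P x)) \<omega> - rep (w (P y)) \<omega>\<bar>"
          using D_L0[OF measurable_rep[OF wc[OF Pc[OF xy(1)]]] measurable_rep[OF wc[OF Pc[OF xy(2)]]]] xy by simp
        ultimately show ?thesis by (simp only:) (elim AE_mp, auto intro!: AE_I2)
      qed
      show "\<exists>r::nat \<Rightarrow> nat. strict_mono r \<and> (AE \<omega> in M. (\<lambda>n. D (P (xs (r n))) (P x) \<omega>) \<longlonglongrightarrow> 0) \<and>
          (AE \<omega> in M. (\<lambda>n. ?V (xs (r n)) \<omega>) \<longlonglongrightarrow> ?V x \<omega>)"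
        if xs: "\<And>n. xs n \<in> carrier E" and x: "x \<in> carrier E" and lim: "AE \<omega> in M. (\<lambda>n. D (xs n) x \<omega>) \<longlonglongrightarrow> 0" for xs x
      proof -
        have sh: "D (y \<ominus>\<^bsub>E\<^esub> c) (z \<ominus>\<^bsub>E\<^esub> c) = D y z" if "y \<in> carrier E" "z \<in> carrier E" for y z
          using that by (simp add: M.minus_eq D_shift)
        have "(\<lambda>n. dst (xs n \<ominus>\<^bsub>E\<^esub> c) (x \<ominus>\<^bsub>E\<^esub> c)) \<longlonglongrightarrow> 0"
          using lim xs x by (intro dst_tendsto_AE) (simp_all add: sh)
        then have "(\<lambda>n. dst (P (xs n)) (P x)) \<longlonglongrightarrow> 0"
          unfolding P_def using xs x by (intro cont_hom_tendsto[OF cK rn_module_axioms]) auto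
        then obtain r1 :: "nat \<Rightarrow> nat" where r1: "strict_mono r1" 
          and P1: "AE \<omega> in M. (\<lambda>n. D (P (xs (r1 n))) (P x) \<omega>) \<longlonglongrightarrow> 0"
          using dst_AE_subseq[of "\<lambda>n. P (xs n)" "P x"] xs x by auto
        \<comment> \<open>A second subsequence is extracted for the functional; the limit along the
          first one survives.\<close>
        have "(\<lambda>n. dst (P (xs (r1 n))) (P x)) \<longlonglongrightarrow> 0" using P1 xs x by (intro dst_tendsto_AE) auto
        then obtain r2 :: "nat \<Rightarrow> nat" where r2: "strict_mono r2"
          and w2: "AE \<omega> in M. (\<lambda>n. rep (w (P (xs (r1 (r2 n))))) \<omega>) \<longlonglongrightarrow> rep (w (P x)) \<omega>"
          using cont_functional_subseq[OF cw, of "\<lambda>n. P (xs (r1 n))" "P x"] xs x by auto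
        have "AE \<omega> in M. (\<lambda>n. D (P (xs (r1 (r2 n)))) (P x) \<omega>) \<longlonglongrightarrow> 0"
          using P1
        proof eventually_elim
          case (elim \<omega>)
          from LIMSEQ_subseq_LIMSEQ[OF elim r2] show ?case by (simp add: o_def)
        qed
        moreover have "AE \<omega> in M. (\<lambda>n. ?V (xs (r1 (r2 n))) \<omega>) \<longlonglongrightarrow> ?V x \<omega>"
          using w2 t0
        proof eventually_elim
          case (elim \<omega>)
          then show ?case by (intro tendsto_intros) auto
        qed
        moreover have "strict_mono (\<lambda>n. r1 (r2 n))" using strict_mono_o[OF r1 r2] by (simp add: o_def)
        ultimately show ?thesis by (intro exI[of _ "\<lambda>n. r1 (r2 n)"]) simp
      qed
    qed (use affP in auto)
    have "T (mkf ?F) = g"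
    proof (rule convex_funs_eqI[OF Tc[OF f] g])
      fix x assume x: "x \<in> carrier E"
      have q: "?q x \<in> carrier E" using x by simp
      have Fm: "?F (?q x) \<in> borel_measurable M"
        using convex_funs_measurable[OF g Pc[OF q]] bxm[OF Pc[OF q]] by measurable
      show "AE \<omega> in M. rep (T (mkf ?F) x) \<omega> = rep (g x) \<omega>"
        using Tf[OF f x] rep_mkf[of "?q x" ?F, OF q Fm] t0 convex_funs_proper[OF g x] unfolding Pq[OF x]
      proof eventually_elim
        case (elim \<omega>)
        then show ?case by (cases "rep (g x) \<omega>") (auto simp: field_simps)
      qed
    qed
    then show ?thesis using f by blast
  qed
  then have "T ` convex_funs M E = convex_funs M E" using Tc by blast
  then show ?thesis using stable order by (simp add: fully_order_preserving_def)
qed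

end

theorem theorem1:
  fixes M :: "'w measure"
    and E :: "(('w \<Rightarrow> real) set, 'e) normed_module"
    and T :: "('e \<Rightarrow> ('w \<Rightarrow> ereal) set) \<Rightarrow> 'e \<Rightarrow> ('w \<Rightarrow> ereal) set"
  assumes "rn_module M E"
    and "rn_complete M E"
    and "full_support M E"
    and "T \<in> convex_funs M E \<rightarrow> convex_funs M E"
  shows "stable_op M E T \<and> fully_order_preserving M E T \<longleftrightarrow>
    (\<exists>c\<in>carrier E. \<exists>w\<in>rn_dual M E. \<exists>\<beta>\<in>carrier (L0 M). \<exists>\<tau>\<in>L0_plus_plus M.
      \<exists>H\<in>cont_automorphisms M E.
        \<forall>f\<in>convex_funs M E. \<forall>x\<in>carrier E.
          T f x = cls_add M (cls_add M (scale_ext M \<tau> (f (H x \<oplus>\<^bsub>E\<^esub> c))) (to_ext M (w x)))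
                            (to_ext M \<beta>))"
proof
  interpret rn_module M E by fact
  {
    assume "stable_op M E T \<and> fully_order_preserving M E T"
    then have "ord_auto T" using assms(4) by (simp add: ord_auto_def)
    then show "\<exists>c\<in>carrier E. \<exists>w\<in>rn_dual M E. \<exists>\<beta>\<in>carrier (L0 M). \<exists>\<tau>\<in>L0_plus_plus M.
      \<exists>H\<in>cont_automorphisms M E.
        \<forall>f\<in>convex_funs M E. \<forall>x\<in>carrier E.
          T f x = cls_add M (cls_add M (scale_ext M \<tau> (f (H x \<oplus>\<^bsub>E\<^esub> c))) (to_ext M (w x)))
                            (to_ext M \<beta>)"
      by (rule ord_auto_imp_formula[OF assms(2,3)])
  next
    assume "\<exists>c\<in>carrier E. \<exists>w\<in>rn_dual M E. \<exists>\<beta>\<in>carrier (L0 M). \<exists>\<tau>\<in>L0_plus_plus M.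
      \<exists>H\<in>cont_automorphisms M E.
        \<forall>f\<in>convex_funs M E. \<forall>x\<in>carrier E.
          T f x = cls_add M (cls_add M (scale_ext M \<tau> (f (H x \<oplus>\<^bsub>E\<^esub> c))) (to_ext M (w x)))
                            (to_ext M \<beta>)"
    then show "stable_op M E T \<and> fully_order_preserving M E T"
      by (elim bexE) (rule formula_imp_ord_auto[OF assms(2,4)]; blast)
  }
qed

end
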